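(* Let $A \in \mathbb{R}^{m\times n}$ and $B\in \mathbb{R}^{l\times n}$. If $B$ is injective, or more generally if $\operatorname{Ker}(B) \subseteq \operatorname{Ker}(A)$, then $$\max_{\|B v\|_2\leq 1}\|A v\|_2 = \|A B^+\|_{2\mapsto 2},$$ which can be evaluated in polynomial time with respect to $l$, $m$, and $n$. Instead, if $\operatorname{Ker}(B) \not\subseteq \operatorname{Ker}(A)$, $$\max_{\|B v\|_2\leq 1}\|A v\|_2 = \infty.$$
   Context: The maxima are over $v\in\mathbb{R}^n$; the value $\infty$ means that the problem is unbounded. $B^+$ is the Moore–Penrose pseudoinverse of $B$, and $\|M\|_{2\mapsto 2} := \max_{\|x\|_2\le 1}\|Mx\|_2$ is the spectral norm. A matrix is called injective if the linear map it represents is injective. *)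

theory Defs
  imports Complex_Main "HOL-Library.Extended_Real" "Jordan_Normal_Form.Matrix_Kernel"
begin

section \<open>Norms, maxima and the pseudoinverse\<close>

definition norm2 :: "real vec \<Rightarrow> real" where
  "norm2 v = sqrt (v \<bullet> v)"

text \<open>A finite maximum is required to be attained; the value \<open>\<infinity>\<close> means that the set of objective
  values is unbounded above.\<close>

definition is_max_value :: "real set \<Rightarrow> ereal \<Rightarrow> bool" where
  "is_max_value S c \<longleftrightarrow>
     (c = \<infinity> \<and> \<not> bdd_above S) \<or> (\<exists>r\<in>S. c = ereal r \<and> (\<forall>s\<in>S. s \<le> r))"

definition objective_values :: "real mat \<Rightarrow> real mat \<Rightarrow> real set" where
  "objective_values A B =
     {norm2 (A *\<^sub>v v) |v. v \<in> carrier_vec (dim_col A) \<and> norm2 (B *\<^sub>v v) \<le> 1}"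

definition spectral_norm :: "real mat \<Rightarrow> real" where
  "spectral_norm M =
     (GREATEST r. r \<in> {norm2 (M *\<^sub>v x) |x. x \<in> carrier_vec (dim_col M) \<and> norm2 x \<le> 1})"

definition injective_mat :: "real mat \<Rightarrow> bool" where
  "injective_mat B \<longleftrightarrow> inj_on (\<lambda>v. B *\<^sub>v v) (carrier_vec (dim_col B))"

text \<open>The four Penrose conditions, which determine \<open>X\<close> uniquely.\<close>

definition is_pseudoinverse :: "real mat \<Rightarrow> real mat \<Rightarrow> bool" where
  "is_pseudoinverse B X \<longleftrightarrow>
     X \<in> carrier_mat (dim_col B) (dim_row B) \<and>
     B * X * B = B \<and> X * B * X = X \<and>
     transpose_mat (B * X) = B * X \<and> transpose_mat (X * B) = X * B"

definition pinv :: "real mat \<Rightarrow> real mat" where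
  "pinv B = (THE X. is_pseudoinverse B X)"

section \<open>Polynomial time on a real random access machine\<close>

text \<open>
  Running time is measured as usual for algorithms on real matrices: exact field operations and
  comparisons of real numbers have unit cost (the Blum-Shub-Smale model, here as a random access
  machine with a fixed structured program). A state consists of index registers with values in
  the natural numbers and an array of real cells, which are addressed only indirectly through
  index registers. Index arithmetic is limited to addition and truncated subtraction, so \<open>T\<close>
  steps produce indices of only \<open>O(T)\<close> additional bits and unit cost hides nothing. Programs
  contain no real constants except integers. The only transfer of information from real cells to
  index registers is through the branching on comparisons.
\<close>

type_synonym state = "(nat \<Rightarrow> nat) \<times> (nat \<Rightarrow> real)"

datatype rop = Plus | Minus | Times | Divide

fun rop_val :: "rop \<Rightarrow> real \<Rightarrow> real \<Rightarrow> real" where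
  "rop_val Plus x y = x + y"
| "rop_val Minus x y = x - y"
| "rop_val Times x y = x * y"
| "rop_val Divide x y = x / y"

datatype test =
    ILess nat nat
  | RLess nat nat

fun holds :: "test \<Rightarrow> state \<Rightarrow> bool" where
  "holds (ILess a b) (I, R) \<longleftrightarrow> I a < I b"
| "holds (RLess a b) (I, R) \<longleftrightarrow> R (I a) < R (I b)"

datatype com =
    Skip
  | IConst nat nat
  | IAdd nat nat nat
  | ISub nat nat nat
  | RConst nat int
  | RCopy nat nat
  | ROp rop nat nat nat
  | Seq com com
  | Cond test com com
  | While test com

text \<open>\<open>exec c s t s'\<close>: started in \<open>s\<close>, program \<open>c\<close> halts in \<open>s'\<close> after \<open>t\<close> steps. There is no rule
  for division by zero, that is, the machine gets stuck.\<close>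

inductive exec :: "com \<Rightarrow> state \<Rightarrow> nat \<Rightarrow> state \<Rightarrow> bool" where
  "exec Skip s 1 s"
| "exec (IConst a k) (I, R) 1 (I(a := k), R)"
| "exec (IAdd a b c) (I, R) 1 (I(a := I b + I c), R)"
| "exec (ISub a b c) (I, R) 1 (I(a := I b - I c), R)"
| "exec (RConst a z) (I, R) 1 (I, R(I a := real_of_int z))"
| "exec (RCopy a b) (I, R) 1 (I, R(I a := R (I b)))"
| "(f = Divide \<Longrightarrow> R (I c) \<noteq> 0) \<Longrightarrow>
     exec (ROp f a b c) (I, R) 1 (I, R(I a := rop_val f (R (I b)) (R (I c))))"
| "exec c1 s t1 s' \<Longrightarrow> exec c2 s' t2 s'' \<Longrightarrow> exec (Seq c1 c2) s (t1 + t2) s''"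
| "holds b s \<Longrightarrow> exec c1 s t s' \<Longrightarrow> exec (Cond b c1 c2) s (t + 1) s'"
| "\<not> holds b s \<Longrightarrow> exec c2 s t s' \<Longrightarrow> exec (Cond b c1 c2) s (t + 1) s'"
| "\<not> holds b s \<Longrightarrow> exec (While b c) s 1 s"
| "holds b s \<Longrightarrow> exec c s t1 s' \<Longrightarrow> exec (While b c) s' t2 s'' \<Longrightarrow>
     exec (While b c) s (t1 + t2 + 1) s''"

text \<open>Input: index registers 0, 1, 2, 3 hold \<open>l\<close>, \<open>m\<close>, \<open>n\<close> and the precision \<open>k\<close>; the real cells
  from 0 on hold the entries of \<open>A\<close>, row by row, followed by those of \<open>B\<close>, row by row. Everything
  else is zero. Output: real cell 0.\<close>

definition input_state :: "nat \<Rightarrow> real mat \<Rightarrow> real mat \<Rightarrow> state" where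
  "input_state k A B =
     (let l = dim_row B; m = dim_row A; n = dim_col A in
       ((\<lambda>_. 0)(0 := l, 1 := m, 2 := n, 3 := k),
        (\<lambda>i. if i < m * n then A $$ (i div n, i mod n)
             else if i < (m + l) * n then B $$ ((i - m * n) div n, (i - m * n) mod n)
             else 0)))"

definition output_value :: "state \<Rightarrow> real" where
  "output_value s = snd s 0"

text \<open>
  A spectral norm is the square root of an eigenvalue and in general not obtainable exactly from
  the entries by finitely many field operations. As usual in numerical linear algebra,
  evaluating a real quantity means computing it to any prescribed relative accuracy
  \<open>2\<^sup>-\<^sup>k\<close>, with time also polynomial in the number \<open>k\<close> of requested bits. The bound is uniform over all real
  entries of the matrices, and one and the same program serves all dimensions and accuracies. A
  function of \<open>l, m, n, k\<close> is polynomially bounded iff it is at most \<open>d * (l + m + n + k + 1) ^ d\<close>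
  for some \<open>d\<close>.
\<close>

definition poly_time_evaluable ::
    "(real mat \<Rightarrow> real mat \<Rightarrow> bool) \<Rightarrow> (real mat \<Rightarrow> real mat \<Rightarrow> real) \<Rightarrow> bool" where
  "poly_time_evaluable P f \<longleftrightarrow>
     (\<exists>prog d. \<forall>l m n k. \<forall>A\<in>carrier_mat m n. \<forall>B\<in>carrier_mat l n. P A B \<longrightarrow>
        (\<exists>t s. exec prog (input_state k A B) t s \<and>
               t \<le> d * (l + m + n + k + 1) ^ d \<and>
               \<bar>output_value s - f A B\<bar> \<le> \<bar>f A B\<bar> / 2 ^ k))"

end

theory Submission
  imports Defs "HOL-Library.Nat_Bijection"
begin

text \<open>
  Write \<open>B\<^sup>+\<close> for the pseudoinverse. If \<open>Ker B \<subseteq> Ker A\<close>, then \<open>A v = A B\<^sup>+ (B v)\<close> for every \<open>v\<close>,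
  and \<open>B B\<^sup>+\<close> is an orthogonal projection and therefore does not increase norms. So the
  substitutions \<open>x = B v\<close> and \<open>v = B\<^sup>+ x\<close> carry the values of the constrained problem to those of
  \<open>\<parallel>A B\<^sup>+ x\<parallel>\<close> on the unit ball and back: the two sets of values coincide
  (\<open>objective_values_eq_ball_values\<close>), and a maximum exists by compactness (\<open>max_on_unit_ball\<close>).
  If some \<open>v \<in> Ker B\<close> has \<open>A v \<noteq> 0\<close>, all multiples of \<open>v\<close> are feasible and the problem is
  unbounded (\<open>unbounded_objective\<close>).

  The complexity claim needs an algorithm whose running time does not depend on the magnitude of
  the real entries. The number \<open>F = \<parallel>A B\<^sup>+\<parallel>\<close> is the least \<open>t \<ge> 0\<close> with \<open>\<parallel>A v\<parallel> \<le> t \<parallel>B v\<parallel>\<close> for all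
  \<open>v\<close> (\<open>least_bound_spectral_norm\<close>), and it is located by bisection. A real machine cannot
  extract square roots of numbers of unknown size in bounded time, so the start of the bisection
  matters: it must be a rational expression of degree one in \<open>A\<close> and minus one in \<open>B\<close> that exceeds
  \<open>F\<close> by a bounded factor only. Column operations, applied to \<open>A\<close> and \<open>B\<close> simultaneously, do not
  change \<open>F\<close>; after a Gram-Schmidt process the columns \<open>b\<^sub>c\<close> of \<open>B\<close> are orthogonal, and
  the sum of all \<open>\<bar>A\<^sub>r\<^sub>c B\<^sub>s\<^sub>c\<bar> / \<parallel>b\<^sub>c\<parallel>\<^sup>2\<close>, taken over the indices \<open>c\<close>, \<open>r\<close> and \<open>s\<close>, lies between \<open>F\<close> and
  \<open>n m l F\<close> (\<open>ratio_bound_entry_sum\<close>, \<open>entry_sum_le\<close>). Starting from the interval from \<open>0\<close> to this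
  sum, \<open>k + l + m + n\<close> halvings reach the relative accuracy \<open>2\<^sup>-\<^sup>k\<close>, because \<open>n m l \<le> 2\<^sup>n\<^sup>+\<^sup>m\<^sup>+\<^sup>l\<close>.
  A midpoint \<open>t\<close> is compared with \<open>F\<close> without error: up to the treatment of zero columns, \<open>F < t\<close>
  means that \<open>t\<^sup>2 B\<^sup>T B - A\<^sup>T A\<close> is positive definite in the new coordinates, which is read off the
  pivots of symmetric elimination (\<open>pd_from_pivot\<close>,
  \<open>pd_from_eliminate\<close>).

  To run this on the random access machine, the algorithm is written in a small language of
  whole-matrix assignments and bounded loops with a total, functional semantics, and the language
  is compiled. All index expressions have values linear in the input dimensions and \<open>k\<close>, so
  every program of the language runs in polynomial time, by induction on its syntax
  (\<open>cmd_code_correct\<close>, \<open>program_code_correct\<close>); only functional correctness has to be proved for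
  the algorithm itself (\<open>norm_cmd_correct\<close>).
\<close>

section \<open>Column operations and Gram-Schmidt orthogonalisation\<close>

text \<open>A matrix is a function of a row and a column index here, and its dimensions are explicit
  parameters, so that a matrix in the memory of a program can be used directly.\<close>

definition lin :: "nat \<Rightarrow> (nat \<Rightarrow> nat \<Rightarrow> real) \<Rightarrow> (nat \<Rightarrow> real) \<Rightarrow> nat \<Rightarrow> real" where
  "lin n K x r = (\<Sum>c<n. K r c * x c)"

text \<open>The statement that the first \<open>h\<close> rows of both matrices have the same column space. For the
  matrix that consists of \<open>A\<close> on top of \<open>B\<close>, this is the space of all pairs \<open>(A v, B v)\<close>, and
  the norm in question depends on nothing else.\<close>

definition same_range :: "nat \<Rightarrow> nat \<Rightarrow> (nat \<Rightarrow> nat \<Rightarrow> real) \<Rightarrow> (nat \<Rightarrow> nat \<Rightarrow> real) \<Rightarrow> bool" where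
  "same_range h n K K' \<longleftrightarrow> (\<forall>x. \<exists>y. \<forall>r<h. lin n K' y r = lin n K x r) \<and>
     (\<forall>x. \<exists>y. \<forall>r<h. lin n K y r = lin n K' x r)"

lemma same_range_refl: "same_range h n K K"
  unfolding same_range_def by blast

lemma same_range_trans: "same_range h n K K' \<Longrightarrow> same_range h n K' K'' \<Longrightarrow> same_range h n K K''"
  unfolding same_range_def by metis

lemma lin_upd:
  assumes "i < n"
  shows "lin n K (x(i := z)) r = lin n K x r + K r i * (z - x i)"
proof -
  have "(\<Sum>c<n. K r c * (x(i := z)) c) = K r i * z + (\<Sum>c\<in>{..<n} - {i}. K r c * x c)"
    using assms by (subst sum.remove[of _ i]) (auto intro!: sum.cong)
  moreover have "(\<Sum>c<n. K r c * x c) = K r i * x i + (\<Sum>c\<in>{..<n} - {i}. K r c * x c)"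
    using assms by (subst sum.remove[of _ i]) auto
  ultimately show ?thesis by (simp add: lin_def algebra_simps)
qed

lemma lin_unit: "c < n \<Longrightarrow> lin n K (\<lambda>j. if j = c then 1 else 0) r = K r c"
  by (simp add: lin_def if_distrib[of "\<lambda>z. _ * z"] cong: if_cong)

text \<open>Subtracting multiples of column \<open>i\<close> from the other columns amounts to an invertible change of
  the \<open>i\<close>-th coordinate; its inverse has the same form since \<open>q i = 0\<close>.\<close>

lemma same_range_column_op:
  assumes i: "i < n" "q i = 0" and K': "\<And>r c. r < h \<Longrightarrow> c < n \<Longrightarrow> K' r c = K r c - q c * K r i"
  shows "same_range h n K K'"
proof -
  define S where "S = (\<lambda>x. \<Sum>c<n. q c * x c)"
  have lin': "lin n K' x r = lin n K x r - S x * K r i" if "r < h" for x r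
  proof -
    have "lin n K' x r = (\<Sum>c<n. K r c * x c - (q c * x c) * K r i)"
      unfolding lin_def by (intro sum.cong refl) (simp add: K' that algebra_simps)
    then show ?thesis by (simp add: lin_def S_def sum_subtractf sum_distrib_right)
  qed
  have S: "S (x(i := z)) = S x" for x z
    unfolding S_def using i by (intro sum.cong) auto
  show ?thesis unfolding same_range_def
  proof (intro conjI allI)
    fix x
    show "\<exists>y. \<forall>r<h. lin n K' y r = lin n K x r"
    proof (intro exI[of _ "x(i := x i + S x)"] allI impI)
      fix r assume "r < h"
      then show "lin n K' (x(i := x i + S x)) r = lin n K x r"
        unfolding lin'[OF \<open>r < h\<close>] S using i by (simp add: lin_upd)
    qed
    show "\<exists>y. \<forall>r<h. lin n K y r = lin n K' x r"
      by (rule exI[of _ "x(i := x i - S x)"]) (use i in \<open>auto simp: lin' lin_upd ac_simps\<close>)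
  qed
qed

text \<open>The inner products of columns refer to the rows \<open>m, \<dots>, m + l - 1\<close> only, which hold \<open>B\<close>; the
  rows above hold \<open>A\<close> and take part in the column operations passively.\<close>

definition ip :: "nat \<Rightarrow> nat \<Rightarrow> (nat \<Rightarrow> nat \<Rightarrow> real) \<Rightarrow> nat \<Rightarrow> nat \<Rightarrow> real" where
  "ip m l K c c' = (\<Sum>s<l. K (m + s) c * K (m + s) c')"

lemma ip_commute: "ip m l K c c' = ip m l K c' c"
  by (simp add: ip_def mult.commute)

lemma ip_nonneg: "0 \<le> ip m l K c c"
  by (simp add: ip_def sum_nonneg)

lemma ip_zero: "ip m l K c c = 0 \<Longrightarrow> s < l \<Longrightarrow> K (m + s) c = 0"
  unfolding ip_def by (subst (asm) sum_nonneg_eq_0_iff) auto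

definition orth_upto :: "nat \<Rightarrow> nat \<Rightarrow> nat \<Rightarrow> nat \<Rightarrow> (nat \<Rightarrow> nat \<Rightarrow> real) \<Rightarrow> bool" where
  "orth_upto m l n i K \<longleftrightarrow> (\<forall>c<n. \<forall>c'<n. c < i \<longrightarrow> c \<noteq> c' \<longrightarrow> ip m l K c c' = 0)"

text \<open>One step clears the component along column \<open>i\<close> from all later columns at once. By the convention
  \<open>x / 0 = 0\<close> nothing happens if the lower part of column \<open>i\<close> is zero.\<close>

definition gs_step :: "nat \<Rightarrow> nat \<Rightarrow> nat \<Rightarrow> (nat \<Rightarrow> nat \<Rightarrow> real) \<Rightarrow> nat \<Rightarrow> nat \<Rightarrow> real" where
  "gs_step m l i K r c = (if i < c then K r c - ip m l K i c / ip m l K i i * K r i else K r c)"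

text \<open>The earlier columns are already orthogonal to column \<open>i\<close> and to all later ones, so subtracting
  multiples of column \<open>i\<close> preserves what has been achieved.\<close>

lemma gs_step_correct:
  assumes i: "i < n" and orth: "orth_upto m l n i K"
    and K': "\<And>r c. r < m + l \<Longrightarrow> c < n \<Longrightarrow> K' r c = gs_step m l i K r c"
  shows "same_range (m + l) n K K'" "orth_upto m l n (Suc i) K'"
proof -
  define q where "q = (\<lambda>c. if i < c then ip m l K i c / ip m l K i i else 0)"
  have K'': "K' r c = K r c - q c * K r i" if "r < m + l" "c < n" for r c
    using K'[OF that] by (simp add: gs_step_def q_def)
  show "same_range (m + l) n K K'"
    using i K'' by (intro same_range_column_op[where q=q and i=i]) (simp_all add: q_def)
  have ip': "ip m l K' c c' = ip m l K c c' - q c * ip m l K i c' - q c' * ip m l K c i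
      + q c * q c' * ip m l K i i" if "c < n" "c' < n" for c c'
  proof -
    have "ip m l K' c c' = (\<Sum>s<l. K (m + s) c * K (m + s) c' - q c * (K (m + s) i * K (m + s) c')
      - q c' * (K (m + s) c * K (m + s) i) + q c * q c' * (K (m + s) i * K (m + s) i))"
      unfolding ip_def by (intro sum.cong refl) (simp add: K'' that algebra_simps)
    then show ?thesis by (simp add: ip_def sum.distrib sum_subtractf sum_distrib_left)
  qed
  \<comment> \<open>A zero column makes the quotient in the step meaningless, but then there is nothing to
    orthogonalise against.\<close>
  have zero: "ip m l K i c = 0" if "ip m l K i i = 0" for c
    using ip_zero[OF that] by (simp add: ip_def)
  show "orth_upto m l n (Suc i) K'"
    unfolding orth_upto_def
  proof (intro allI impI)
    fix c c' assume c: "c < n" "c' < n" "c < Suc i" "c \<noteq> c'"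
    have o: "ip m l K a b = 0" if "a < n" "b < n" "a < i" "a \<noteq> b" for a b
      using orth that unfolding orth_upto_def by blast
    show "ip m l K' c c' = 0"
    proof (cases "c < i")
      case True
      then show ?thesis using o[of c c'] o[of c i] c i by (simp add: ip' q_def)
    next
      case False
      then have ci: "c = i" using c by simp
      show ?thesis
      proof (cases "i < c'")
        case True
        then show ?thesis using zero[of c'] c ci by (simp add: ip' q_def)
      next
        case False
        then show ?thesis using o[of c' i] c ci ip_commute[of m l K i c'] by (simp add: ip' q_def)
      qed
    qed
  qed
qed

lemma gram_schmidt:
  obtains K' where "same_range (m + l) n K K'" "orth_upto m l n n K'"
proof -
  have "i \<le> n \<Longrightarrow> \<exists>K'. same_range (m + l) n K K' \<and> orth_upto m l n i K'" for i
  proof (induction i)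
    case 0
    then show ?case using same_range_refl by (auto simp: orth_upto_def)
  next
    case (Suc i)
    then obtain K' where "same_range (m + l) n K K'" "orth_upto m l n i K'" by auto
    then show ?case
      using gs_step_correct[of i n m l K' "gs_step m l i K'"] Suc.prems same_range_trans
      by (metis Suc_le_eq)
  qed
  then show thesis using that by blast
qed

text \<open>Pairing with a column reads off a coordinate of \<open>x\<close>, up to the squared norm of the column.\<close>

lemma orthogonal_columns:
  assumes orth: "orth_upto m l n n K" and c: "c < n"
  shows "(\<Sum>s<l. K (m + s) c * lin n K x (m + s)) = ip m l K c c * x c"
proof -
  have "(\<Sum>s<l. K (m + s) c * lin n K x (m + s)) = (\<Sum>c'<n. ip m l K c c' * x c')"
    unfolding lin_def ip_def sum_distrib_left sum_distrib_right
    by (subst sum.swap) (simp add: mult.assoc)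
  also have "\<dots> = (\<Sum>c'<n. if c' = c then ip m l K c c * x c else 0)"
    using orth c by (intro sum.cong) (auto simp: orth_upto_def)
  also have "\<dots> = ip m l K c c * x c" using c by simp
  finally show ?thesis .
qed

definition num_sq :: "nat \<Rightarrow> nat \<Rightarrow> (nat \<Rightarrow> nat \<Rightarrow> real) \<Rightarrow> (nat \<Rightarrow> real) \<Rightarrow> real" where
  "num_sq m n K x = (\<Sum>r<m. (lin n K x r)\<^sup>2)"

definition den_sq :: "nat \<Rightarrow> nat \<Rightarrow> nat \<Rightarrow> (nat \<Rightarrow> nat \<Rightarrow> real) \<Rightarrow> (nat \<Rightarrow> real) \<Rightarrow> real" where
  "den_sq m l n K x = (\<Sum>s<l. (lin n K x (m + s))\<^sup>2)"

text \<open>For \<open>A\<close> on top of \<open>B\<close>: \<open>\<parallel>A x\<parallel> \<le> t \<parallel>B x\<parallel>\<close> for all \<open>x\<close>, in squared form.\<close>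

definition ratio_bound :: "nat \<Rightarrow> nat \<Rightarrow> nat \<Rightarrow> (nat \<Rightarrow> nat \<Rightarrow> real) \<Rightarrow> real \<Rightarrow> bool" where
  "ratio_bound m l n K t \<longleftrightarrow> 0 \<le> t \<and> (\<forall>x. num_sq m n K x \<le> t\<^sup>2 * den_sq m l n K x)"

lemma ratio_bound_same_range:
  assumes "same_range (m + l) n K K'"
  shows "ratio_bound m l n K t \<longleftrightarrow> ratio_bound m l n K' t"
proof -
  have *: "num_sq m n K x = num_sq m n K' y \<and> den_sq m l n K x = den_sq m l n K' y"
    if "\<forall>r<m+l. lin n K' y r = lin n K x r" for K K' x y
    using that by (simp add: num_sq_def den_sq_def)
  show ?thesis using assms * unfolding ratio_bound_def same_range_def by (metis (no_types, lifting))
qed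

definition least_bound :: "nat \<Rightarrow> nat \<Rightarrow> nat \<Rightarrow> (nat \<Rightarrow> nat \<Rightarrow> real) \<Rightarrow> real \<Rightarrow> bool" where
  "least_bound m l n K F \<longleftrightarrow> ratio_bound m l n K F \<and> (\<forall>t. ratio_bound m l n K t \<longrightarrow> F \<le> t)"

section \<open>Deciding positive definiteness by elimination\<close>

definition quad :: "nat \<Rightarrow> (nat \<Rightarrow> nat \<Rightarrow> real) \<Rightarrow> (nat \<Rightarrow> real) \<Rightarrow> real" where
  "quad n S x = (\<Sum>i<n. \<Sum>j<n. S i j * x i * x j)"

text \<open>Positivity is required only on vectors that do not vanish on the indices from \<open>i\<close> on. When the
  rows and columns below \<open>i\<close> are zero, this is positive definiteness of the remaining block.\<close>

definition pd_from :: "nat \<Rightarrow> nat \<Rightarrow> (nat \<Rightarrow> nat \<Rightarrow> real) \<Rightarrow> bool" where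
  "pd_from n i S \<longleftrightarrow> (\<forall>x. (\<exists>c<n. i \<le> c \<and> x c \<noteq> 0) \<longrightarrow> 0 < quad n S x)"

definition reduced :: "nat \<Rightarrow> nat \<Rightarrow> (nat \<Rightarrow> nat \<Rightarrow> real) \<Rightarrow> bool" where
  "reduced n i S \<longleftrightarrow> (\<forall>j<n. \<forall>k<n. S j k = S k j) \<and> (\<forall>j<i. \<forall>k<n. S j k = 0)"

text \<open>The Schur complement, without restriction of the indices: row and column \<open>i\<close> become zero and
  those that are zero stay zero.\<close>

definition eliminate :: "nat \<Rightarrow> (nat \<Rightarrow> nat \<Rightarrow> real) \<Rightarrow> nat \<Rightarrow> nat \<Rightarrow> real" where
  "eliminate i S j k = S j k - S j i * S i k / S i i"

lemma pd_from_pivot: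
  assumes i: "i < n" and pd: "pd_from n i S"
  shows "0 < S i i"
proof -
  let ?x = "\<lambda>j. if j = i then 1 else (0::real)"
  have "S a b * ?x a * ?x b = (if b = i then if a = i then S i i else 0 else 0)" for a b by simp
  then have "quad n S ?x = S i i" using i by (simp add: quad_def)
  moreover have "0 < quad n S ?x" using pd i unfolding pd_from_def by fastforce
  ultimately show ?thesis by simp
qed

text \<open>Elimination completes the square for the \<open>i\<close>-th variable and removes the square.\<close>

lemma quad_eliminate:
  assumes i: "i < n" and red: "reduced n i S"
  shows "quad n (eliminate i S) x = quad n S x - (\<Sum>k<n. S i k * x k)\<^sup>2 / S i i"
proof -
  have sym: "S j i = S i j" if "j < n" for j using red i that by (simp add: reduced_def)
  have "quad n (eliminate i S) x =
      (\<Sum>j<n. \<Sum>k<n. S j k * x j * x k - (S i j * x j) * (S i k * x k) / S i i)"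
    unfolding quad_def eliminate_def
    by (intro sum.cong refl) (simp add: sym algebra_simps)
  also have "\<dots> = quad n S x - (\<Sum>j<n. \<Sum>k<n. (S i j * x j) * (S i k * x k)) / S i i"
    by (simp add: quad_def sum_subtractf sum_divide_distrib)
  also have "(\<Sum>j<n. \<Sum>k<n. (S i j * x j) * (S i k * x k)) = (\<Sum>k<n. S i k * x k)\<^sup>2"
    by (simp add: power2_eq_square sum_product)
  finally show ?thesis .
qed

lemma reduced_eliminate:
  assumes i: "i < n" and red: "reduced n i S" and p: "S i i \<noteq> 0"
  shows "reduced n (Suc i) (eliminate i S)"
  using assms unfolding reduced_def eliminate_def
  by (auto simp: less_Suc_eq mult.commute)

text \<open>A form with positive pivot is the sum of a nonnegative square and the reduced form. The square can
  be made zero by the choice of the \<open>i\<close>-th coordinate, which the reduced form ignores.\<close>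

lemma pd_from_eliminate:
  assumes i: "i < n" and red: "reduced n i S" and p: "0 < S i i"
  shows "pd_from n i S \<longleftrightarrow> pd_from n (Suc i) (eliminate i S)"
proof -
  let ?S = "eliminate i S"
  have red': "reduced n (Suc i) ?S" by (rule reduced_eliminate[OF i red]) (use p in simp)
  have z: "?S j k = 0" if "j < n" "k < n" "j \<le> i \<or> k \<le> i" for j k
    using red' that unfolding reduced_def by (metis less_Suc_eq_le)
  note q = quad_eliminate[OF i red]
  show ?thesis
  proof
    assume pd: "pd_from n i S"
    show "pd_from n (Suc i) ?S"
      unfolding pd_from_def
    proof (intro allI impI)
      fix x :: "nat \<Rightarrow> real" assume x: "\<exists>c<n. Suc i \<le> c \<and> x c \<noteq> 0"
      \<comment> \<open>The \<open>i\<close>-th coordinate is chosen to make the eliminated square vanish; row and column \<open>i\<close>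
        of the reduced matrix are zero, so this choice does not affect its form.\<close>
      define y where "y = x(i := x i - lin n S x i / S i i)"
      have "lin n S y i = 0" using i p by (simp add: y_def lin_upd)
      then have "quad n ?S y = quad n S y" by (simp add: q lin_def)
      moreover have "quad n ?S y = quad n ?S x"
        unfolding quad_def by (intro sum.cong refl) (auto simp: y_def z)
      moreover have "0 < quad n S y"
      proof -
        obtain c where "c < n" "Suc i \<le> c" "x c \<noteq> 0" using x by blast
        then have "c < n \<and> i \<le> c \<and> y c \<noteq> 0" by (simp add: y_def)
        then show ?thesis using pd unfolding pd_from_def by blast
      qed
      ultimately show "0 < quad n ?S x" by simp
    qed
  next
    assume pd: "pd_from n (Suc i) ?S"
    show "pd_from n i S"
      unfolding pd_from_def
    proof (intro allI impI)
      fix x :: "nat \<Rightarrow> real" assume x: "\<exists>c<n. i \<le> c \<and> x c \<noteq> 0"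
      have eq: "quad n S x = quad n ?S x + (lin n S x i)\<^sup>2 / S i i" by (simp add: q lin_def)
      show "0 < quad n S x"
      proof (cases "\<exists>c<n. Suc i \<le> c \<and> x c \<noteq> 0")
        case True
        then have "0 < quad n ?S x" using pd unfolding pd_from_def by blast
        then show ?thesis using eq p by (simp add: add_pos_nonneg)
      next
        case False
        then have x0: "x c = 0" if "c < n" "i < c" for c using that by auto
        then have xi: "x i \<noteq> 0" using x by (metis le_neq_implies_less)
        have "?S j k * x j * x k = 0" if "j < n" "k < n" for j k
          using z[OF that] x0[OF that(1)] by (cases "j \<le> i") auto
        then have "quad n ?S x = 0"
          unfolding quad_def by (intro sum.neutral ballI) auto
        moreover have "lin n S x i = S i i * x i"
        proof -
          have "S i k * x k = (if k = i then S i i * x i else 0)" if "k < n" for k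
          proof (cases k i rule: linorder_cases)
            case less
            then have "S i k = 0" using red i that unfolding reduced_def by metis
            then show ?thesis using less by simp
          qed (use x0 that in auto)
          then have "lin n S x i = (\<Sum>k<n. if k = i then S i i * x i else 0)"
            unfolding lin_def by (intro sum.cong) auto
          then show ?thesis using i by simp
        qed
        ultimately show ?thesis using eq p xi by simp
      qed
    qed
  qed
qed

lemma pd_from_cong:
  assumes "\<And>j k. j < n \<Longrightarrow> k < n \<Longrightarrow> S j k = S' j k"
  shows "pd_from n i S \<longleftrightarrow> pd_from n i S'"
proof -
  have "quad n S = quad n S'" unfolding quad_def using assms by (intro ext sum.cong refl) auto
  then show ?thesis by (simp add: pd_from_def)
qed

lemma reduced_cong:
  assumes "\<And>j k. j < n \<Longrightarrow> k < n \<Longrightarrow> S j k = S' j k" "i \<le> n"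
  shows "reduced n i S \<longleftrightarrow> reduced n i S'"
proof -
  have "j < n" if "j < i" for j using that assms(2) by simp
  then show ?thesis using assms(1) unfolding reduced_def by auto
qed

section \<open>The norm in orthogonalised coordinates\<close>

text \<open>The squared column norms, except that \<open>1\<close> stands in for \<open>0\<close>. Zero columns thereby contribute a
  positive diagonal entry to the test matrix below and never cause a division by zero.\<close>

definition diag :: "nat \<Rightarrow> nat \<Rightarrow> (nat \<Rightarrow> nat \<Rightarrow> real) \<Rightarrow> nat \<Rightarrow> real" where
  "diag m l K c = (if 0 < ip m l K c c then ip m l K c c else 1)"

lemma diag_pos: "0 < diag m l K c"
  by (simp add: diag_def)

lemma diag_eq: "ip m l K c c \<noteq> 0 \<Longrightarrow> diag m l K c = ip m l K c c"
  using ip_nonneg[of m l K c] by (simp add: diag_def)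

lemma ip_le_diag: "ip m l K c c \<le> diag m l K c"
  by (simp add: diag_def)

text \<open>For orthogonal columns these are the terms of \<open>A B\<^sup>+ = \<Sum>\<^sub>c a\<^sub>c b\<^sub>c\<^sup>T / \<parallel>b\<^sub>c\<parallel>\<^sup>2\<close>, so the sum has
  the right degree of homogeneity for a first approximation of the norm.\<close>

definition entry_sum :: "nat \<Rightarrow> nat \<Rightarrow> nat \<Rightarrow> (nat \<Rightarrow> nat \<Rightarrow> real) \<Rightarrow> real" where
  "entry_sum m l n K = (\<Sum>c<n. \<Sum>r<m. \<Sum>s<l. \<bar>K r c * K (m + s) c / diag m l K c\<bar>)"

text \<open>The matrix of the form \<open>t\<^sup>2 \<parallel>B x\<parallel>\<^sup>2 - \<parallel>A x\<parallel>\<^sup>2\<close> for orthogonal columns, up to the modification of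
  \<open>diag\<close> on zero columns.\<close>

definition test_mat :: "nat \<Rightarrow> nat \<Rightarrow> (nat \<Rightarrow> nat \<Rightarrow> real) \<Rightarrow> real \<Rightarrow> nat \<Rightarrow> nat \<Rightarrow> real" where
  "test_mat m l K t i j = (if i = j then t * t * diag m l K i else 0) - (\<Sum>r<m. K r i * K r j)"

lemma den_sq_orth:
  assumes "orth_upto m l n n K"
  shows "den_sq m l n K x = (\<Sum>c<n. ip m l K c c * (x c)\<^sup>2)"
proof -
  have "den_sq m l n K x = (\<Sum>s<l. \<Sum>c<n. (K (m + s) c * x c) * lin n K x (m + s))"
    unfolding den_sq_def power2_eq_square
    by (subst (1) lin_def) (simp add: sum_distrib_right)
  also have "\<dots> = (\<Sum>c<n. x c * (\<Sum>s<l. K (m + s) c * lin n K x (m + s)))"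
    by (subst sum.swap) (simp add: sum_distrib_left ac_simps)
  also have "\<dots> = (\<Sum>c<n. ip m l K c c * (x c)\<^sup>2)"
    by (intro sum.cong refl)
      (simp add: orthogonal_columns[OF assms] power2_eq_square)
  finally show ?thesis .
qed

lemma den_sq_nonneg: "0 \<le> den_sq m l n K x"
  by (simp add: den_sq_def sum_nonneg)

lemma quad_test_mat:
  "quad n (test_mat m l K t) x = t\<^sup>2 * (\<Sum>c<n. diag m l K c * (x c)\<^sup>2) - num_sq m n K x"
proof -
  have "quad n (test_mat m l K t) x = (\<Sum>i<n. \<Sum>j<n. (if i = j then t * t * diag m l K i * x i * x i else 0)
      - (\<Sum>r<m. (K r i * x i) * (K r j * x j)))"
    unfolding quad_def test_mat_def
    by (intro sum.cong refl) (auto simp: algebra_simps sum_distrib_left sum_distrib_right)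
  also have "\<dots> = (\<Sum>i<n. t * t * diag m l K i * x i * x i) -
      (\<Sum>i<n. \<Sum>j<n. \<Sum>r<m. (K r i * x i) * (K r j * x j))"
    by (simp add: sum_subtractf)
  also have "(\<Sum>i<n. t * t * diag m l K i * x i * x i) = t\<^sup>2 * (\<Sum>c<n. diag m l K c * (x c)\<^sup>2)"
    by (simp add: sum_distrib_left power2_eq_square ac_simps)
  also have "(\<Sum>i<n. \<Sum>j<n. \<Sum>r<m. (K r i * x i) * (K r j * x j)) = num_sq m n K x"
  proof -
    have "num_sq m n K x = (\<Sum>r<m. \<Sum>i<n. \<Sum>j<n. (K r i * x i) * (K r j * x j))"
      by (simp add: num_sq_def lin_def power2_eq_square sum_product)
    also have "\<dots> = (\<Sum>i<n. \<Sum>r<m. \<Sum>j<n. (K r i * x i) * (K r j * x j))"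
      by (rule sum.swap)
    also have "\<dots> = (\<Sum>i<n. \<Sum>j<n. \<Sum>r<m. (K r i * x i) * (K r j * x j))"
      by (intro sum.cong refl sum.swap)
    finally show ?thesis by simp
  qed
  finally show ?thesis .
qed

text \<open>A finite bound forces \<open>A\<close> to vanish where \<open>B\<close> does; this is how the inclusion of the kernels
  enters.\<close>

lemma zero_columns:
  assumes orth: "orth_upto m l n n K" and F: "ratio_bound m l n K F"
    and c: "c < n" "ip m l K c c = 0" "r < m"
  shows "K r c = 0"
proof -
  let ?e = "\<lambda>j. if j = c then 1 else (0::real)"
  have "den_sq m l n K ?e = 0"
    using c ip_zero[OF c(2)] by (simp add: den_sq_def lin_unit)
  then have "num_sq m n K ?e \<le> 0" using F unfolding ratio_bound_def by (metis mult_zero_right)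
  then have "(\<Sum>r<m. (K r c)\<^sup>2) = 0"
    using c by (intro antisym) (simp_all add: num_sq_def lin_unit sum_nonneg)
  then show ?thesis using c(3) by (subst (asm) sum_nonneg_eq_0_iff) auto
qed

text \<open>Orthogonality expresses every entry of \<open>A x\<close> as a combination of the entries of \<open>B x\<close>, with
  coefficients whose absolute values are part of the entry sum, and no entry of \<open>B x\<close> exceeds
  \<open>\<parallel>B x\<parallel>\<close>.\<close>

lemma ratio_bound_entry_sum:
  assumes orth: "orth_upto m l n n K" and F: "ratio_bound m l n K F"
  shows "ratio_bound m l n K (entry_sum m l n K)"
  unfolding ratio_bound_def
proof (intro conjI allI)
  show "0 \<le> entry_sum m l n K" by (simp add: entry_sum_def sum_nonneg)
  fix x
  define \<beta> where "\<beta> = den_sq m l n K x"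
  define h where "h = (\<lambda>r. \<Sum>c<n. \<Sum>s<l. \<bar>K r c * K (m + s) c / diag m l K c\<bar>)"
  have h0: "0 \<le> h r" for r by (simp add: h_def sum_nonneg)
  have b: "\<bar>lin n K x (m + s)\<bar> \<le> sqrt \<beta>" if "s < l" for s
  proof (rule real_le_rsqrt)
    show "\<bar>lin n K x (m + s)\<bar>\<^sup>2 \<le> \<beta>"
      unfolding \<beta>_def den_sq_def power2_abs
      by (rule member_le_sum[of s "{..<l}" "\<lambda>s. (lin n K x (m + s))\<^sup>2"]) (use that in auto)
  qed
  have "\<bar>lin n K x r\<bar> \<le> h r * sqrt \<beta>" if r: "r < m" for r
  proof -
    \<comment> \<open>By orthogonality, \<open>x c\<close> can be recovered from the image of \<open>x\<close> under the lower block, unless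
      column \<open>c\<close> vanishes there, and then it vanishes altogether.\<close>
    have col: "K r c * x c = (\<Sum>s<l. K r c * K (m + s) c / diag m l K c * lin n K x (m + s))" if c: "c < n" for c
    proof (cases "ip m l K c c = 0")
      case True
      then show ?thesis using zero_columns[OF orth F c True r] by simp
    next
      case False
      then have D: "diag m l K c = ip m l K c c" using ip_nonneg[of m l K c] by (simp add: diag_def)
      have "(\<Sum>s<l. K r c * K (m + s) c / diag m l K c * lin n K x (m + s)) =
          K r c / ip m l K c c * (\<Sum>s<l. K (m + s) c * lin n K x (m + s))"
        unfolding D sum_distrib_left by (intro sum.cong refl) (simp only: times_divide_eq_left times_divide_eq_right mult.assoc)
      also have "\<dots> = K r c * x c"
        unfolding orthogonal_columns[OF orth c] using False by simp
      finally show ?thesis by (rule sym)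
    qed
    have eq: "lin n K x r = (\<Sum>c<n. \<Sum>s<l. K r c * K (m + s) c / diag m l K c * lin n K x (m + s))"
      unfolding lin_def[of n K x r] by (intro sum.cong refl col) simp
    have "\<bar>lin n K x r\<bar> \<le> (\<Sum>c<n. \<Sum>s<l. \<bar>K r c * K (m + s) c / diag m l K c * lin n K x (m + s)\<bar>)"
      unfolding eq by (rule order_trans[OF sum_abs]) (intro sum_mono sum_abs)
    also have "\<dots> \<le> (\<Sum>c<n. \<Sum>s<l. \<bar>K r c * K (m + s) c / diag m l K c\<bar> * sqrt \<beta>)"
    proof (rule sum_mono, rule sum_mono)
      fix c s assume s: "s \<in> {..<l}"
      have "\<bar>lin n K x (m + s)\<bar> \<le> sqrt \<beta>" by (rule b) (use s in simp)
      then show "\<bar>K r c * K (m + s) c / diag m l K c * lin n K x (m + s)\<bar> \<le>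
          \<bar>K r c * K (m + s) c / diag m l K c\<bar> * sqrt \<beta>"
        by (subst abs_mult) (rule mult_left_mono, assumption, rule abs_ge_zero)
    qed
    also have "\<dots> = h r * sqrt \<beta>" by (simp add: h_def sum_distrib_right)
    finally show ?thesis .
  qed
  then have "(lin n K x r)\<^sup>2 \<le> (h r)\<^sup>2 * \<beta>" if "r < m" for r
  proof -
    have "\<bar>lin n K x r\<bar>\<^sup>2 \<le> (h r * sqrt \<beta>)\<^sup>2"
      using that \<open>\<And>r. r < m \<Longrightarrow> \<bar>lin n K x r\<bar> \<le> h r * sqrt \<beta>\<close> by (intro power_mono) auto
    also have "(h r * sqrt \<beta>)\<^sup>2 = (h r)\<^sup>2 * \<beta>"
      unfolding power_mult_distrib \<beta>_def using den_sq_nonneg by simp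
    finally show ?thesis by simp
  qed
  then have "num_sq m n K x \<le> (\<Sum>r<m. (h r)\<^sup>2 * \<beta>)"
    unfolding num_sq_def by (intro sum_mono) simp
  also have "\<dots> = (\<Sum>r<m. h r * h r) * \<beta>" by (simp add: sum_distrib_right power2_eq_square)
  also have "\<dots> \<le> (\<Sum>r<m. h r * (\<Sum>r<m. h r)) * \<beta>"
  proof (intro mult_right_mono sum_mono mult_left_mono h0)
    show "0 \<le> \<beta>" by (simp add: \<beta>_def den_sq_nonneg)
    show "h r \<le> (\<Sum>r<m. h r)" if "r \<in> {..<m}" for r
      by (rule member_le_sum[of r "{..<m}" h]) (use that h0 in auto)
  qed
  also have "(\<Sum>r<m. h r * (\<Sum>r<m. h r)) = (\<Sum>r<m. h r)\<^sup>2"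
    by (simp add: power2_eq_square sum_distrib_right)
  also have "(\<Sum>r<m. h r) = entry_sum m l n K"
    unfolding h_def entry_sum_def by (rule sum.swap)
  finally show "num_sq m n K x \<le> (entry_sum m l n K)\<^sup>2 * den_sq m l n K x"
    by (simp add: \<beta>_def)
qed

text \<open>Every term is at most \<open>F\<close>: apply the bound \<open>F\<close> to the unit vector of column \<open>c\<close> for the first
  factor, and estimate an entry of the column by its norm for the second.\<close>

lemma entry_sum_le:
  assumes orth: "orth_upto m l n n K" and F: "ratio_bound m l n K F"
  shows "entry_sum m l n K \<le> real (n * m * l) * F"
proof -
  have F0: "0 \<le> F" using F by (simp add: ratio_bound_def)
  have "\<bar>K r c * K (m + s) c / diag m l K c\<bar> \<le> F" if c: "c < n" and r: "r < m" and s: "s < l" for c r s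
  proof (cases "ip m l K c c = 0")
    case True
    then show ?thesis using zero_columns[OF orth F c True r] F0 by simp
  next
    case False
    define D where "D = ip m l K c c"
    have D: "0 < D" "diag m l K c = D"
      using False ip_nonneg[of m l K c] by (simp_all add: diag_def D_def)
    let ?e = "\<lambda>j. if j = c then 1 else (0::real)"
    have "(K r c)\<^sup>2 \<le> num_sq m n K ?e"
      unfolding num_sq_def lin_unit[OF c]
      by (rule member_le_sum[of r "{..<m}" "\<lambda>r. (K r c)\<^sup>2"]) (use r in auto)
    also have "\<dots> \<le> F\<^sup>2 * den_sq m l n K ?e"
      using F unfolding ratio_bound_def by blast
    also have "den_sq m l n K ?e = D"
      by (simp add: den_sq_def lin_unit[OF c] D_def ip_def power2_eq_square)
    finally have 1: "(K r c)\<^sup>2 \<le> F\<^sup>2 * D" .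
    have 2: "(K (m + s) c)\<^sup>2 \<le> D"
      unfolding D_def ip_def power2_eq_square
      by (rule member_le_sum[of s "{..<l}" "\<lambda>s. K (m + s) c * K (m + s) c"]) (use s in auto)
    have "(K r c * K (m + s) c)\<^sup>2 \<le> (F * D)\<^sup>2"
      using mult_mono[OF 1 2] D by (simp add: power_mult_distrib power2_eq_square ac_simps)
    then have "\<bar>K r c * K (m + s) c\<bar> \<le> F * D"
      using F0 D by (simp add: abs_le_square_iff[symmetric])
    then show ?thesis using D by (simp add: abs_divide pos_divide_le_eq)
  qed
  then have "entry_sum m l n K \<le> (\<Sum>c<n. \<Sum>r<m. \<Sum>s<l. F)"
    unfolding entry_sum_def by (intro sum_mono) simp
  then show ?thesis by (simp add: mult.assoc)
qed

lemma ratio_bound_if_pd: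
  assumes orth: "orth_upto m l n n K" and F: "ratio_bound m l n K F" and t: "0 \<le> t"
    and pd: "pd_from n 0 (test_mat m l K t)"
  shows "ratio_bound m l n K t"
  unfolding ratio_bound_def
proof (intro conjI allI t)
  fix x :: "nat \<Rightarrow> real"
  \<comment> \<open>On zero columns \<open>diag\<close> is \<open>1\<close> instead of the true squared norm, so the coordinates of \<open>x\<close> that
    belong to them are removed; neither block sees the difference.\<close>
  define y where "y = (\<lambda>c. if ip m l K c c = 0 then 0 else x c)"
  have "num_sq m n K x = num_sq m n K y"
    unfolding num_sq_def lin_def
    by (intro sum.cong refl arg_cong[where f="\<lambda>z. z\<^sup>2"]) (auto simp: y_def zero_columns[OF orth F])
  also have "num_sq m n K y \<le> t\<^sup>2 * (\<Sum>c<n. diag m l K c * (y c)\<^sup>2)"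
  proof (cases "\<exists>c<n. y c \<noteq> 0")
    case True
    then have "0 < quad n (test_mat m l K t) y" using pd unfolding pd_from_def by auto
    then show ?thesis by (simp add: quad_test_mat)
  next
    case False
    then have "num_sq m n K y = 0" by (simp add: num_sq_def lin_def)
    then show ?thesis using diag_pos[of m l K] by (simp add: sum_nonneg less_imp_le)
  qed
  also have "(\<Sum>c<n. diag m l K c * (y c)\<^sup>2) = (\<Sum>c<n. ip m l K c c * (x c)\<^sup>2)"
    by (intro sum.cong refl) (simp add: y_def diag_eq)
  finally show "num_sq m n K x \<le> t\<^sup>2 * den_sq m l n K x"
    by (simp add: den_sq_orth[OF orth])
qed

text \<open>A vector on which the test form is not positive witnesses that bounds below \<open>t\<close> are violated.\<close>

lemma le_bound_if_not_pd:
  assumes orth: "orth_upto m l n n K" and F: "ratio_bound m l n K F"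
    and pd: "\<not> pd_from n 0 (test_mat m l K t)"
  shows "t \<le> F"
proof -
  obtain x c where x: "c < n" "x c \<noteq> 0" "\<not> 0 < quad n (test_mat m l K t) x"
    using pd unfolding pd_from_def by blast
  define s where "s = (\<Sum>c<n. diag m l K c * (x c)\<^sup>2)"
  have "0 < s" unfolding s_def
  proof (rule sum_pos2)
    show "c \<in> {..<n}" "0 < diag m l K c * (x c)\<^sup>2" using x diag_pos[of m l K c] by simp_all
    show "0 \<le> diag m l K i * (x i)\<^sup>2" for i using diag_pos[of m l K i] by simp
  qed simp
  have "t\<^sup>2 * s \<le> num_sq m n K x" using x(3) unfolding quad_test_mat s_def by linarith
  also have "\<dots> \<le> F\<^sup>2 * den_sq m l n K x"
    using F unfolding ratio_bound_def by blast
  also have "\<dots> \<le> F\<^sup>2 * s"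
    unfolding s_def den_sq_orth[OF orth]
    by (intro mult_left_mono sum_mono mult_right_mono ip_le_diag) simp_all
  finally have "t\<^sup>2 \<le> F\<^sup>2" using \<open>0 < s\<close> by (rule mult_right_le_imp_le)
  then show ?thesis using F unfolding ratio_bound_def by (blast intro: power2_le_imp_le)
qed

lemma least_bound_same_range:
  "same_range (m + l) n K K' \<Longrightarrow> least_bound m l n K F \<longleftrightarrow> least_bound m l n K' F"
  by (simp add: least_bound_def ratio_bound_same_range)

lemma same_range_eq:
  assumes "\<And>x r. r < h \<Longrightarrow> lin n K' x r = lin n K x r"
  shows "same_range h n K K'"
  unfolding same_range_def
proof (intro conjI allI)
  fix x
  show "\<exists>y. \<forall>r<h. lin n K' y r = lin n K x r" by (rule exI[of _ x]) (simp add: assms)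
  show "\<exists>y. \<forall>r<h. lin n K y r = lin n K' x r" by (rule exI[of _ x]) (simp add: assms)
qed

section \<open>Existence and uniqueness of the pseudoinverse\<close>

lemma mult_entry:
  assumes "A \<in> carrier_mat m n" "X \<in> carrier_mat n k" "i < m" "j < k"
  shows "(A * X) $$ (i, j) = (\<Sum>c<n. A $$ (i, c) * X $$ (c, j))"
  using assms by (simp add: scalar_prod_def lessThan_atLeast0)

lemma mult_vec_entry:
  assumes "A \<in> carrier_mat m n" "v \<in> carrier_vec n" "i < m"
  shows "(A *\<^sub>v v) $ i = (\<Sum>c<n. A $$ (i, c) * v $ c)"
  using assms by (simp add: scalar_prod_def lessThan_atLeast0)

text \<open>With orthogonal columns \<open>b\<^sub>j\<close> obtained by column operations \<open>U\<close>, the matrix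
  \<open>\<Sum>\<^sub>j b\<^sub>j b\<^sub>j\<^sup>T / \<parallel>b\<^sub>j\<parallel>\<^sup>2\<close> is symmetric and fixes the range of \<open>B\<close>. It has the form \<open>B X\<close> because
  each \<open>b\<^sub>j\<close> is \<open>B\<close> applied to the \<open>j\<close>-th column of \<open>U\<close>.\<close>

lemma least_squares_inverse:
  fixes B :: "real mat"
  assumes B: "B \<in> carrier_mat l n"
  obtains X where "X \<in> carrier_mat n l" "B * X * B = B" "transpose_mat (B * X) = B * X"
proof -
  \<comment> \<open>With the identity on top, the upper block records the column operations.\<close>
  define K where "K = (\<lambda>r c. if r < n then (if r = c then 1 else 0) else B $$ (r - n, c))"
  obtain K' where sr: "same_range (n + l) n K K'" and orth: "orth_upto n l n n K'"
    by (rule gram_schmidt)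
  define D where "D = (\<lambda>j. ip n l K' j j)"
  define P where "P = (\<lambda>s s'. \<Sum>j<n. K' (n + s) j * K' (n + s') j / D j)"
  define X where "X = mat n l (\<lambda>(c, s). \<Sum>j<n. K' c j * K' (n + s) j / D j)"
  have X: "X \<in> carrier_mat n l" by (simp add: X_def)
  have lin_top: "lin n K y r = y r" if "r < n" for y r
  proof -
    have "lin n K y r = (\<Sum>c<n. if c = r then y r else 0)"
      unfolding lin_def K_def using that by (intro sum.cong) auto
    then show ?thesis using that by simp
  qed
  have lin_bot: "lin n K y (n + s) = (\<Sum>c<n. B $$ (s, c) * y c)" for y s
    by (simp add: lin_def K_def)
  have G: "K' (n + s) j = (\<Sum>c<n. B $$ (s, c) * K' c j)" if "s < l" "j < n" for s j
  proof -
    obtain y where "\<forall>r<n+l. lin n K y r = lin n K' (\<lambda>i. if i = j then 1 else 0) r"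
      using sr unfolding same_range_def by blast
    then have y: "lin n K y r = K' r j" if "r < n + l" for r
      using that lin_unit[OF \<open>j < n\<close>, of K' r] by simp
    have "y c = K' c j" if "c < n" for c using y[of c] lin_top[OF that] that by simp
    then show ?thesis using y[of "n + s"] that unfolding lin_bot by simp
  qed
  have BX: "(B * X) $$ (s, s') = P s s'" if "s < l" "s' < l" for s s'
  proof -
    have "(B * X) $$ (s, s') = (\<Sum>c<n. \<Sum>j<n. B $$ (s, c) * K' c j * (K' (n + s') j / D j))"
      unfolding mult_entry[OF B X that]
      using that by (intro sum.cong refl) (simp add: X_def sum_distrib_left mult.assoc)
    also have "\<dots> = (\<Sum>j<n. \<Sum>c<n. B $$ (s, c) * K' c j * (K' (n + s') j / D j))"
      by (rule sum.swap)
    also have "\<dots> = (\<Sum>j<n. K' (n + s) j * (K' (n + s') j / D j))"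
      unfolding sum_distrib_right[symmetric]
      by (intro sum.cong refl) (simp only: lessThan_iff G[OF that(1)])
    finally show ?thesis by (simp only: P_def times_divide_eq_right)
  qed
  have sym: "transpose_mat (B * X) = B * X"
    using B X by (intro eq_matI) (auto simp: BX P_def mult.commute simp del: index_mult_mat(1))
  have "(B * X * B) $$ (s, c) = B $$ (s, c)" if s: "s < l" and c: "c < n" for s c
  proof -
    obtain w where "\<forall>r<n+l. lin n K' w r = lin n K (\<lambda>i. if i = c then 1 else 0) r"
      using sr unfolding same_range_def by blast
    then have w: "lin n K' w (n + s) = B $$ (s, c)" if "s < l" for s
      using that lin_unit[OF c, of K "n + s"] by (simp add: K_def)
    have BXc: "B * X \<in> carrier_mat l l" using B X by simp
    have "(B * X * B) $$ (s, c) = (\<Sum>s'<l. P s s' * lin n K' w (n + s'))"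
      using s c by (simp add: mult_entry[OF BXc B] BX w del: index_mult_mat(1))
    also have "\<dots> = (\<Sum>s'<l. \<Sum>j<n. K' (n + s) j / D j * (K' (n + s') j * lin n K' w (n + s')))"
      by (simp only: P_def sum_distrib_right times_divide_eq_left times_divide_eq_right mult.assoc)
    also have "\<dots> = (\<Sum>j<n. \<Sum>s'<l. K' (n + s) j / D j * (K' (n + s') j * lin n K' w (n + s')))"
      by (rule sum.swap)
    also have "\<dots> = (\<Sum>j<n. K' (n + s) j / D j * (D j * w j))"
      by (intro sum.cong refl)
        (simp only: sum_distrib_left[symmetric] orthogonal_columns[OF orth] lessThan_iff D_def)
    also have "\<dots> = (\<Sum>j<n. K' (n + s) j * w j)"
      using ip_zero[of n l K' _ s] s by (intro sum.cong refl) (auto simp: D_def)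
    also have "\<dots> = B $$ (s, c)" using w[OF s] by (simp add: lin_def)
    finally show ?thesis .
  qed
  then have "B * X * B = B" using B X by (intro eq_matI) auto
  then show thesis using that X sym by blast
qed

text \<open>Each of the two symmetry conditions can be achieved separately. If \<open>X\<close> serves for \<open>B X\<close> and \<open>Y\<close>
  for \<open>Y B\<close>, then \<open>Y B X\<close> serves for both.\<close>

lemma pseudoinverse_exists:
  fixes B :: "real mat"
  shows "\<exists>X. is_pseudoinverse B X"
proof -
  define l n where "l = dim_row B" and "n = dim_col B"
  have B: "B \<in> carrier_mat l n" unfolding l_def n_def by (rule carrier_matI) (rule refl)+
  then have Bt: "transpose_mat B \<in> carrier_mat n l" by simp
  obtain X where X: "X \<in> carrier_mat n l" "B * X * B = B" "transpose_mat (B * X) = B * X"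
    by (rule least_squares_inverse[OF B])
  \<comment> \<open>Transposition turns the second inverse into one whose product with \<open>B\<close> on the other side is
    symmetric.\<close>
  obtain Z where Z: "Z \<in> carrier_mat l n" "transpose_mat B * Z * transpose_mat B = transpose_mat B"
    "transpose_mat (transpose_mat B * Z) = transpose_mat B * Z"
    by (rule least_squares_inverse[OF Bt])
  define Y where "Y = transpose_mat Z"
  have Y: "Y \<in> carrier_mat n l" using Z by (simp add: Y_def)
  have YB: "transpose_mat (Y * B) = transpose_mat B * Z"
    unfolding transpose_mult[OF Y B] by (simp only: Y_def transpose_transpose)
  have "transpose_mat (transpose_mat (Y * B)) = transpose_mat (Y * B)"
    unfolding YB by (rule Z(3))
  then have YB_sym: "transpose_mat (Y * B) = Y * B" unfolding transpose_transpose by (rule sym)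
  have BYc: "B * Y \<in> carrier_mat l l" using B Y by auto
  have "transpose_mat (B * Y * B) = transpose_mat B * (Z * transpose_mat B)"
    unfolding transpose_mult[OF BYc B] transpose_mult[OF B Y] by (simp only: Y_def transpose_transpose)
  also have "\<dots> = transpose_mat B"
    unfolding assoc_mult_mat[OF Bt Z(1) Bt, symmetric] by (rule Z(2))
  finally have "transpose_mat (transpose_mat (B * Y * B)) = transpose_mat (transpose_mat B)"
    by (rule arg_cong)
  then have BYB: "B * Y * B = B" unfolding transpose_transpose .
  define W where "W = Y * B * X"
  have YBc: "Y * B \<in> carrier_mat n n" and BXc: "B * X \<in> carrier_mat l l"
    using B Y X by auto
  have W: "W \<in> carrier_mat n l" using B Y X by (simp add: W_def)
  have BW: "B * W = B * X"
    unfolding W_def assoc_mult_mat[OF B YBc X(1), symmetric] assoc_mult_mat[OF B Y B, symmetric] BYB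
    by (rule refl)
  have XBc: "X * B \<in> carrier_mat n n" using B X by auto
  have WB: "W * B = Y * B"
    unfolding W_def assoc_mult_mat[OF YBc X(1) B] assoc_mult_mat[OF Y B XBc]
      assoc_mult_mat[OF B X(1) B, symmetric] X(2) by (rule refl)
  have "is_pseudoinverse B W"
    unfolding is_pseudoinverse_def
  proof (intro conjI)
    show "W \<in> carrier_mat (dim_col B) (dim_row B)" using W by (simp add: l_def n_def)
    show "B * W * B = B" by (simp add: BW X(2))
    show "transpose_mat (B * W) = B * W" by (simp add: BW X(3))
    show "transpose_mat (W * B) = W * B" by (simp add: WB YB_sym)
    have "W * B * W = Y * (B * W)" unfolding WB by (rule assoc_mult_mat[OF Y B W])
    also have "\<dots> = Y * (B * X)" by (simp only: BW)
    also have "\<dots> = W" unfolding W_def by (rule assoc_mult_mat[OF Y B X(1), symmetric])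
    finally show "W * B * W = W" .
  qed
  then show ?thesis by blast
qed

lemma pseudoinverse_unique:
  assumes X: "is_pseudoinverse B X" and Y: "is_pseudoinverse B Y"
  shows "X = Y"
proof -
  define l n where "l = dim_row B" and "n = dim_col B"
  have B: "B \<in> carrier_mat l n" unfolding l_def n_def by (rule carrier_matI) (rule refl)+
  have Xc: "X \<in> carrier_mat n l" and Yc: "Y \<in> carrier_mat n l"
    using X Y unfolding is_pseudoinverse_def l_def n_def by - (elim conjE, assumption)+
  have cs: "B * X \<in> carrier_mat l l" "B * Y \<in> carrier_mat l l" "X * B \<in> carrier_mat n n" "Y * B \<in> carrier_mat n n"
    using B Xc Yc by auto
  have x: "B * X * B = B" "X * B * X = X" "transpose_mat (B * X) = B * X" "transpose_mat (X * B) = X * B"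
    and y: "B * Y * B = B" "Y * B * Y = Y" "transpose_mat (B * Y) = B * Y" "transpose_mat (Y * B) = Y * B"
    using X Y unfolding is_pseudoinverse_def by - (elim conjE, assumption)+
  \<comment> \<open>The products \<open>B * X\<close> and \<open>B * Y\<close> are symmetric and absorb each other, hence equal;
    likewise on the other side.\<close>
  have 1: "B * Y * (B * X) = B * X" "B * X * (B * Y) = B * Y"
    unfolding assoc_mult_mat[OF cs(2) B Xc, symmetric] assoc_mult_mat[OF cs(1) B Yc, symmetric]
    by (simp_all only: x y)
  have "transpose_mat (B * Y * (B * X)) = B * X * (B * Y)"
    unfolding transpose_mult[OF cs(2) cs(1)] x(3) y(3) by (rule refl)
  then have BX: "B * X = B * Y" unfolding 1 x(3) .
  have 2: "X * B * (Y * B) = X * B" "Y * B * (X * B) = Y * B"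
    unfolding assoc_mult_mat[OF Xc B cs(4)] assoc_mult_mat[OF Yc B cs(3)]
      assoc_mult_mat[OF B Yc B, symmetric] assoc_mult_mat[OF B Xc B, symmetric]
    by (simp_all only: x y)
  have "transpose_mat (X * B * (Y * B)) = Y * B * (X * B)"
    unfolding transpose_mult[OF cs(3) cs(4)] x(4) y(4) by (rule refl)
  then have XB: "X * B = Y * B" unfolding 2 x(4) .
  have "X = Y * B * X" using x(2) unfolding XB by (rule sym)
  also have "\<dots> = Y" unfolding assoc_mult_mat[OF Yc B Xc] BX
    unfolding assoc_mult_mat[OF Yc B Yc, symmetric] by (rule y(2))
  finally show ?thesis .
qed

lemma is_pseudoinverse_pinv: "is_pseudoinverse B (pinv B)"
proof -
  obtain X where X: "is_pseudoinverse B X" using pseudoinverse_exists by blast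
  show ?thesis unfolding pinv_def
    by (rule theI[where a = X], rule X, rule pseudoinverse_unique[OF _ X])
qed

section \<open>Attainment of the spectral norm\<close>

text \<open>The Bolzano-Weierstrass theorem for finitely many coordinates, which are made convergent one after
  the other.\<close>

lemma convergent_subsequence_coordinates:
  fixes x :: "nat \<Rightarrow> nat \<Rightarrow> real"
  assumes "\<And>k i. i < n \<Longrightarrow> \<bar>x k i\<bar> \<le> b"
  shows "\<exists>f y. strict_mono (f :: nat \<Rightarrow> nat) \<and> (\<forall>i<n. (\<lambda>k. x (f k) i) \<longlonglongrightarrow> y i)"
  using assms
proof (induction n)
  case 0
  then show ?case by (auto intro!: exI[of _ id] simp: strict_mono_def)
next
  case (Suc n)
  then obtain f y where f: "strict_mono (f :: nat \<Rightarrow> nat)" "\<And>i. i < n \<Longrightarrow> (\<lambda>k. x (f k) i) \<longlonglongrightarrow> y i"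
    by auto
  obtain g where g: "strict_mono (g :: nat \<Rightarrow> nat)" "monoseq (\<lambda>k. x (f (g k)) n)"
    using seq_monosub[of "\<lambda>k. x (f k) n"] by blast
  have "Bseq (\<lambda>k. x (f (g k)) n)" using Suc.prems[of n] by (intro BseqI'[of _ b]) simp
  then obtain z where z: "(\<lambda>k. x (f (g k)) n) \<longlonglongrightarrow> z"
    using Bseq_monoseq_convergent g(2) by (auto simp: convergent_def)
  have "(\<lambda>k. x (f (g k)) i) \<longlonglongrightarrow> (y(n := z)) i" if "i < Suc n" for i
  proof (cases "i = n")
    case False
    then have "i < n" using that by simp
    then show ?thesis using LIMSEQ_subseq_LIMSEQ[OF f(2) g(1)] False by (simp add: o_def)
  qed (use z in simp)
  then show ?case using strict_mono_o[OF f(1) g(1)]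
    by (intro exI[of _ "f \<circ> g"] exI[of _ "y(n := z)"]) (simp add: o_def)
qed

lemma max_on_unit_ball:
  obtains x where "(\<Sum>i<n. (x i)\<^sup>2) \<le> 1"
    "\<And>y. (\<Sum>i<n. (y i)\<^sup>2) \<le> 1 \<Longrightarrow> num_sq m n K y \<le> num_sq m n K x"
proof -
  define V where "V = num_sq m n K ` {y. (\<Sum>i<n. (y i)\<^sup>2) \<le> 1}"
  have le1: "\<bar>y i\<bar> \<le> 1" if "(\<Sum>i<n. (y i)\<^sup>2) \<le> 1" "i < n" for y :: "nat \<Rightarrow> real" and i
  proof -
    have "(y i)\<^sup>2 \<le> (\<Sum>i<n. (y i)\<^sup>2)"
      by (rule member_le_sum[of i "{..<n}" "\<lambda>i. (y i)\<^sup>2"]) (use that in auto)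
    then show ?thesis using that(1) abs_le_square_iff[of "y i" 1] by simp
  qed
  define b where "b = (\<Sum>r<m. (\<Sum>c<n. \<bar>K r c\<bar>)\<^sup>2)"
  have bound: "v \<le> b" if v: "v \<in> V" for v
  proof -
    obtain y where y: "(\<Sum>i<n. (y i)\<^sup>2) \<le> 1" "v = num_sq m n K y" using v by (auto simp: V_def)
    have "\<bar>lin n K y r\<bar> \<le> (\<Sum>c<n. \<bar>K r c\<bar>)" for r
    proof -
      have "\<bar>lin n K y r\<bar> \<le> (\<Sum>c<n. \<bar>K r c * y c\<bar>)" unfolding lin_def by (rule sum_abs)
      moreover have "(\<Sum>c<n. \<bar>K r c * y c\<bar>) \<le> (\<Sum>c<n. \<bar>K r c\<bar>)"
      proof (rule sum_mono)
        fix c assume "c \<in> {..<n}"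
        then have "\<bar>y c\<bar> \<le> 1" using le1[OF y(1)] by simp
        then show "\<bar>K r c * y c\<bar> \<le> \<bar>K r c\<bar>" by (simp add: abs_mult mult_left_le)
      qed
      ultimately show ?thesis by linarith
    qed
    then show ?thesis unfolding y(2) num_sq_def b_def
      by (intro sum_mono) (metis abs_ge_zero power2_abs power_mono)
  qed
  then have bdd: "bdd_above V" unfolding bdd_above_def by blast
  have ne: "V \<noteq> {}" by (auto simp: V_def intro!: exI[of _ "\<lambda>_. 0"])
  \<comment> \<open>A maximising sequence has a subsequence that converges to a maximiser.\<close>
  have "\<exists>y. (\<Sum>i<n. (y i)\<^sup>2) \<le> 1 \<and> Sup V - 1 / real (Suc k) < num_sq m n K y" for k
  proof -
    have "Sup V - 1 / real (Suc k) < Sup V" by simp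
    then obtain v where "v \<in> V" "Sup V - 1 / real (Suc k) < v"
      using less_cSup_iff[OF ne bdd] by blast
    then show ?thesis by (auto simp: V_def)
  qed
  then obtain x where x: "\<And>k. (\<Sum>i<n. (x k i)\<^sup>2) \<le> 1"
    "\<And>k. Sup V - 1 / real (Suc k) < num_sq m n K (x k)" by metis
  obtain f y where f: "strict_mono (f :: nat \<Rightarrow> nat)" and y: "\<And>i. i < n \<Longrightarrow> (\<lambda>k. x (f k) i) \<longlonglongrightarrow> y i"
    using convergent_subsequence_coordinates[of n x 1] le1[OF x(1)] by blast
  have "(\<lambda>k. \<Sum>i<n. (x (f k) i)\<^sup>2) \<longlonglongrightarrow> (\<Sum>i<n. (y i)\<^sup>2)"
    by (intro tendsto_intros y) simp
  then have y1: "(\<Sum>i<n. (y i)\<^sup>2) \<le> 1"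
    by (rule LIMSEQ_le_const2) (use x(1) in blast)
  have lim: "(\<lambda>k. num_sq m n K (x (f k))) \<longlonglongrightarrow> num_sq m n K y"
    unfolding num_sq_def lin_def by (intro tendsto_intros y) simp
  have "(\<lambda>k. Sup V - 1 / real (Suc k)) \<longlonglongrightarrow> Sup V - 0"
    by (intro tendsto_diff tendsto_const LIMSEQ_Suc[OF lim_1_over_n])
  from LIMSEQ_subseq_LIMSEQ[OF this f]
  have "(\<lambda>k. Sup V - 1 / real (Suc (f k))) \<longlonglongrightarrow> Sup V" by (simp add: o_def)
  then have "Sup V \<le> num_sq m n K y"
    by (rule LIMSEQ_le[OF _ lim]) (use x(2) in \<open>auto intro!: exI[of _ 0] less_imp_le\<close>)
  moreover have "num_sq m n K z \<le> Sup V" if "(\<Sum>i<n. (z i)\<^sup>2) \<le> 1" for z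
    by (rule cSup_upper[OF _ bdd]) (use that in \<open>auto simp: V_def\<close>)
  ultimately show thesis using that[of y] y1 order_trans by blast
qed

lemma norm2_sq: "(norm2 v)\<^sup>2 = (\<Sum>i<dim_vec v. (v $ i)\<^sup>2)"
proof -
  have "v \<bullet> v = (\<Sum>i<dim_vec v. (v $ i)\<^sup>2)"
    by (simp add: scalar_prod_def lessThan_atLeast0 power2_eq_square)
  then show ?thesis by (simp add: norm2_def sum_nonneg)
qed

lemma norm2_nonneg: "0 \<le> norm2 v"
proof -
  have "0 \<le> v \<bullet> v" by (simp add: scalar_prod_def sum_nonneg)
  then show ?thesis by (simp add: norm2_def)
qed

lemma norm2_smult: "norm2 (c \<cdot>\<^sub>v v) = \<bar>c\<bar> * norm2 v"
proof (rule power2_eq_imp_eq)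
  show "(norm2 (c \<cdot>\<^sub>v v))\<^sup>2 = (\<bar>c\<bar> * norm2 v)\<^sup>2"
    by (simp add: norm2_sq power_mult_distrib sum_distrib_left)
qed (simp_all add: norm2_nonneg)

lemma norm2_eq_0:
  assumes "norm2 v = 0"
  shows "v = 0\<^sub>v (dim_vec v)"
proof -
  have "(\<Sum>i<dim_vec v. (v $ i)\<^sup>2) = 0" using norm2_sq[of v] assms by simp
  then have "\<forall>i\<in>{..<dim_vec v}. (v $ i)\<^sup>2 = 0" by (subst (asm) sum_nonneg_eq_0_iff) auto
  then show ?thesis by (intro eq_vecI) auto
qed

lemma norm2_mult_vec_sq:
  assumes A: "A \<in> carrier_mat m n"
  shows "(norm2 (A *\<^sub>v vec n x))\<^sup>2 = (\<Sum>r<m. (\<Sum>c<n. A $$ (r, c) * x c)\<^sup>2)"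
proof -
  have "(A *\<^sub>v vec n x) $ r = (\<Sum>c<n. A $$ (r, c) * x c)" if "r < m" for r
    using that by (simp add: mult_vec_entry[OF A] del: index_mult_mat_vec)
  then show ?thesis using A by (simp add: norm2_sq del: index_mult_mat_vec)
qed

lemma vec_as_function:
  assumes "v \<in> carrier_vec n"
  obtains x where "v = vec n x"
proof
  show "v = vec n (\<lambda>i. v $ i)" using assms by auto
qed

definition ball_values :: "real mat \<Rightarrow> real set" where
  "ball_values M = {norm2 (M *\<^sub>v x) |x. x \<in> carrier_vec (dim_col M) \<and> norm2 x \<le> 1}"

text \<open>The greatest element in the definition of the spectral norm exists because a continuous function
  attains its maximum on the unit ball.\<close>

lemma spectral_norm_max:
  "spectral_norm M \<in> ball_values M" "r \<in> ball_values M \<Longrightarrow> r \<le> spectral_norm M"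
proof -
  define m n where "m = dim_row M" and "n = dim_col M"
  have M: "M \<in> carrier_mat m n" unfolding m_def n_def by (rule carrier_matI) (rule refl)+
  obtain x where x: "(\<Sum>i<n. (x i)\<^sup>2) \<le> 1"
    "\<And>y. (\<Sum>i<n. (y i)\<^sup>2) \<le> 1 \<Longrightarrow> num_sq m n (\<lambda>r c. M $$ (r, c)) y \<le> num_sq m n (\<lambda>r c. M $$ (r, c)) x"
    using max_on_unit_ball[of n m "\<lambda>r c. M $$ (r, c)"] by blast
  have ball: "norm2 (vec n y) \<le> 1 \<longleftrightarrow> (\<Sum>i<n. (y i)\<^sup>2) \<le> 1" for y
  proof -
    have "norm2 (vec n y) \<le> 1 \<longleftrightarrow> (norm2 (vec n y))\<^sup>2 \<le> 1"
      using abs_square_le_1[of "norm2 (vec n y)"] norm2_nonneg[of "vec n y"] by simp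
    then show ?thesis by (simp add: norm2_sq)
  qed
  let ?v = "norm2 (M *\<^sub>v vec n x)"
  have mem: "?v \<in> ball_values M"
    unfolding ball_values_def using ball[of x] x(1) n_def by auto
  have max: "s \<le> ?v" if s: "s \<in> ball_values M" for s
  proof -
    obtain w where w: "w \<in> carrier_vec n" "norm2 w \<le> 1" "s = norm2 (M *\<^sub>v w)"
      using s unfolding ball_values_def n_def by blast
    obtain y where y: "w = vec n y" by (rule vec_as_function[OF w(1)])
    have "num_sq m n (\<lambda>r c. M $$ (r, c)) y \<le> num_sq m n (\<lambda>r c. M $$ (r, c)) x"
      by (rule x(2)) (use w(2) y ball in simp)
    then have "s\<^sup>2 \<le> ?v\<^sup>2"
      unfolding w(3) y norm2_mult_vec_sq[OF M] by (simp add: num_sq_def lin_def)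
    then show ?thesis using norm2_nonneg by (rule power2_le_imp_le)
  qed
  have "spectral_norm M = ?v"
    unfolding spectral_norm_def ball_values_def[symmetric]
    by (rule Greatest_equality) (use mem max in auto)
  then show "spectral_norm M \<in> ball_values M" "r \<in> ball_values M \<Longrightarrow> r \<le> spectral_norm M"
    using mem max by auto
qed

lemma spectral_norm_nonneg: "0 \<le> spectral_norm M"
  using spectral_norm_max(1)[of M] norm2_nonneg by (auto simp: ball_values_def)

section \<open>The constrained maximum as a spectral norm\<close>

text \<open>For a symmetric idempotent matrix, \<open>P y\<close> and \<open>y - P y\<close> are orthogonal.\<close>

lemma projection_contracts:
  assumes P: "P \<in> carrier_mat l l" "transpose_mat P = P" "P * P = P" and y: "y \<in> carrier_vec l"
  shows "norm2 (P *\<^sub>v y) \<le> norm2 y"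
proof -
  let ?p = "P *\<^sub>v y"
  have p: "?p \<in> carrier_vec l" using P(1) y by simp
  have "transpose_mat P *\<^sub>v ?p = ?p"
    unfolding P(2) assoc_mult_mat_vec[OF P(1) P(1) y, symmetric] P(3) by (rule refl)
  then have pp: "?p \<bullet> y = ?p \<bullet> ?p"
    using transpose_vec_mult_scalar[OF P(1) y p] by (simp only:)
  have "0 \<le> (y - ?p) \<bullet> (y - ?p)" by (simp add: scalar_prod_def sum_nonneg)
  also have "(y - ?p) \<bullet> (y - ?p) = (y \<bullet> y - y \<bullet> ?p) - (?p \<bullet> y - ?p \<bullet> ?p)"
    unfolding minus_scalar_prod_distrib[OF y p minus_carrier_vec[OF y p]]
      scalar_prod_minus_distrib[OF y y p] scalar_prod_minus_distrib[OF p y p] by (rule refl)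
  also have "\<dots> = y \<bullet> y - ?p \<bullet> ?p" using pp comm_scalar_prod[OF p y] by linarith
  finally show ?thesis by (simp add: norm2_def)
qed

text \<open>The vector \<open>B\<^sup>+ B v - v\<close> lies in \<open>Ker B\<close> and hence in \<open>Ker A\<close>, so the point \<open>B v\<close> of the unit ball
  gives the same value as \<open>v\<close>. Conversely \<open>B\<^sup>+ x\<close> is feasible since \<open>B B\<^sup>+\<close> is a projection.\<close>

lemma objective_values_eq_ball_values:
  assumes A: "A \<in> carrier_mat m n" and B: "B \<in> carrier_mat l n"
    and ker: "mat_kernel B \<subseteq> mat_kernel A"
  shows "objective_values A B = ball_values (A * pinv B)"
proof -
  define X where "X = pinv B"
  have psi: "is_pseudoinverse B X" unfolding X_def by (rule is_pseudoinverse_pinv)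
  have "X \<in> carrier_mat (dim_col B) (dim_row B)"
    using psi unfolding is_pseudoinverse_def by (rule conjunct1)
  then have X: "X \<in> carrier_mat n l" using B by simp
  have BXB: "B * X * B = B" and XBX: "X * B * X = X" and sym: "transpose_mat (B * X) = B * X"
    using psi unfolding is_pseudoinverse_def by - (elim conjE, assumption)+
  have BX: "B * X \<in> carrier_mat l l" using B X by simp
  have idem: "B * X * (B * X) = B * X"
    unfolding assoc_mult_mat[OF BX B X, symmetric] BXB by (rule refl)
  have AXB: "A *\<^sub>v (X *\<^sub>v (B *\<^sub>v v)) = A *\<^sub>v v" if v: "v \<in> carrier_vec n" for v
  proof -
    let ?w = "X *\<^sub>v (B *\<^sub>v v)"
    have Bv: "B *\<^sub>v v \<in> carrier_vec l" using B v by simp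
    have w: "?w \<in> carrier_vec n" using X Bv by simp
    have "B *\<^sub>v ?w = B * X * B *\<^sub>v v"
      unfolding assoc_mult_mat_vec[OF BX B v] assoc_mult_mat_vec[OF B X Bv] by (rule refl)
    then have Bw: "B *\<^sub>v ?w = B *\<^sub>v v" by (simp only: BXB)
    have "B *\<^sub>v (?w - v) = 0\<^sub>v l"
      unfolding mult_minus_distrib_mat_vec[OF B w v] Bw using Bv by auto
    then have "?w - v \<in> mat_kernel B" by (intro mat_kernelI[OF B]) (use w v in auto)
    then have "?w - v \<in> mat_kernel A" by (rule subsetD[OF ker])
    from mat_kernelD(2)[OF A this] have z: "A *\<^sub>v ?w - A *\<^sub>v v = 0\<^sub>v m"
      unfolding mult_minus_distrib_mat_vec[OF A w v] .
    define a b where "a = A *\<^sub>v ?w" and "b = A *\<^sub>v v"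
    have ab: "a - b = 0\<^sub>v m" "dim_vec a = m" "dim_vec b = m"
      using z A unfolding a_def b_def by simp_all
    have "a = b"
    proof (rule eq_vecI)
      fix i assume i: "i < dim_vec b"
      have "(a - b) $ i = 0" unfolding ab(1) using i ab by simp
      then show "a $ i = b $ i" using i by simp
    qed (use ab in simp)
    then show ?thesis unfolding a_def b_def .
  qed
  have dims: "dim_col A = n" "dim_col (A * X) = l" using A X by auto
  show ?thesis
    unfolding objective_values_def ball_values_def X_def[symmetric] dims
  proof (intro subset_antisym subsetI, elim CollectE exE conjE)
    fix z v assume v: "z = norm2 (A *\<^sub>v v)" "v \<in> carrier_vec n" "norm2 (B *\<^sub>v v) \<le> 1"
    have Bv: "B *\<^sub>v v \<in> carrier_vec l" using B v by simp
    have "A * X *\<^sub>v (B *\<^sub>v v) = A *\<^sub>v v"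
      unfolding assoc_mult_mat_vec[OF A X Bv] by (rule AXB[OF v(2)])
    then show "z \<in> {norm2 (A * X *\<^sub>v x) |x. x \<in> carrier_vec l \<and> norm2 x \<le> 1}"
      unfolding v(1) using v(3) Bv by (intro CollectI exI[of _ "B *\<^sub>v v"]) simp
  next
    fix z assume "z \<in> {norm2 (A * X *\<^sub>v x) |x. x \<in> carrier_vec l \<and> norm2 x \<le> 1}"
    then obtain x where x: "z = norm2 (A * X *\<^sub>v x)" "x \<in> carrier_vec l" "norm2 x \<le> 1" by blast
    have "norm2 (B * X *\<^sub>v x) \<le> 1"
      using projection_contracts[OF BX sym idem x(2)] x(3) by linarith
    then have "norm2 (B *\<^sub>v (X *\<^sub>v x)) \<le> 1" unfolding assoc_mult_mat_vec[OF B X x(2)] .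
    moreover have "z = norm2 (A *\<^sub>v (X *\<^sub>v x))" unfolding x(1) assoc_mult_mat_vec[OF A X x(2)] by (rule refl)
    moreover have "X *\<^sub>v x \<in> carrier_vec n" using X x(2) by simp
    ultimately show "z \<in> {norm2 (A *\<^sub>v v) |v. v \<in> carrier_vec n \<and> norm2 (B *\<^sub>v v) \<le> 1}" by blast
  qed
qed

text \<open>This homogeneous description of the norm no longer mentions the pseudoinverse; scaling passes from
  the constraint \<open>\<parallel>B v\<parallel> \<le> 1\<close> to all vectors, and \<open>Ker B \<subseteq> Ker A\<close> covers the vectors with
  \<open>B v = 0\<close>.\<close>

lemma least_bound_spectral_norm:
  assumes A: "A \<in> carrier_mat m n" and B: "B \<in> carrier_mat l n"
    and ker: "mat_kernel B \<subseteq> mat_kernel A"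
    and KA: "\<And>r c. r < m \<Longrightarrow> c < n \<Longrightarrow> K r c = A $$ (r, c)"
    and KB: "\<And>s c. s < l \<Longrightarrow> c < n \<Longrightarrow> K (m + s) c = B $$ (s, c)"
  shows "least_bound m l n K (spectral_norm (A * pinv B))"
proof -
  define F where "F = spectral_norm (A * pinv B)"
  have F0: "0 \<le> F" unfolding F_def by (rule spectral_norm_nonneg)
  have obj: "objective_values A B = ball_values (A * pinv B)"
    by (rule objective_values_eq_ball_values[OF A B ker])
  have Fmem: "F \<in> objective_values A B" and Fmax: "r \<in> objective_values A B \<Longrightarrow> r \<le> F" for r
    unfolding obj F_def using spectral_norm_max by blast+
  have dA: "dim_col A = n" using A by simp
  have num: "num_sq m n K x = (norm2 (A *\<^sub>v vec n x))\<^sup>2" for x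
    unfolding norm2_mult_vec_sq[OF A] num_sq_def lin_def by (simp add: KA)
  have den: "den_sq m l n K x = (norm2 (B *\<^sub>v vec n x))\<^sup>2" for x
    unfolding norm2_mult_vec_sq[OF B] den_sq_def lin_def by (simp add: KB)
  have le: "norm2 (A *\<^sub>v v) \<le> F * norm2 (B *\<^sub>v v)" if v: "v \<in> carrier_vec n" for v
  proof (cases "norm2 (B *\<^sub>v v) = 0")
    case True
    have "dim_vec (B *\<^sub>v v) = l" using B by simp
    then have "B *\<^sub>v v = 0\<^sub>v l" using norm2_eq_0[OF True] by simp
    then have "v \<in> mat_kernel A" using ker mat_kernelI[OF B v] by blast
    then have "A *\<^sub>v v = 0\<^sub>v m" by (rule mat_kernelD(2)[OF A])
    then have "norm2 (A *\<^sub>v v) = 0" by (simp add: norm2_def)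
    then show ?thesis using True by simp
  next
    case False
    then have pos: "0 < norm2 (B *\<^sub>v v)" using norm2_nonneg[of "B *\<^sub>v v"] by simp
    define c where "c = 1 / norm2 (B *\<^sub>v v)"
    have c: "0 < c" using pos by (simp add: c_def)
    have "norm2 (B *\<^sub>v (c \<cdot>\<^sub>v v)) \<le> 1"
      unfolding mult_mat_vec[OF B v] norm2_smult using pos by (simp add: c_def)
    then have "norm2 (A *\<^sub>v (c \<cdot>\<^sub>v v)) \<le> F"
      using smult_carrier_vec[of c v n] v by (intro Fmax) (auto simp only: objective_values_def dA)
    then have "c * norm2 (A *\<^sub>v v) \<le> F"
      unfolding mult_mat_vec[OF A v] norm2_smult using c by simp
    then show ?thesis using pos by (simp add: c_def pos_divide_le_eq)
  qed
  have "ratio_bound m l n K F"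
    unfolding ratio_bound_def
  proof (intro conjI F0 allI)
    fix x
    have "(norm2 (A *\<^sub>v vec n x))\<^sup>2 \<le> (F * norm2 (B *\<^sub>v vec n x))\<^sup>2"
      by (rule power_mono[OF le norm2_nonneg]) simp
    then show "num_sq m n K x \<le> F\<^sup>2 * den_sq m l n K x"
      unfolding num den power_mult_distrib .
  qed
  moreover have "F \<le> t" if t: "ratio_bound m l n K t" for t
  proof -
    obtain v where v: "F = norm2 (A *\<^sub>v v)" "v \<in> carrier_vec n" "norm2 (B *\<^sub>v v) \<le> 1"
      using Fmem unfolding objective_values_def dA by blast
    obtain x where x: "v = vec n x" by (rule vec_as_function[OF v(2)])
    have t0: "0 \<le> t" using t by (simp add: ratio_bound_def)
    have "num_sq m n K x \<le> t\<^sup>2 * den_sq m l n K x"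
      using t unfolding ratio_bound_def by blast
    then have "F\<^sup>2 \<le> t\<^sup>2 * (norm2 (B *\<^sub>v v))\<^sup>2"
      unfolding num den x[symmetric] v(1)[symmetric] .
    moreover have "t\<^sup>2 * (norm2 (B *\<^sub>v v))\<^sup>2 \<le> t\<^sup>2 * 1"
      by (rule mult_left_mono[OF power_le_one[OF norm2_nonneg v(3)]]) simp
    ultimately have "F\<^sup>2 \<le> t\<^sup>2" by linarith
    then show ?thesis using t0 by (rule power2_le_imp_le)
  qed
  ultimately show ?thesis unfolding least_bound_def F_def[symmetric] by blast
qed

lemma injective_kernel:
  assumes A: "A \<in> carrier_mat m n" and B: "B \<in> carrier_mat l n" and inj: "injective_mat B"
  shows "mat_kernel B \<subseteq> mat_kernel A"
proof
  fix v assume v: "v \<in> mat_kernel B"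
  note vc = mat_kernelD(1)[OF B v]
  have "B *\<^sub>v 0\<^sub>v n = 0\<^sub>v l" using B by auto
  then have eq: "B *\<^sub>v v = B *\<^sub>v 0\<^sub>v n" using mat_kernelD(2)[OF B v] by (simp only:)
  have "inj_on (\<lambda>v. B *\<^sub>v v) (carrier_vec n)" using inj B by (simp add: injective_mat_def)
  then have v0: "v = 0\<^sub>v n" by (rule inj_onD) (rule eq, rule vc, rule zero_carrier_vec)
  have "A *\<^sub>v 0\<^sub>v n = 0\<^sub>v m" using A by auto
  then show "v \<in> mat_kernel A" unfolding v0 by (intro mat_kernelI[OF A zero_carrier_vec])
qed

lemma unbounded_objective:
  assumes A: "A \<in> carrier_mat m n" and B: "B \<in> carrier_mat l n"
    and ker: "\<not> mat_kernel B \<subseteq> mat_kernel A"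
  shows "\<not> bdd_above (objective_values A B)"
proof
  assume "bdd_above (objective_values A B)"
  then obtain b where b: "\<And>r. r \<in> objective_values A B \<Longrightarrow> r \<le> b" unfolding bdd_above_def by blast
  obtain v where v: "v \<in> mat_kernel B" "v \<notin> mat_kernel A" using ker by blast
  have vc: "v \<in> carrier_vec n" and Bv: "B *\<^sub>v v = 0\<^sub>v l" using mat_kernelD[OF B v(1)] by auto
  have "norm2 (A *\<^sub>v v) \<noteq> 0"
  proof
    assume "norm2 (A *\<^sub>v v) = 0"
    from norm2_eq_0[OF this] have "A *\<^sub>v v = 0\<^sub>v m" using A by simp
    then show False using v(2) mat_kernelI[OF A vc] by blast
  qed
  then have pos: "0 < norm2 (A *\<^sub>v v)" using norm2_nonneg[of "A *\<^sub>v v"] by simp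
  have le: "\<bar>c\<bar> * norm2 (A *\<^sub>v v) \<le> b" for c
  proof -
    have "norm2 (B *\<^sub>v (c \<cdot>\<^sub>v v)) = \<bar>c\<bar> * norm2 (0\<^sub>v l :: real vec)"
      unfolding mult_mat_vec[OF B vc] norm2_smult Bv by (rule refl)
    then have "norm2 (B *\<^sub>v (c \<cdot>\<^sub>v v)) \<le> 1" by (simp add: norm2_def)
    then have "norm2 (A *\<^sub>v (c \<cdot>\<^sub>v v)) \<le> b"
      using vc A by (intro b) (auto simp: objective_values_def)
    then show ?thesis unfolding mult_mat_vec[OF A vc] norm2_smult .
  qed
  have "\<bar>(\<bar>b\<bar> + 1) / norm2 (A *\<^sub>v v)\<bar> * norm2 (A *\<^sub>v v) = \<bar>b\<bar> + 1" using pos by simp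
  then have "\<bar>b\<bar> + 1 \<le> b" using le[of "(\<bar>b\<bar> + 1) / norm2 (A *\<^sub>v v)"] by (simp only:)
  then show False by linarith
qed

section \<open>Time-bounded executions\<close>

text \<open>A judgement of total correctness with a bound on the number of steps.\<close>

definition runs :: "com \<Rightarrow> state \<Rightarrow> nat \<Rightarrow> (state \<Rightarrow> bool) \<Rightarrow> bool" where
  "runs c s T Q \<longleftrightarrow> (\<exists>t s'. exec c s t s' \<and> t \<le> T \<and> Q s')"

lemma runs_weaken:
  assumes "runs c s T P" "T \<le> T'" "\<And>s'. P s' \<Longrightarrow> Q s'"
  shows "runs c s T' Q"
  using assms unfolding runs_def by (meson order_trans)

lemma runs_Seq:
  assumes "runs c1 s T1 P" "\<And>s'. P s' \<Longrightarrow> runs c2 s' T2 Q"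
  shows "runs (Seq c1 c2) s (T1 + T2) Q"
proof -
  obtain t1 s1 where 1: "exec c1 s t1 s1" "t1 \<le> T1" "P s1"
    using assms(1) unfolding runs_def by blast
  obtain t2 s2 where 2: "exec c2 s1 t2 s2" "t2 \<le> T2" "Q s2"
    using assms(2)[OF 1(3)] unfolding runs_def by blast
  show ?thesis unfolding runs_def
    using exec.intros(8)[OF 1(1) 2(1)] add_mono[OF 1(2) 2(2)] 2(3) by blast
qed

lemma runs_IConst: "Q (I(a := k), R) \<Longrightarrow> 1 \<le> T \<Longrightarrow> runs (IConst a k) (I, R) T Q"
  and runs_IAdd: "Q (I(a := I b + I c), R) \<Longrightarrow> 1 \<le> T \<Longrightarrow> runs (IAdd a b c) (I, R) T Q"
  and runs_ISub: "Q (I(a := I b - I c), R) \<Longrightarrow> 1 \<le> T \<Longrightarrow> runs (ISub a b c) (I, R) T Q"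
  and runs_RConst: "Q (I, R(I a := real_of_int z)) \<Longrightarrow> 1 \<le> T \<Longrightarrow> runs (RConst a z) (I, R) T Q"
  and runs_RCopy: "Q (I, R(I a := R (I b))) \<Longrightarrow> 1 \<le> T \<Longrightarrow> runs (RCopy a b) (I, R) T Q"
  and runs_ROp: "(f = Divide \<Longrightarrow> R (I c) \<noteq> 0) \<Longrightarrow> Q (I, R(I a := rop_val f (R (I b)) (R (I c))))
    \<Longrightarrow> 1 \<le> T \<Longrightarrow> runs (ROp f a b c) (I, R) T Q"
  unfolding runs_def by (meson exec.intros)+

lemma runs_Cond:
  assumes "holds b s \<Longrightarrow> runs c1 s T Q" "\<not> holds b s \<Longrightarrow> runs c2 s T Q"
  shows "runs (Cond b c1 c2) s (T + 1) Q"
proof (cases "holds b s")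
  case True
  then obtain t s' where "exec c1 s t s'" "t \<le> T" "Q s'"
    using assms(1) unfolding runs_def by blast
  then show ?thesis unfolding runs_def using exec.intros(9)[OF True]
    by (meson add_le_mono1)
next
  case False
  then obtain t s' where "exec c2 s t s'" "t \<le> T" "Q s'"
    using assms(2) unfolding runs_def by blast
  then show ?thesis unfolding runs_def using exec.intros(10)[OF False]
    by (meson add_le_mono1)
qed

text \<open>The invariant \<open>J\<close> is indexed by the number of completed rounds, which also determines when the loop
  stops.\<close>

lemma runs_While:
  assumes "J 0 s"
    and "\<And>i s. i < n \<Longrightarrow> J i s \<Longrightarrow> holds b s"
    and "\<And>i s. i < n \<Longrightarrow> J i s \<Longrightarrow> runs c s T (J (Suc i))"
    and "\<And>s. J n s \<Longrightarrow> \<not> holds b s"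
  shows "runs (While b c) s (n * (T + 1) + 1) (J n)"
proof -
  have "J i s \<Longrightarrow> i \<le> n \<Longrightarrow> runs (While b c) s ((n - i) * (T + 1) + 1) (J n)" for i s
  proof (induction "n - i" arbitrary: i s)
    case 0
    then have "i = n" by simp
    then show ?case using 0 exec.intros(11)[of b s c] assms(4)[of s] unfolding runs_def
      by (metis diff_self_eq_0 le_add2 mult_0)
  next
    case (Suc k)
    then have i: "i < n" "k = n - Suc i" by auto
    obtain t1 s1 where 1: "exec c s t1 s1" "t1 \<le> T" "J (Suc i) s1"
      using assms(3)[OF i(1)] Suc.prems unfolding runs_def by blast
    have "runs (While b c) s1 ((n - Suc i) * (T + 1) + 1) (J n)"
      using Suc.hyps(1)[OF i(2)] 1 i by auto
    then obtain t2 s2 where 2: "exec (While b c) s1 t2 s2" "t2 \<le> (n - Suc i) * (T + 1) + 1" "J n s2"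
      unfolding runs_def by blast
    have "n - i = Suc (n - Suc i)" using i by simp
    then have "t1 + t2 + 1 \<le> (n - i) * (T + 1) + 1"
      using 1 2 by simp
    then show ?case unfolding runs_def
      using exec.intros(12)[OF assms(2)[OF i(1) Suc.prems(1)] 1(1) 2(1)] 2(3) by blast
  qed
  from this[OF assms(1)] show ?thesis by simp
qed

section \<open>Polynomially bounded functions\<close>

definition poly_bdd :: "(nat \<Rightarrow> nat) \<Rightarrow> bool" where
  "poly_bdd p \<longleftrightarrow> (\<exists>d. \<forall>N. p N \<le> d * (N + 1) ^ d)"

lemma poly_bddI:
  assumes "\<And>N. p N \<le> a * (N + 1) ^ b"
  shows "poly_bdd p"
proof -
  have "p N \<le> (a + b) * (N + 1) ^ (a + b)" for N
    using assms[of N] mult_mono[of a "a + b" "(N + 1) ^ b" "(N + 1) ^ (a + b)"]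
      power_increasing[of b "a + b" "N + 1"] by linarith
  then show ?thesis unfolding poly_bdd_def by blast
qed

lemma poly_bdd_const: "poly_bdd (\<lambda>N. c)"
  by (rule poly_bddI[of _ c 0]) simp

lemma poly_bdd_id: "poly_bdd (\<lambda>N. N)"
  by (rule poly_bddI[of _ 1 1]) simp

lemma poly_bdd_add:
  assumes "poly_bdd p" "poly_bdd q"
  shows "poly_bdd (\<lambda>N. p N + q N)"
proof -
  obtain a b where ab: "p N \<le> a * (N + 1) ^ a" "q N \<le> b * (N + 1) ^ b" for N
    using assms unfolding poly_bdd_def by blast
  have "p N + q N \<le> (a + b) * (N + 1) ^ (a + b)" for N
    using ab[of N] mult_le_mono2[OF power_increasing[of a "a + b" "N + 1"], of a]
      mult_le_mono2[OF power_increasing[of b "a + b" "N + 1"], of b]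
    unfolding distrib_right by linarith
  then show ?thesis by (rule poly_bddI)
qed

lemma poly_bdd_mult:
  assumes "poly_bdd p" "poly_bdd q"
  shows "poly_bdd (\<lambda>N. p N * q N)"
proof -
  obtain a b where ab: "p N \<le> a * (N + 1) ^ a" "q N \<le> b * (N + 1) ^ b" for N
    using assms unfolding poly_bdd_def by blast
  have "p N * q N \<le> (a * b) * (N + 1) ^ (a + b)" for N
    using mult_mono[OF ab(1)[of N] ab(2)[of N]] by (simp add: power_add ac_simps)
  then show ?thesis by (rule poly_bddI)
qed

text \<open>Inside a loop the index values may exceed those outside by a constant factor; this composition
  keeps the time bounds polynomial.\<close>

lemma poly_bdd_scale:
  assumes "poly_bdd p"
  shows "poly_bdd (\<lambda>N. p (c * (N + 1)))"
proof -
  obtain a where a: "p N \<le> a * (N + 1) ^ a" for N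
    using assms unfolding poly_bdd_def by blast
  have "p (c * (N + 1)) \<le> (a * (c + 1) ^ a) * (N + 1) ^ a" for N
  proof -
    have "(c * (N + 1) + 1) ^ a \<le> ((c + 1) * (N + 1)) ^ a"
      by (rule power_mono) (auto simp: algebra_simps)
    then have "a * (c * (N + 1) + 1) ^ a \<le> a * ((c + 1) * (N + 1)) ^ a" by (rule mult_le_mono2)
    also have "\<dots> = (a * (c + 1) ^ a) * (N + 1) ^ a" by (simp only: power_mult_distrib mult.assoc)
    finally show ?thesis using a[of "c * (N + 1)"] by linarith
  qed
  then show ?thesis by (rule poly_bddI)
qed

lemmas poly_bdd_intros = poly_bdd_const poly_bdd_id poly_bdd_add poly_bdd_mult poly_bdd_scale

section \<open>A loop language for matrix algorithms\<close>

text \<open>Index expressions have no products, so their values are linear in the values of the variables, and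
  this keeps all loop bounds polynomial.\<close>

datatype ix = IVar nat | INum nat | ISum ix ix

fun ix_val :: "(nat \<Rightarrow> nat) \<Rightarrow> ix \<Rightarrow> nat" where
  "ix_val e (IVar v) = e v"
| "ix_val e (INum c) = c"
| "ix_val e (ISum s t) = ix_val e s + ix_val e t"

fun ix_vars :: "ix \<Rightarrow> nat set" where
  "ix_vars (IVar v) = {v}"
| "ix_vars (INum c) = {}"
| "ix_vars (ISum s t) = ix_vars s \<union> ix_vars t"

text \<open>\<open>Inp r c\<close> denotes the entry in row \<open>r\<close> and column \<open>c\<close> of the input, \<open>A\<close> on top of \<open>B\<close>, and
  \<open>Cell a r c\<close> an entry of the matrix with number \<open>a\<close>. Sums bind their summation variable.\<close>

datatype rexp =
    Num int
  | Inp ix ix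
  | Cell nat ix ix
  | Bin rop rexp rexp
  | Sum nat ix rexp
  | IfIdx ix ix rexp rexp
  | IfLess rexp rexp rexp rexp

type_synonym mem = "nat \<Rightarrow> nat \<Rightarrow> nat \<Rightarrow> real"

text \<open>Expressions are evaluated in an environment of index variables that programs cannot assign.
  Variable \<open>2\<close> holds the number of columns \<open>n\<close>, the row length of the input. Division is total.\<close>

fun rval :: "(nat \<Rightarrow> real) \<Rightarrow> mem \<Rightarrow> (nat \<Rightarrow> nat) \<Rightarrow> rexp \<Rightarrow> real" where
  "rval inp M e (Num z) = real_of_int z"
| "rval inp M e (Inp r c) = inp (ix_val e c + ix_val e r * e 2)"
| "rval inp M e (Cell a r c) = M a (ix_val e r) (ix_val e c)"
| "rval inp M e (Bin f x y) = rop_val f (rval inp M e x) (rval inp M e y)"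
| "rval inp M e (Sum v b x) = (\<Sum>i<ix_val e b. rval inp M (e(v := i)) x)"
| "rval inp M e (IfIdx s t x y) =
     (if ix_val e s < ix_val e t then rval inp M e x else rval inp M e y)"
| "rval inp M e (IfLess u w x y) =
     (if rval inp M e u < rval inp M e w then rval inp M e x else rval inp M e y)"

text \<open>The set \<open>X\<close> contains the variables that are in scope. A variable may be bound only outside its own
  scope, because its register serves as loop counter.\<close>

fun rexp_ok :: "nat set \<Rightarrow> rexp \<Rightarrow> bool" where
  "rexp_ok X (Bin f x y) = (rexp_ok X x \<and> rexp_ok X y)"
| "rexp_ok X (Sum v b x) = (v \<notin> X \<and> v \<notin> ix_vars b \<and> rexp_ok (insert v X) x)"
| "rexp_ok X (IfIdx s t x y) = (rexp_ok X x \<and> rexp_ok X y)"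
| "rexp_ok X (IfLess u w x y) = (rexp_ok X u \<and> rexp_ok X w \<and> rexp_ok X x \<and> rexp_ok X y)"
| "rexp_ok X _ = True"

text \<open>\<open>Fill a v b w b' x\<close> assigns \<open>x\<close> to all entries of matrix \<open>a\<close> with row \<open>v < b\<close> and column
  \<open>w < b'\<close> simultaneously: \<open>x\<close> refers to the old contents, also of \<open>a\<close> itself.\<close>

datatype cmd =
    Fill nat nat ix nat ix rexp
  | Then cmd cmd
  | For nat ix cmd

fun sem :: "(nat \<Rightarrow> real) \<Rightarrow> (nat \<Rightarrow> nat) \<Rightarrow> cmd \<Rightarrow> mem \<Rightarrow> mem" where
  "sem inp e (Fill a v b w b' x) M =
     M(a := \<lambda>i j. if i < ix_val e b \<and> j < ix_val e b' then rval inp M (e(v := i, w := j)) x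
                  else M a i j)"
| "sem inp e (Then c c') M = sem inp e c' (sem inp e c M)"
| "sem inp e (For v b c) M = fold (\<lambda>i. sem inp (e(v := i)) c) [0..<ix_val e b] M"

fun cmd_ok :: "nat set \<Rightarrow> cmd \<Rightarrow> bool" where
  "cmd_ok X (Fill a v b w b' x) = (v \<notin> X \<and> w \<notin> X \<and> v \<noteq> w \<and> v \<notin> ix_vars b \<union> ix_vars b' \<and>
     w \<notin> ix_vars b \<union> ix_vars b' \<and> rexp_ok (insert v (insert w X)) x)"
| "cmd_ok X (Then c c') = (cmd_ok X c \<and> cmd_ok X c')"
| "cmd_ok X (For v b c) = (v \<notin> X \<and> v \<notin> ix_vars b \<and> cmd_ok (insert v X) c)"

section \<open>Registers, addresses and loops of the compiled code\<close>

text \<open>The registers \<open>4\<close> to \<open>19\<close> are reserved for the compiled code: the first address after the input, the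
  constants \<open>0\<close> and \<open>1\<close>, scratch registers, pointers to real cells and the bound of a loop.\<close>

abbreviation (input) "base_reg \<equiv> (4::nat)"
abbreviation (input) "zero_reg \<equiv> (5::nat)"
abbreviation (input) "one_reg \<equiv> (6::nat)"
abbreviation (input) "const_reg \<equiv> (7::nat)"
abbreviation (input) "count_reg \<equiv> (8::nat)"
abbreviation (input) "row_reg \<equiv> (9::nat)"
abbreviation (input) "col_reg \<equiv> (10::nat)"
abbreviation (input) "pair_reg \<equiv> (11::nat)"
abbreviation (input) "ptr1 \<equiv> (12::nat)"
abbreviation (input) "ptr2 \<equiv> (13::nat)"
abbreviation (input) "ptr3 \<equiv> (14::nat)"
abbreviation (input) "bound_reg \<equiv> (15::nat)"

text \<open>The variables \<open>0\<close> to \<open>3\<close> stay in the registers in which the input supplies them; the others are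
  moved out of the way of the reserved registers.\<close>

definition reg :: "nat \<Rightarrow> nat" where
  "reg v = (if v < 4 then v else v + 16)"

lemma reg_neq: "4 \<le> r \<Longrightarrow> r < 20 \<Longrightarrow> reg v \<noteq> r" "4 \<le> r \<Longrightarrow> r < 20 \<Longrightarrow> r \<noteq> reg v"
  by (auto simp: reg_def split: if_splits)

text \<open>What holds of the index registers between any two compiled statements, for the environment \<open>e\<close>.\<close>

definition frame :: "nat \<Rightarrow> (nat \<Rightarrow> nat) \<Rightarrow> (nat \<Rightarrow> nat) \<Rightarrow> bool" where
  "frame b e I \<longleftrightarrow> I base_reg = b \<and> I zero_reg = 0 \<and> I one_reg = 1 \<and> (\<forall>v. I (reg v) = e v)"

text \<open>The code \<open>c\<close> stores \<open>x\<close> in register \<open>q\<close>, changes no real cell, and apart from \<open>q\<close> modifies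
  registers in \<open>W\<close> only.\<close>

definition sets :: "nat set \<Rightarrow> com \<Rightarrow> nat \<Rightarrow> nat \<Rightarrow> nat \<Rightarrow> (nat \<Rightarrow> nat) \<Rightarrow> bool" where
  "sets W c q x T I \<longleftrightarrow> (\<forall>R. runs c (I, R) T (\<lambda>(I', R'). R' = R \<and> I' q = x \<and>
     (\<forall>r. r \<notin> W \<and> r \<noteq> q \<longrightarrow> I' r = I r)))"

lemma sets_frame:
  assumes "frame b e I" "\<forall>r. r \<notin> W \<and> r \<noteq> q \<longrightarrow> I' r = I r" "W \<subseteq> {7..<20}" "7 \<le> q" "q < 20"
  shows "frame b e I'"
proof -
  have "reg v \<notin> {7..<20}" for v
    by (auto simp: reg_def)
  then have "reg v \<notin> W \<and> reg v \<noteq> q" "r < 7 \<Longrightarrow> r \<notin> W \<and> r \<noteq> q" for v r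
    using assms(3-5) by force+
  then show ?thesis using assms unfolding frame_def by auto
qed

fun add_ix :: "nat \<Rightarrow> ix \<Rightarrow> com" where
  "add_ix q (IVar v) = IAdd q q (reg v)"
| "add_ix q (INum c) = Seq (IConst const_reg c) (IAdd q q const_reg)"
| "add_ix q (ISum s t) = Seq (add_ix q s) (add_ix q t)"

definition set_ix :: "nat \<Rightarrow> ix \<Rightarrow> com" where
  "set_ix q t = Seq (IConst q 0) (add_ix q t)"

fun ix_time :: "ix \<Rightarrow> nat" where
  "ix_time (IVar v) = 1"
| "ix_time (INum c) = 2"
| "ix_time (ISum s t) = ix_time s + ix_time t"

lemma runs_add_ix:
  assumes "\<forall>v. I (reg v) = e v" "7 < q" "q < 20"
  shows "runs (add_ix q t) (I, R) (ix_time t)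
    (\<lambda>(I', R'). R' = R \<and> I' q = I q + ix_val e t \<and> (\<forall>r. r \<noteq> const_reg \<and> r \<noteq> q \<longrightarrow> I' r = I r))"
  using assms
proof (induction t arbitrary: I)
  case (IVar v)
  then show ?case by (auto intro!: runs_IAdd)
next
  case (INum c)
  show ?case
    unfolding add_ix.simps ix_time.simps one_add_one[symmetric]
    by (rule runs_Seq, rule runs_IConst[where Q="\<lambda>s. s = (I(const_reg := c), R)"], simp)
      (use INum in \<open>auto intro!: runs_IAdd\<close>)
next
  case (ISum s t)
  show ?case unfolding add_ix.simps ix_time.simps
  proof (rule runs_Seq[OF ISum.IH(1)], goal_cases)
    case (4 s')
    obtain I' R' where s': "s' = (I', R')" by (cases s')
    have *: "R' = R" "I' q = I q + ix_val e s" "\<forall>r. r \<noteq> const_reg \<and> r \<noteq> q \<longrightarrow> I' r = I r"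
      using 4 s' by auto
    have "\<forall>v. I' (reg v) = e v"
      using *(3) ISum.prems reg_neq[of q] reg_neq[of const_reg] by auto
    from ISum.IH(2)[OF this ISum.prems(2,3)] show ?case
      unfolding s' *(1) by (rule runs_weaken) (use * in auto)
  qed (use ISum.prems in auto)
qed

lemma sets_set_ix:
  assumes "frame b e I" "7 < q" "q < 20"
  shows "sets {const_reg} (set_ix q t) q (ix_val e t) (1 + ix_time t) I"
  unfolding sets_def set_ix_def
proof
  fix R :: "nat \<Rightarrow> real"
  have e: "\<forall>v. (I(q := 0)) (reg v) = e v"
    using assms reg_neq[of q] by (auto simp: frame_def)
  show "runs (Seq (IConst q 0) (add_ix q t)) (I, R) (1 + ix_time t)
          (\<lambda>(I', R'). R' = R \<and> I' q = ix_val e t \<and> (\<forall>r. r \<notin> {const_reg} \<and> r \<noteq> q \<longrightarrow> I' r = I r))"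
    by (rule runs_Seq, rule runs_IConst[where Q="\<lambda>s. s = (I(q := 0), R)"], simp)
      (auto intro!: runs_weaken[OF runs_add_ix[OF e assms(2,3)]])
qed

lemma sets_weaken: "sets W c q x T I \<Longrightarrow> T \<le> T' \<Longrightarrow> W \<subseteq> W' \<Longrightarrow> sets W' c q x T' I"
  unfolding sets_def by (rule allI, rule runs_weaken, erule allE, assumption) auto

lemma runs_Seq_sets:
  assumes "sets W c1 q x T1 I"
    and "\<And>I'. I' q = x \<Longrightarrow> \<forall>r. r \<notin> W \<and> r \<noteq> q \<longrightarrow> I' r = I r \<Longrightarrow> runs c2 (I', R) T2 Q"
  shows "runs (Seq c1 c2) (I, R) (T1 + T2) Q"
  by (rule runs_Seq[OF assms(1)[unfolded sets_def, rule_format]]) (use assms(2) in auto)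

lemma sets_Seq:
  assumes "sets W1 c1 q1 x1 T1 I" "W1 \<union> {q1} \<subseteq> W \<union> {q}"
    and "\<And>I'. I' q1 = x1 \<Longrightarrow> \<forall>r. r \<notin> W1 \<and> r \<noteq> q1 \<longrightarrow> I' r = I r \<Longrightarrow> sets W c2 q x T2 I'"
  shows "sets W (Seq c1 c2) q x (T1 + T2) I"
  unfolding sets_def
proof
  fix R :: "nat \<Rightarrow> real"
  show "runs (Seq c1 c2) (I, R) (T1 + T2) (\<lambda>(I', R'). R' = R \<and> I' q = x \<and>
     (\<forall>r. r \<notin> W \<and> r \<noteq> q \<longrightarrow> I' r = I r))"
  proof (rule runs_Seq_sets[OF assms(1)])
    fix I'
    assume I': "I' q1 = x1" "\<forall>r. r \<notin> W1 \<and> r \<noteq> q1 \<longrightarrow> I' r = I r"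
    show "runs c2 (I', R) T2 (\<lambda>(I', R'). R' = R \<and> I' q = x \<and>
       (\<forall>r. r \<notin> W \<and> r \<noteq> q \<longrightarrow> I' r = I r))"
      by (rule runs_weaken[OF assms(3)[OF I', unfolded sets_def, rule_format]])
        (use I' assms(2) in auto)
  qed
qed

lemma sets_IConst: "sets {} (IConst q k) q k 1 I"
  and sets_IAdd: "sets {} (IAdd q u v) q (I u + I v) 1 I"
  unfolding sets_def by (auto intro!: runs_IConst runs_IAdd)

text \<open>Computes Cantor's pairing function: a triangular number is accumulated while counting down.\<close>

definition pair_code :: "nat \<Rightarrow> nat \<Rightarrow> nat \<Rightarrow> com" where
  "pair_code q u v = Seq (IAdd count_reg u v) (Seq (IAdd q u zero_reg)
     (While (ILess zero_reg count_reg)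
       (Seq (IAdd q q count_reg) (ISub count_reg count_reg one_reg))))"

lemma sets_pair_code:
  assumes "I zero_reg = 0" "I one_reg = 1" "q \<notin> {zero_reg, one_reg, count_reg}" "u \<noteq> count_reg"
  shows "sets {count_reg} (pair_code q u v) q (prod_encode (I u, I v)) (3 * (I u + I v) + 3) I"
  unfolding sets_def pair_code_def
proof
  fix R :: "nat \<Rightarrow> real"
  define I1 where "I1 = I(count_reg := I u + I v)"
  define I2 where "I2 = I1(q := I u)"
  define J where "J = (\<lambda>i (I', R'). R' = R \<and> I' count_reg = I u + I v - i \<and>
    I' q + triangle (I u + I v - i) = I u + triangle (I u + I v) \<and>
    (\<forall>r. r \<noteq> count_reg \<and> r \<noteq> q \<longrightarrow> I' r = I r))"
  have 1: "runs (IAdd count_reg u v) (I, R) 1 (\<lambda>s. s = (I1, R))"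
    by (rule runs_IAdd) (auto simp: I1_def)
  have 2: "runs (IAdd q u zero_reg) (I1, R) 1 (\<lambda>s. s = (I2, R))"
    by (rule runs_IAdd) (use assms in \<open>auto simp: I1_def I2_def\<close>)
  have 3: "runs (While (ILess zero_reg count_reg)
      (Seq (IAdd q q count_reg) (ISub count_reg count_reg one_reg))) (I2, R)
      ((I u + I v) * (2 + 1) + 1) (J (I u + I v))"
  proof (rule runs_While)
    show "J 0 (I2, R)" using assms by (auto simp: J_def I1_def I2_def)
  next
    fix i s assume "i < I u + I v" "J i s"
    then show "holds (ILess zero_reg count_reg) s" using assms by (cases s) (auto simp: J_def)
  next
    fix i s assume i: "i < I u + I v" and J: "J i s"
    obtain I' R' where s: "s = (I', R')" by (cases s)
    define k where "k = I u + I v - Suc i"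
    have k: "I u + I v - i = Suc k" using i by (simp add: k_def)
    have *: "R' = R" "I' count_reg = Suc k" "I' q + triangle (Suc k) = I u + triangle (I u + I v)"
      "\<And>r. r \<noteq> count_reg \<and> r \<noteq> q \<longrightarrow> I' r = I r"
      using J k by (auto simp: J_def s)
    have "runs (Seq (IAdd q q count_reg) (ISub count_reg count_reg one_reg)) s (1 + 1) (J (Suc i))"
      unfolding s
      by (rule runs_Seq, rule runs_IAdd[where Q="\<lambda>s. s = (I'(q := I' q + I' count_reg), R')"])
        (use * assms k_def in \<open>auto intro!: runs_ISub simp: J_def\<close>)
    then show "runs (Seq (IAdd q q count_reg) (ISub count_reg count_reg one_reg)) s 2 (J (Suc i))"
      by (simp add: numeral_2_eq_2)
  next
    fix s assume "J (I u + I v) s"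
    then show "\<not> holds (ILess zero_reg count_reg) s" using assms by (cases s) (auto simp: J_def)
  qed
  have "runs (Seq (IAdd count_reg u v) (Seq (IAdd q u zero_reg)
     (While (ILess zero_reg count_reg)
       (Seq (IAdd q q count_reg) (ISub count_reg count_reg one_reg))))) (I, R)
       (1 + (1 + ((I u + I v) * (2 + 1) + 1))) (J (I u + I v))"
    by (rule runs_Seq[OF 1], erule ssubst, rule runs_Seq[OF 2], erule ssubst, rule 3)
  then show "runs (Seq (IAdd count_reg u v) (Seq (IAdd q u zero_reg)
     (While (ILess zero_reg count_reg)
       (Seq (IAdd q q count_reg) (ISub count_reg count_reg one_reg))))) (I, R)
       (3 * (I u + I v) + 3) (\<lambda>(I', R'). R' = R \<and> I' q = prod_encode (I u, I v) \<and>
              (\<forall>r. r \<notin> {count_reg} \<and> r \<noteq> q \<longrightarrow> I' r = I r))"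
    by (rule runs_weaken) (auto simp: J_def prod_encode_def)
qed

definition mul_code :: "nat \<Rightarrow> nat \<Rightarrow> nat \<Rightarrow> com" where
  "mul_code q c w = While (ILess zero_reg c) (Seq (IAdd q q w) (ISub c c one_reg))"

lemma sets_mul_code:
  assumes "I zero_reg = 0" "I one_reg = 1" "q \<noteq> c" "w \<notin> {q, c}" "zero_reg \<notin> {q, c}"
    "one_reg \<notin> {q, c}"
  shows "sets {c} (mul_code q c w) q (I q + I c * I w) (3 * I c + 1) I"
  unfolding sets_def mul_code_def
proof
  fix R :: "nat \<Rightarrow> real"
  define J where "J = (\<lambda>i (I', R'). R' = R \<and> I' c = I c - i \<and> I' q = I q + i * I w \<and>
    (\<forall>r. r \<noteq> c \<and> r \<noteq> q \<longrightarrow> I' r = I r))"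
  have "runs (While (ILess zero_reg c) (Seq (IAdd q q w) (ISub c c one_reg))) (I, R)
      (I c * ((1 + 1) + 1) + 1) (J (I c))"
  proof (rule runs_While)
    show "J 0 (I, R)" using assms by (auto simp: J_def)
  next
    fix i s assume "i < I c" "J i s"
    then show "holds (ILess zero_reg c) s" using assms by (cases s) (auto simp: J_def)
  next
    fix i s assume i: "i < I c" and J: "J i s"
    obtain I' R' where s: "s = (I', R')" by (cases s)
    show "runs (Seq (IAdd q q w) (ISub c c one_reg)) s (1 + 1) (J (Suc i))"
      unfolding s
      by (rule runs_Seq, rule runs_IAdd[where Q="\<lambda>s. s = (I'(q := I' q + I' w), R')"])
        (use J i assms s in \<open>auto intro!: runs_ISub simp: J_def\<close>)
  next
    fix s assume "J (I c) s"
    then show "\<not> holds (ILess zero_reg c) s" using assms by (cases s) (auto simp: J_def)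
  qed
  then show "runs (While (ILess zero_reg c) (Seq (IAdd q q w) (ISub c c one_reg))) (I, R)
     (3 * I c + 1) (\<lambda>(I', R'). R' = R \<and> I' q = I q + I c * I w \<and>
              (\<forall>r. r \<notin> {c} \<and> r \<noteq> q \<longrightarrow> I' r = I r))"
    by (rule runs_weaken) (use assms in \<open>auto simp: J_def\<close>)
qed

fun ix_size :: "ix \<Rightarrow> nat" where
  "ix_size (IVar v) = 1"
| "ix_size (INum c) = c"
| "ix_size (ISum s t) = ix_size s + ix_size t"

lemma ix_val_le: "\<forall>v. e v \<le> N \<Longrightarrow> ix_val e t \<le> ix_size t * (N + 1)"
proof (induction t)
  case (IVar v)
  then show ?case using le_Suc_eq by auto
qed (auto simp: distrib_right)

text \<open>Real cell of entry \<open>(i, j)\<close> in a memory area \<open>c\<close>. Pairing makes all areas disjoint and unbounded, so no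
  matrix dimensions have to be known to address an entry, while addresses remain polynomial in the
  indices. Area \<open>0\<close> holds intermediate results, area \<open>1\<close> is for staging, and area \<open>a + 2\<close>
  holds matrix \<open>a\<close>.\<close>

definition slot :: "nat \<Rightarrow> nat \<Rightarrow> nat \<Rightarrow> nat \<Rightarrow> nat" where
  "slot b c i j = prod_encode (prod_encode (i, j), c) + b"

lemma slot_eq [simp]: "slot b c i j = slot b c' i' j' \<longleftrightarrow> c = c' \<and> i = i' \<and> j = j'"
  by (auto simp: slot_def)

lemma slot_ge: "b \<le> slot b c i j"
  by (simp add: slot_def)

definition slot_addr :: "nat \<Rightarrow> nat \<Rightarrow> ix \<Rightarrow> ix \<Rightarrow> com" where
  "slot_addr q c i j = Seq (set_ix row_reg i) (Seq (set_ix col_reg j)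
     (Seq (pair_code pair_reg row_reg col_reg) (Seq (IConst row_reg c)
       (Seq (pair_code q pair_reg row_reg) (IAdd q q base_reg)))))"

lemma triangle_le: "triangle n \<le> n * (n + 1)"
  by (simp add: triangle_def)

text \<open>The time is that of the two nested pairings, whose loops run as long as the values that they add
  up.\<close>

lemma sets_slot_addr:
  "\<exists>p. poly_bdd p \<and> (\<forall>q c b e N I. (\<forall>v. e v \<le> N) \<longrightarrow> frame b e I \<longrightarrow> q \<in> {12..<20} \<longrightarrow>
     sets {7..<12} (slot_addr q c i j) q (slot b c (ix_val e i) (ix_val e j)) (p N + 3 * c) I)"
proof -
  define s where "s = (\<lambda>N::nat. (ix_size i + ix_size j) * (N + 1))"
  define p where "p = (\<lambda>N. (1 + ix_time i) + (1 + ix_time j) + (3 * s N + 3) + 1 +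
    (3 * (s N * (s N + 1) + s N) + 3) + 1)"
  have "poly_bdd p" unfolding p_def s_def by (intro poly_bdd_intros)
  moreover have "sets {7..<12} (slot_addr q c i j) q (slot b c (ix_val e i) (ix_val e j)) (p N + 3 * c) I"
    if N: "\<forall>v. e v \<le> N" and fr: "frame b e I" and q: "q \<in> {12..<20}" for q c b e N I
  proof -
    let ?u = "ix_val e i" and ?v = "ix_val e j"
    have uv: "?u + ?v \<le> s N"
      using ix_val_le[OF N, of i] ix_val_le[OF N, of j] by (simp add: s_def distrib_right)
    then have "triangle (?u + ?v) \<le> s N * (s N + 1)"
      by (meson triangle_le add_le_mono1 le_trans mult_le_mono)
    then have P: "prod_encode (?u, ?v) \<le> s N * (s N + 1) + s N"
      using uv by (simp add: prod_encode_def)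
    have "sets {7..<12} (slot_addr q c i j) q (slot b c ?u ?v) ((1 + ix_time i) + ((1 + ix_time j) +
       ((3 * (?u + ?v) + 3) + (1 + ((3 * (prod_encode (?u, ?v) + c) + 3) + 1))))) I"
      unfolding slot_addr_def
    proof (rule sets_Seq[OF sets_set_ix[OF fr]])
      fix I1 assume 1: "I1 row_reg = ?u" "\<forall>r. r \<notin> {const_reg} \<and> r \<noteq> row_reg \<longrightarrow> I1 r = I r"
      have fr1: "frame b e I1" by (rule sets_frame[OF fr 1(2)]) auto
      show "sets {7..<12} (Seq (set_ix col_reg j) (Seq (pair_code pair_reg row_reg col_reg)
          (Seq (IConst row_reg c) (Seq (pair_code q pair_reg row_reg) (IAdd q q base_reg)))))
          q (slot b c ?u ?v) ((1 + ix_time j) +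
          ((3 * (?u + ?v) + 3) + (1 + ((3 * (prod_encode (?u, ?v) + c) + 3) + 1)))) I1"
      proof (rule sets_Seq[OF sets_set_ix[OF fr1]])
        fix I2 assume 2: "I2 col_reg = ?v" "\<forall>r. r \<notin> {const_reg} \<and> r \<noteq> col_reg \<longrightarrow> I2 r = I1 r"
        have fr2: "frame b e I2" by (rule sets_frame[OF fr1 2(2)]) auto
        have u: "I2 row_reg = ?u" using 1 2 by simp
        have "sets {count_reg} (pair_code pair_reg row_reg col_reg) pair_reg
            (prod_encode (I2 row_reg, I2 col_reg)) (3 * (I2 row_reg + I2 col_reg) + 3) I2"
          by (rule sets_pair_code) (use fr2 in \<open>auto simp: frame_def\<close>)
        then have pc: "sets {count_reg} (pair_code pair_reg row_reg col_reg) pair_reg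
            (prod_encode (?u, ?v)) (3 * (?u + ?v) + 3) I2"
          using u 2(1) by simp
        show "sets {7..<12} (Seq (pair_code pair_reg row_reg col_reg)
            (Seq (IConst row_reg c) (Seq (pair_code q pair_reg row_reg) (IAdd q q base_reg))))
            q (slot b c ?u ?v)
            ((3 * (?u + ?v) + 3) + (1 + ((3 * (prod_encode (?u, ?v) + c) + 3) + 1))) I2"
        proof (rule sets_Seq[OF pc])
          fix I3 assume 3: "I3 pair_reg = prod_encode (?u, ?v)"
            "\<forall>r. r \<notin> {count_reg} \<and> r \<noteq> pair_reg \<longrightarrow> I3 r = I2 r"
          have fr3: "frame b e I3" by (rule sets_frame[OF fr2 3(2)]) auto
          show "sets {7..<12} (Seq (IConst row_reg c) (Seq (pair_code q pair_reg row_reg)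
              (IAdd q q base_reg))) q (slot b c ?u ?v)
              (1 + ((3 * (prod_encode (?u, ?v) + c) + 3) + 1)) I3"
          proof (rule sets_Seq[OF sets_IConst])
            fix I4 assume 4: "I4 row_reg = c" "\<forall>r. r \<notin> {} \<and> r \<noteq> row_reg \<longrightarrow> I4 r = I3 r"
            have fr4: "frame b e I4" by (rule sets_frame[OF fr3 4(2)]) auto
            have "sets {count_reg} (pair_code q pair_reg row_reg) q
                (prod_encode (I4 pair_reg, I4 row_reg)) (3 * (I4 pair_reg + I4 row_reg) + 3) I4"
              by (rule sets_pair_code) (use fr4 q in \<open>auto simp: frame_def\<close>)
            then have pc2: "sets {count_reg} (pair_code q pair_reg row_reg) q
                (prod_encode (prod_encode (?u, ?v), c)) (3 * (prod_encode (?u, ?v) + c) + 3) I4"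
              using 3 4 by simp
            show "sets {7..<12} (Seq (pair_code q pair_reg row_reg)
              (IAdd q q base_reg)) q (slot b c ?u ?v)
              ((3 * (prod_encode (?u, ?v) + c) + 3) + 1) I4"
            proof (rule sets_Seq[OF pc2])
              fix I5 assume 5: "I5 q = prod_encode (prod_encode (?u, ?v), c)"
                "\<forall>r. r \<notin> {count_reg} \<and> r \<noteq> q \<longrightarrow> I5 r = I4 r"
              have "I5 base_reg = b" using 5(2) fr4 q by (auto simp: frame_def)
              then show "sets {7..<12} (IAdd q q base_reg) q (slot b c ?u ?v) 1 I5"
                using sets_weaken[OF sets_IAdd[of q q base_reg I5] order_refl, of "{7..<12}"] 5(1)
                by (simp add: slot_def)
            qed auto
          qed auto
        qed auto
      qed auto
    qed auto
    then show ?thesis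
      by (rule sets_weaken) (use uv P in \<open>auto simp: p_def\<close>)
  qed
  ultimately show ?thesis by blast
qed

definition temp_addr :: "nat \<Rightarrow> nat \<Rightarrow> com" where
  "temp_addr q d = Seq (IConst q (prod_encode (prod_encode (d, 0), 0))) (IAdd q q base_reg)"

lemma sets_temp_addr:
  assumes "I base_reg = b" "q \<noteq> base_reg"
  shows "sets {} (temp_addr q d) q (slot b 0 d 0) 2 I"
proof -
  have "sets {} (temp_addr q d) q (slot b 0 d 0) (1 + 1) I"
    unfolding temp_addr_def
  proof (rule sets_Seq[OF sets_IConst])
    fix I' assume I': "I' q = prod_encode (prod_encode (d, 0), 0)" "\<forall>r. r \<notin> {} \<and> r \<noteq> q \<longrightarrow> I' r = I r"
    then show "sets {} (IAdd q q base_reg) q (slot b 0 d 0) 1 I'"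
      using sets_IAdd[of q q base_reg I'] assms by (simp add: slot_def)
  qed simp
  then show ?thesis by (simp add: numeral_2_eq_2)
qed

definition inp_addr :: "nat \<Rightarrow> ix \<Rightarrow> ix \<Rightarrow> com" where
  "inp_addr q i j = Seq (set_ix row_reg i) (Seq (set_ix q j) (mul_code q row_reg (reg 2)))"

lemma sets_inp_addr:
  assumes fr: "frame b e I" and q: "q \<in> {12..<20}" and N: "\<forall>v. e v \<le> N"
  shows "sets {7..<12} (inp_addr q i j) q (ix_val e j + ix_val e i * e 2)
    (1 + ix_time i + (1 + ix_time j + (3 * (ix_size i * (N + 1)) + 1))) I"
  unfolding inp_addr_def
proof (rule sets_Seq[OF sets_set_ix[OF fr]])
  fix I1 assume 1: "I1 row_reg = ix_val e i" "\<forall>r. r \<notin> {const_reg} \<and> r \<noteq> row_reg \<longrightarrow> I1 r = I r"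
  have fr1: "frame b e I1" by (rule sets_frame[OF fr 1(2)]) auto
  show "sets {7..<12} (Seq (set_ix q j) (mul_code q row_reg (reg 2))) q
      (ix_val e j + ix_val e i * e 2) (1 + ix_time j + (3 * (ix_size i * (N + 1)) + 1)) I1"
  proof (rule sets_Seq[OF sets_set_ix[OF fr1]])
    fix I2 assume 2: "I2 q = ix_val e j" "\<forall>r. r \<notin> {const_reg} \<and> r \<noteq> q \<longrightarrow> I2 r = I1 r"
    have fr2: "frame b e I2" by (rule sets_frame[OF fr1 2(2)]) (use q in auto)
    have "I2 (reg 2) = e 2" using fr2 by (simp add: frame_def)
    moreover have "I2 row_reg = ix_val e i" using 1 2 q by simp
    moreover have "sets {row_reg} (mul_code q row_reg (reg 2)) q
        (I2 q + I2 row_reg * I2 (reg 2)) (3 * I2 row_reg + 1) I2"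
      by (rule sets_mul_code) (use fr2 q in \<open>auto simp: frame_def reg_def\<close>)
    ultimately show "sets {7..<12} (mul_code q row_reg (reg 2)) q
      (ix_val e j + ix_val e i * e 2) (3 * (ix_size i * (N + 1)) + 1) I2"
      using ix_val_le[OF N, of i] 2(1) 
      by - (rule sets_weaken[where W="{row_reg}" and T="3 * ix_val e i + 1"], auto)
  qed (use q in auto)
qed (use q in auto)

text \<open>The bound is recomputed in every round since the body overwrites the bound register. The counter is
  reset at the end, so that the environment is the same before and after.\<close>

definition loop :: "nat \<Rightarrow> ix \<Rightarrow> com \<Rightarrow> com" where
  "loop v t body = Seq (set_ix bound_reg t) (Seq
     (While (ILess (reg v) bound_reg)
       (Seq body (Seq (IAdd (reg v) (reg v) one_reg) (set_ix bound_reg t))))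
     (IConst (reg v) 0))"

definition framed :: "nat \<Rightarrow> (nat \<Rightarrow> nat) \<Rightarrow> ((nat \<Rightarrow> real) \<Rightarrow> bool) \<Rightarrow> state \<Rightarrow> bool" where
  "framed b e H = (\<lambda>(I, R). frame b e I \<and> H R)"

lemma ix_val_upd: "v \<notin> ix_vars t \<Longrightarrow> ix_val (e(v := i)) t = ix_val e t"
  by (induction t) auto

lemma frame_upd: "frame b e I \<Longrightarrow> frame b (e(v := i)) (I(reg v := i))"
  by (auto simp: frame_def reg_def split: if_splits)

text \<open>The rule reduces a loop to its body, which runs in the environment where \<open>v\<close> has the current
  value; the invariant speaks of the real cells only.\<close>

lemma runs_loop:
  assumes v: "e v = 0" "v \<notin> ix_vars t" and fr: "frame b e I" and J0: "J 0 R"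
    and step: "\<And>i I R. i < ix_val e t \<Longrightarrow> frame b (e(v := i)) I \<Longrightarrow> J i R \<Longrightarrow>
      runs body (I, R) T (framed b (e(v := i)) (J (Suc i)))"
  shows "runs (loop v t body) (I, R) (ix_val e t * (T + ix_time t + 3) + ix_time t + 3)
    (framed b e (J (ix_val e t)))"
proof -
  let ?n = "ix_val e t"
  define L where "L = (\<lambda>i (I, R). frame b (e(v := i)) I \<and> I bound_reg = ?n \<and> J i R)"
  have bound: "sets {const_reg} (set_ix bound_reg t) bound_reg ?n (1 + ix_time t) I"
    if "frame b (e(v := i)) I" for i I
    using sets_set_ix[OF that, of bound_reg t] ix_val_upd[OF v(2)] by simp
  have fr': "frame b (e(v := 0)) I" using fr v(1) by (metis fun_upd_triv)
  have "runs (loop v t body) (I, R) ((1 + ix_time t) + ((?n * ((T + (1 + (1 + ix_time t))) + 1) + 1) + 1))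
      (framed b e (J ?n))"
    unfolding loop_def
  proof (rule runs_Seq_sets[OF bound[OF fr']])
    fix I1 assume 1: "I1 bound_reg = ?n" "\<forall>r. r \<notin> {const_reg} \<and> r \<noteq> bound_reg \<longrightarrow> I1 r = I r"
    have fr1: "frame b (e(v := 0)) I1" by (rule sets_frame[OF fr' 1(2)]) auto
    have "runs (While (ILess (reg v) bound_reg)
       (Seq body (Seq (IAdd (reg v) (reg v) one_reg) (set_ix bound_reg t)))) (I1, R)
       (?n * ((T + (1 + (1 + ix_time t))) + 1) + 1) (L ?n)"
    proof (rule runs_While)
      show "L 0 (I1, R)" using fr1 1(1) J0 by (simp add: L_def)
    next
      fix i s assume "i < ?n" "L i s"
      then show "holds (ILess (reg v) bound_reg) s" by (cases s) (auto simp: L_def frame_def)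
    next
      fix s assume "L ?n s"
      then show "\<not> holds (ILess (reg v) bound_reg) s" by (cases s) (auto simp: L_def frame_def)
    next
      fix i s assume i: "i < ?n" and L: "L i s"
      obtain I2 R2 where s: "s = (I2, R2)" by (cases s)
      have 2: "frame b (e(v := i)) I2" "J i R2" using L by (auto simp: L_def s)
      show "runs (Seq body (Seq (IAdd (reg v) (reg v) one_reg) (set_ix bound_reg t))) s
          (T + (1 + (1 + ix_time t))) (L (Suc i))"
        unfolding s
      proof (rule runs_Seq[OF step[OF i 2]])
        fix s' assume s': "framed b (e(v := i)) (J (Suc i)) s'"
        obtain I3 R3 where s3: "s' = (I3, R3)" by (cases s')
        have 3: "frame b (e(v := i)) I3" "J (Suc i) R3" using s' s3 by (auto simp: framed_def)
        have I3: "I3 (reg v) + I3 one_reg = Suc i" using 3(1) by (simp add: frame_def)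
        have fr4: "frame b (e(v := Suc i)) (I3(reg v := I3 (reg v) + I3 one_reg))"
          using frame_upd[OF 3(1), of v "Suc i"] I3 by simp
        show "runs (Seq (IAdd (reg v) (reg v) one_reg) (set_ix bound_reg t)) s'
            (1 + (1 + ix_time t)) (L (Suc i))"
          unfolding s3
        proof (rule runs_Seq, rule runs_IAdd[where Q="\<lambda>s. s = (I3(reg v := I3 (reg v) + I3 one_reg), R3)"])
          fix s' assume s': "s' = (I3(reg v := I3 (reg v) + I3 one_reg), R3)"
          show "runs (set_ix bound_reg t) s' (1 + ix_time t) (L (Suc i))"
            unfolding s'
          proof (rule runs_weaken[OF bound[OF fr4, unfolded sets_def, rule_format]])
            fix s assume s: "case s of (I', R') \<Rightarrow> R' = R3 \<and> I' bound_reg = ?n \<and>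
              (\<forall>r. r \<notin> {const_reg} \<and> r \<noteq> bound_reg \<longrightarrow>
                I' r = (I3(reg v := I3 (reg v) + I3 one_reg)) r)"
            obtain I5 R5 where s5: "s = (I5, R5)" by (cases s)
            have *: "\<forall>r. r \<notin> {const_reg} \<and> r \<noteq> bound_reg \<longrightarrow>
                I5 r = (I3(reg v := I3 (reg v) + I3 one_reg)) r"
              "R5 = R3" "I5 bound_reg = ?n" using s s5 by blast+
            have "frame b (e(v := Suc i)) I5" by (rule sets_frame[OF fr4 *(1)]) auto
            then show "L (Suc i) s" using * 3(2) by (simp add: L_def s5)
          qed simp
        qed auto
      qed
    qed
    then show "runs (Seq (While (ILess (reg v) bound_reg)
       (Seq body (Seq (IAdd (reg v) (reg v) one_reg) (set_ix bound_reg t))))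
       (IConst (reg v) 0)) (I1, R)
       ((?n * ((T + (1 + (1 + ix_time t))) + 1) + 1) + 1) (framed b e (J ?n))"
    proof (rule runs_Seq)
      fix s assume s: "L ?n s"
      obtain I2 R2 where s2: "s = (I2, R2)" by (cases s)
      have "frame b ((e(v := ?n))(v := 0)) (I2(reg v := 0))"
        by (rule frame_upd) (use s s2 in \<open>auto simp: L_def\<close>)
      then have "frame b e (I2(reg v := 0))" using v(1) by (metis fun_upd_triv fun_upd_upd)
      then show "runs (IConst (reg v) 0) s 1 (framed b e (J ?n))"
        unfolding s2 using s s2 by (auto intro!: runs_IConst simp: framed_def L_def)
    qed
  qed
  then show ?thesis by (rule runs_weaken) (auto simp: distrib_left)
qed

section \<open>Compilation of expressions\<close>

text \<open>The value is left in the intermediate cell \<open>d\<close>; cells below \<open>d\<close> hold pending results and are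
  preserved. The machine has no test for zero and gets stuck on a zero divisor, so the second operand is
  compared with zero from both sides.\<close>

fun rexp_code :: "nat \<Rightarrow> rexp \<Rightarrow> com" where
  "rexp_code d (Num z) = Seq (temp_addr ptr1 d) (RConst ptr1 z)"
| "rexp_code d (Inp i j) = Seq (inp_addr ptr2 i j) (Seq (temp_addr ptr1 d)
     (Cond (ILess ptr2 base_reg) (RCopy ptr1 ptr2) (RConst ptr1 0)))"
| "rexp_code d (Cell a i j) = Seq (slot_addr ptr2 (a + 2) i j) (Seq (temp_addr ptr1 d)
     (RCopy ptr1 ptr2))"
| "rexp_code d (Bin f x y) = Seq (rexp_code d x) (Seq (rexp_code (d + 1) y)
     (Seq (temp_addr ptr1 d) (Seq (temp_addr ptr2 (d + 1))
     (Seq (temp_addr ptr3 (d + 2)) (Seq (RConst ptr3 0)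
     (Cond (RLess ptr3 ptr2) (ROp f ptr1 ptr1 ptr2)
     (Cond (RLess ptr2 ptr3) (ROp f ptr1 ptr1 ptr2)
       (if f = Divide then RConst ptr1 0 else ROp f ptr1 ptr1 ptr2))))))))"
| "rexp_code d (Sum v b x) = Seq (temp_addr ptr1 d) (Seq (RConst ptr1 0)
     (loop v b (Seq (rexp_code (d + 1) x) (Seq (temp_addr ptr1 d) (Seq (temp_addr ptr2 (d + 1))
       (ROp Plus ptr1 ptr1 ptr2))))))"
| "rexp_code d (IfIdx s t x y) = Seq (set_ix ptr1 s) (Seq (set_ix ptr2 t)
     (Cond (ILess ptr1 ptr2) (rexp_code d x) (rexp_code d y)))"
| "rexp_code d (IfLess u w x y) = Seq (rexp_code d u) (Seq (rexp_code (d + 1) w)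
     (Seq (temp_addr ptr1 d) (Seq (temp_addr ptr2 (d + 1))
     (Cond (RLess ptr1 ptr2) (rexp_code d x) (rexp_code d y)))))"

text \<open>The two states of the real cells differ at most in intermediate cells from \<open>d\<close> on.\<close>

definition agree :: "nat \<Rightarrow> nat \<Rightarrow> (nat \<Rightarrow> real) \<Rightarrow> (nat \<Rightarrow> real) \<Rightarrow> bool" where
  "agree b d R R' \<longleftrightarrow> (\<forall>q. (\<forall>d'\<ge>d. q \<noteq> slot b 0 d' 0) \<longrightarrow> R' q = R q)"

text \<open>The cells below \<open>b\<close> still hold the input, and matrix \<open>a\<close> is stored in area \<open>a + 2\<close>.
  Intermediate and staging cells are arbitrary.\<close>

definition rep :: "nat \<Rightarrow> (nat \<Rightarrow> real) \<Rightarrow> mem \<Rightarrow> (nat \<Rightarrow> real) \<Rightarrow> bool" where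
  "rep b inp M R \<longleftrightarrow> (\<forall>q<b. R q = inp q) \<and> (\<forall>a i j. R (slot b (a + 2) i j) = M a i j)"

lemma agree_trans: "agree b d R R' \<Longrightarrow> d \<le> d' \<Longrightarrow> agree b d' R' R'' \<Longrightarrow> agree b d R R''"
  unfolding agree_def by (metis order_trans)

lemma agree_upd: "d \<le> d' \<Longrightarrow> agree b d R (R(slot b 0 d' 0 := x))"
  by (auto simp: agree_def)

lemma agree_temp: "agree b d R R' \<Longrightarrow> d' < d \<Longrightarrow> R' (slot b 0 d' 0) = R (slot b 0 d' 0)"
  by (auto simp: agree_def)

lemma agree_slot: "agree b d R R' \<Longrightarrow> c \<noteq> 0 \<Longrightarrow> R' (slot b c i j) = R (slot b c i j)"
  by (auto simp: agree_def)

lemma agree_rep: "agree b d R R' \<Longrightarrow> rep b inp M R \<Longrightarrow> rep b inp M R'"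
proof -
  assume a: "agree b d R R'" "rep b inp M R"
  have "R' q = R q" if "q < b" for q
    using a(1) that slot_ge[of b 0 _ 0] unfolding agree_def by (metis leD)
  then show ?thesis using a agree_slot[OF a(1)] unfolding rep_def by simp
qed

text \<open>The time bound \<open>p\<close> depends only on a bound \<open>N\<close> for the index variables, not on the real data.\<close>

definition computes :: "nat set \<Rightarrow> rexp \<Rightarrow> (nat \<Rightarrow> nat) \<Rightarrow> bool" where
  "computes X x p \<longleftrightarrow> (\<forall>d e N b inp M I R. (\<forall>v. e v \<le> N) \<longrightarrow> (\<forall>v. v \<notin> X \<longrightarrow> e v = 0) \<longrightarrow>
     (\<forall>q\<ge>b. inp q = 0) \<longrightarrow> frame b e I \<longrightarrow> rep b inp M R \<longrightarrow>
     runs (rexp_code d x) (I, R) (p N)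
       (framed b e (\<lambda>R'. agree b d R R' \<and> R' (slot b 0 d 0) = rval inp M e x)))"

lemma computesD:
  assumes "computes X x p" "\<forall>v. e v \<le> N" "\<forall>v. v \<notin> X \<longrightarrow> e v = 0" "\<forall>q\<ge>b. inp q = 0"
    "frame b e I" "rep b inp M R"
  shows "runs (rexp_code d x) (I, R) (p N)
       (framed b e (\<lambda>R'. agree b d R R' \<and> R' (slot b 0 d 0) = rval inp M e x))"
  using assms unfolding computes_def by blast

lemma frame_ptr:
  assumes "frame b e I" "\<forall>r. r \<notin> {} \<and> r \<noteq> q \<longrightarrow> I' r = I r" "q \<in> {7..<20}"
  shows "frame b e I'"
  by (rule sets_frame[OF assms(1,2)]) (use assms(3) in auto)

lemma runs_Seq_temp:
  assumes fr: "frame b e I" and q: "q \<in> {12..<20}"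
    and "\<And>I'. I' q = slot b 0 d 0 \<Longrightarrow> \<forall>r. r \<noteq> q \<longrightarrow> I' r = I r \<Longrightarrow> frame b e I' \<Longrightarrow>
      runs c (I', R) T Q"
  shows "runs (Seq (temp_addr q d) c) (I, R) (2 + T) Q"
proof (rule runs_Seq_sets[OF sets_temp_addr])
  show "I base_reg = b" using fr by (simp add: frame_def)
  show "q \<noteq> base_reg" using q by auto
  fix I' assume I': "I' q = slot b 0 d 0" "\<forall>r. r \<notin> {} \<and> r \<noteq> q \<longrightarrow> I' r = I r"
  show "runs c (I', R) T Q"
    by (rule assms(3)) (use I' frame_ptr[OF fr I'(2)] q in auto)
qed

lemma computes_Num: "computes X (Num z) (\<lambda>N. 3)"
  unfolding computes_def
proof (intro allI impI)
  fix d e N b inp M I R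
  assume fr: "frame b e I"
  show "runs (rexp_code d (Num z)) (I, R) 3
       (framed b e (\<lambda>R'. agree b d R R' \<and> R' (slot b 0 d 0) = rval inp M e (Num z)))"
    by (simp del: One_nat_def, rule runs_weaken[OF runs_Seq_temp[OF fr, where T=1]])
      (auto intro!: runs_RConst simp: framed_def agree_upd)
qed

lemma computes_Inp: "\<exists>p. poly_bdd p \<and> computes X (Inp i j) p"
proof -
  define p where "p = (\<lambda>N. (1 + ix_time i + (1 + ix_time j + (3 * (ix_size i * (N + 1)) + 1))) + (2 + (1 + 1)))"
  have "poly_bdd p" unfolding p_def by (intro poly_bdd_intros)
  moreover have "computes X (Inp i j) p" unfolding computes_def
  proof (intro allI impI)
    fix d e N b inp M I R
    assume N: "\<forall>v. e v \<le> N" and inp: "\<forall>q\<ge>b. inp q = 0" and fr: "frame b e I" and rep: "rep b inp M R"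
    let ?Q = "framed b e (\<lambda>R'. agree b d R R' \<and> R' (slot b 0 d 0) = rval inp M e (Inp i j))"
    have q: "ptr2 \<in> {12..<20}" by simp
    show "runs (rexp_code d (Inp i j)) (I, R) (p N) ?Q"
      unfolding p_def rexp_code.simps
    proof (rule runs_Seq_sets[OF sets_inp_addr[OF fr q N]])
      fix I1 assume 1: "I1 ptr2 = ix_val e j + ix_val e i * e 2"
        "\<forall>r. r \<notin> {7..<12} \<and> r \<noteq> ptr2 \<longrightarrow> I1 r = I r"
      have fr1: "frame b e I1" by (rule sets_frame[OF fr 1(2)]) auto
      show "runs (Seq (temp_addr ptr1 d) (Cond (ILess ptr2 base_reg) (RCopy ptr1 ptr2) (RConst ptr1 0)))
        (I1, R) (2 + (1 + 1)) ?Q"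
      proof (rule runs_Seq_temp[OF fr1])
        fix I2 assume 2: "I2 ptr1 = slot b 0 d 0" "\<forall>r. r \<noteq> ptr1 \<longrightarrow> I2 r = I1 r" "frame b e I2"
        have "I2 base_reg = b" using 2(3) by (simp add: frame_def)
        then show "runs (Cond (ILess ptr2 base_reg) (RCopy ptr1 ptr2) (RConst ptr1 0)) (I2, R) (1 + 1) ?Q"
          using 1 2 inp rep
          by (intro runs_Cond runs_RCopy runs_RConst) (auto simp: framed_def agree_upd rep_def)
      qed simp
    qed
  qed
  ultimately show ?thesis by blast
qed

lemma computes_Cell: "\<exists>p. poly_bdd p \<and> computes X (Cell a i j) p"
proof -
  obtain p0 where p0: "poly_bdd p0" "\<And>q c b e N I. \<forall>v. e v \<le> N \<Longrightarrow> frame b e I \<Longrightarrow> q \<in> {12..<20} \<Longrightarrow>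
     sets {7..<12} (slot_addr q c i j) q (slot b c (ix_val e i) (ix_val e j)) (p0 N + 3 * c) I"
    using sets_slot_addr[of i j] by blast
  define p where "p = (\<lambda>N. (p0 N + 3 * (a + 2)) + (2 + 1))"
  have "poly_bdd p" unfolding p_def by (intro poly_bdd_intros p0)
  moreover have "computes X (Cell a i j) p" unfolding computes_def
  proof (intro allI impI)
    fix d e N b inp M I R
    assume N: "\<forall>v. e v \<le> N" and fr: "frame b e I" and rep: "rep b inp M R"
    let ?Q = "framed b e (\<lambda>R'. agree b d R R' \<and> R' (slot b 0 d 0) = rval inp M e (Cell a i j))"
    have q: "ptr2 \<in> {12..<20}" by simp
    show "runs (rexp_code d (Cell a i j)) (I, R) (p N) ?Q"
      unfolding p_def rexp_code.simps
    proof (rule runs_Seq_sets[OF p0(2)[OF N fr q]])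
      fix I1 assume 1: "I1 ptr2 = slot b (a + 2) (ix_val e i) (ix_val e j)"
        "\<forall>r. r \<notin> {7..<12} \<and> r \<noteq> ptr2 \<longrightarrow> I1 r = I r"
      have fr1: "frame b e I1" by (rule sets_frame[OF fr 1(2)]) auto
      show "runs (Seq (temp_addr ptr1 d) (RCopy ptr1 ptr2)) (I1, R) (2 + 1) ?Q"
      proof (rule runs_Seq_temp[OF fr1])
        fix I2 assume 2: "I2 ptr1 = slot b 0 d 0" "\<forall>r. r \<noteq> ptr1 \<longrightarrow> I2 r = I1 r" "frame b e I2"
        then show "runs (RCopy ptr1 ptr2) (I2, R) 1 ?Q"
          using 1 rep by (intro runs_RCopy) (auto simp: framed_def agree_upd rep_def)
      qed simp
    qed
  qed
  ultimately show ?thesis by blast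
qed

lemma computes_Bin:
  assumes x: "computes X x p" and y: "computes X y p'"
  shows "computes X (Bin f x y) (\<lambda>N. p N + (p' N + 11))"
  unfolding computes_def
proof (intro allI impI)
  fix d e N b inp M I R
  assume N: "\<forall>v. e v \<le> N" and X: "\<forall>v. v \<notin> X \<longrightarrow> e v = 0" and inp: "\<forall>q\<ge>b. inp q = 0"
    and fr: "frame b e I" and rep: "rep b inp M R"
  let ?Q = "framed b e (\<lambda>R'. agree b d R R' \<and> R' (slot b 0 d 0) = rval inp M e (Bin f x y))"
  let ?E = "if f = Divide then RConst ptr1 0 else ROp f ptr1 ptr1 ptr2"
  let ?C = "Cond (RLess ptr3 ptr2) (ROp f ptr1 ptr1 ptr2) (Cond (RLess ptr2 ptr3) (ROp f ptr1 ptr1 ptr2) ?E)"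
  have "runs (rexp_code d (Bin f x y)) (I, R) (p N + (p' N + (2 + (2 + (2 + (1 + ((1 + 1) + 1))))))) ?Q"
    unfolding rexp_code.simps
  proof (rule runs_Seq[OF computesD[OF x N X inp fr rep]])
    fix s1 assume s1: "framed b e (\<lambda>R'. agree b d R R' \<and> R' (slot b 0 d 0) = rval inp M e x) s1"
    obtain I1 R1 where s1': "s1 = (I1, R1)" by (cases s1)
    have 1: "frame b e I1" "agree b d R R1" "R1 (slot b 0 d 0) = rval inp M e x"
      using s1 s1' by (auto simp: framed_def)
    show "runs (Seq (rexp_code (d + 1) y) (Seq (temp_addr ptr1 d) (Seq (temp_addr ptr2 (d + 1))
       (Seq (temp_addr ptr3 (d + 2)) (Seq (RConst ptr3 0) ?C))))) s1
       (p' N + (2 + (2 + (2 + (1 + ((1 + 1) + 1)))))) ?Q"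
      unfolding s1'
    proof (rule runs_Seq[OF computesD[OF y N X inp 1(1) agree_rep[OF 1(2) rep]]])
      fix s2 assume s2: "framed b e (\<lambda>R'. agree b (d + 1) R1 R' \<and> R' (slot b 0 (d + 1) 0) = rval inp M e y) s2"
      obtain I2 R2 where s2': "s2 = (I2, R2)" by (cases s2)
      have 2: "frame b e I2" "agree b (d + 1) R1 R2" "R2 (slot b 0 (d + 1) 0) = rval inp M e y"
        using s2 s2' by (auto simp: framed_def)
      have a2: "agree b d R R2" by (rule agree_trans[OF 1(2) _ 2(2)]) simp
      have r2: "R2 (slot b 0 d 0) = rval inp M e x" using agree_temp[OF 2(2), of d] 1(3) by simp
      show "runs (Seq (temp_addr ptr1 d) (Seq (temp_addr ptr2 (d + 1))
        (Seq (temp_addr ptr3 (d + 2)) (Seq (RConst ptr3 0) ?C)))) s2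
        (2 + (2 + (2 + (1 + ((1 + 1) + 1))))) ?Q"
        unfolding s2'
      proof (rule runs_Seq_temp[OF 2(1)], simp, rule runs_Seq_temp, assumption, simp,
          rule runs_Seq_temp, assumption, simp)
        fix I3 I4 I5
        assume *: "I3 ptr1 = slot b 0 d 0" "\<forall>r. r \<noteq> ptr1 \<longrightarrow> I3 r = I2 r"
          "I4 ptr2 = slot b 0 (d + 1) 0" "\<forall>r. r \<noteq> ptr2 \<longrightarrow> I4 r = I3 r"
          "I5 ptr3 = slot b 0 (d + 2) 0" "\<forall>r. r \<noteq> ptr3 \<longrightarrow> I5 r = I4 r" "frame b e I5"
        have ptr: "I5 ptr1 = slot b 0 d 0" "I5 ptr2 = slot b 0 (d + 1) 0" "I5 ptr3 = slot b 0 (d + 2) 0"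
          using * by auto
        show "runs (Seq (RConst ptr3 0) ?C) (I5, R2) (1 + ((1 + 1) + 1)) ?Q"
        proof (rule runs_Seq)
          let ?R3 = "R2(slot b 0 (d + 2) 0 := 0)"
          show "runs (RConst ptr3 0) (I5, R2) 1 (\<lambda>s. s = (I5, ?R3))"
            by (rule runs_RConst) (auto simp: ptr)
          fix s assume s: "s = (I5, ?R3)"
          have "agree b d R2 ?R3" by (rule agree_upd) simp
          then have a3: "agree b d R ?R3" using agree_trans[OF a2 order_refl] by blast
          have a4: "agree b d R (?R3(slot b 0 d 0 := z))" for z
            by (rule agree_trans[OF a3 order_refl agree_upd]) simp
          show "runs ?C s ((1 + 1) + 1) ?Q"
            unfolding s
          proof (intro runs_Cond, goal_cases)
            case 1
            show ?case by (rule runs_ROp) (use 1 a4 r2 2(3) *(7) in \<open>auto simp: ptr framed_def\<close>)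
          next
            case 2
            show ?case by (rule runs_ROp) (use 2 a4 r2 \<open>R2 (slot b 0 (d + 1) 0) = rval inp M e y\<close> *(7) in \<open>auto simp: ptr framed_def\<close>)
          next
            case 3
            then have z: "rval inp M e y = 0" using 2(3) by (auto simp: ptr)
            show ?case
            proof (cases "f = Divide")
              case True
              then show ?thesis using z a4 *(7)
                by (auto intro!: runs_RConst simp: ptr framed_def)
            next
              case False
              then show ?thesis using z a4 r2 2(3) *(7)
                by (auto intro!: runs_ROp simp: ptr framed_def)
            qed
          qed
        qed
      qed
    qed
  qed
  then show "runs (rexp_code d (Bin f x y)) (I, R) (p N + (p' N + 11)) ?Q"
    by (rule runs_weaken) auto
qed

text \<open>The bound for the index variables grows in the body, because the summation variable ranges up to the
  value of \<open>t\<close>; this value is linear in \<open>N\<close>, so the time remains polynomial.\<close>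

lemma computes_Sum:
  assumes x: "computes (insert v X) x p" and v: "v \<notin> X" "v \<notin> ix_vars t"
  shows "computes X (Sum v t x) (\<lambda>N. 3 + (ix_size t * (N + 1) *
    (p ((ix_size t + 1) * (N + 1)) + 5 + ix_time t + 3) + ix_time t + 3))"
  unfolding computes_def
proof (intro allI impI)
  fix d e N b inp M I R
  assume N: "\<forall>v. e v \<le> N" and X: "\<forall>v. v \<notin> X \<longrightarrow> e v = 0" and inp: "\<forall>q\<ge>b. inp q = 0"
    and fr: "frame b e I" and rep: "rep b inp M R"
  define N' where "N' = (ix_size t + 1) * (N + 1)"
  define S where "S = (\<lambda>n. \<Sum>i<n. rval inp M (e(v := i)) x)"
  define J where "J = (\<lambda>n R'. agree b d R R' \<and> R' (slot b 0 d 0) = S n)"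
  let ?body = "Seq (rexp_code (d + 1) x) (Seq (temp_addr ptr1 d) (Seq (temp_addr ptr2 (d + 1))
       (ROp Plus ptr1 ptr1 ptr2)))"
  let ?n = "ix_val e t"
  have n: "?n \<le> ix_size t * (N + 1)" by (rule ix_val_le[OF N])
  have "runs (rexp_code d (Sum v t x)) (I, R) (2 + (1 + (?n * ((p N' + (2 + (2 + 1))) + ix_time t + 3) + ix_time t + 3)))
    (framed b e (J ?n))"
    unfolding rexp_code.simps
  proof (rule runs_Seq_temp[OF fr], simp, rule runs_Seq)
    fix I1 assume 1: "I1 ptr1 = slot b 0 d 0" "frame b e I1"
    let ?R1 = "R(slot b 0 d 0 := 0)"
    show "runs (RConst ptr1 0) (I1, R) 1 (\<lambda>s. s = (I1, ?R1))"
      by (rule runs_RConst) (auto simp: 1)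
    fix s assume s: "s = (I1, ?R1)"
    show "runs (loop v t ?body) s (?n * ((p N' + (2 + (2 + 1))) + ix_time t + 3) + ix_time t + 3)
        (framed b e (J ?n))"
      unfolding s
    proof (rule runs_loop)
      show "e v = 0" using X v by simp
      show "v \<notin> ix_vars t" "frame b e I1" by fact+
      show "J 0 ?R1" by (simp add: J_def S_def agree_upd)
      fix i I2 R2 assume i: "i < ?n" and fr2: "frame b (e(v := i)) I2" and J: "J i R2"
      have ag: "agree b d R R2" and Si: "R2 (slot b 0 d 0) = S i" using J by (auto simp: J_def)
      have N2: "\<forall>w. (e(v := i)) w \<le> N'"
      proof -
        have "N \<le> N'" by (simp add: N'_def)
        moreover have "i \<le> N'" using i n by (simp add: N'_def)
        ultimately show ?thesis using N by (auto intro: le_trans)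
      qed
      have X2: "\<forall>w. w \<notin> insert v X \<longrightarrow> (e(v := i)) w = 0" using X by simp
      show "runs ?body (I2, R2) (p N' + (2 + (2 + 1))) (framed b (e(v := i)) (J (Suc i)))"
      proof (rule runs_Seq[OF computesD[OF x N2 X2 inp fr2 agree_rep[OF ag rep]]])
        fix s3 assume s3: "framed b (e(v := i)) (\<lambda>R'. agree b (d + 1) R2 R' \<and>
          R' (slot b 0 (d + 1) 0) = rval inp M (e(v := i)) x) s3"
        obtain I3 R3 where s3': "s3 = (I3, R3)" by (cases s3)
        have 3: "frame b (e(v := i)) I3" "agree b (d + 1) R2 R3"
          "R3 (slot b 0 (d + 1) 0) = rval inp M (e(v := i)) x"
          using s3 s3' by (auto simp: framed_def)
        have r3: "R3 (slot b 0 d 0) = S i" using agree_temp[OF 3(2), of d] Si by simp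
        have a3: "agree b d R R3" by (rule agree_trans[OF ag _ 3(2)]) simp
        show "runs (Seq (temp_addr ptr1 d) (Seq (temp_addr ptr2 (d + 1)) (ROp Plus ptr1 ptr1 ptr2)))
          s3 (2 + (2 + 1)) (framed b (e(v := i)) (J (Suc i)))"
          unfolding s3'
        proof (rule runs_Seq_temp[OF 3(1)], simp, rule runs_Seq_temp, assumption, simp)
          fix I4 I5
          assume *: "I4 ptr1 = slot b 0 d 0" "\<forall>r. r \<noteq> ptr1 \<longrightarrow> I4 r = I3 r"
            "I5 ptr2 = slot b 0 (d + 1) 0" "\<forall>r. r \<noteq> ptr2 \<longrightarrow> I5 r = I4 r" "frame b (e(v := i)) I5"
          have ptr: "I5 ptr1 = slot b 0 d 0" "I5 ptr2 = slot b 0 (d + 1) 0" using * by auto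
          have "agree b d R (R3(slot b 0 d 0 := z))" for z
            by (rule agree_trans[OF a3 order_refl agree_upd]) simp
          then show "runs (ROp Plus ptr1 ptr1 ptr2) (I5, R3) 1 (framed b (e(v := i)) (J (Suc i)))"
            using r3 3(3) *(5) by (intro runs_ROp) (auto simp: ptr framed_def J_def S_def)
        qed
      qed
    qed
  qed
  then show "runs (rexp_code d (Sum v t x)) (I, R) (3 + (ix_size t * (N + 1) *
    (p ((ix_size t + 1) * (N + 1)) + 5 + ix_time t + 3) + ix_time t + 3))
    (framed b e (\<lambda>R'. agree b d R R' \<and> R' (slot b 0 d 0) = rval inp M e (Sum v t x)))"
  proof (rule runs_weaken)
    have "?n * ((p N' + (2 + (2 + 1))) + ix_time t + 3) \<le> ix_size t * (N + 1) *
      (p ((ix_size t + 1) * (N + 1)) + 5 + ix_time t + 3)"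
      by (rule mult_le_mono[OF n]) (simp add: N'_def)
    then show "2 + (1 + (?n * ((p N' + (2 + (2 + 1))) + ix_time t + 3) + ix_time t + 3)) \<le>
      3 + (ix_size t * (N + 1) * (p ((ix_size t + 1) * (N + 1)) + 5 + ix_time t + 3) + ix_time t + 3)"
      by linarith
  qed (auto simp: framed_def J_def S_def)
qed

lemma computes_IfIdx:
  assumes x: "computes X x p" and y: "computes X y p'"
  shows "computes X (IfIdx s t x y) (\<lambda>N. (1 + ix_time s) + ((1 + ix_time t) + ((p N + p' N) + 1)))"
  unfolding computes_def
proof (intro allI impI)
  fix d e N b inp M I R
  assume N: "\<forall>v. e v \<le> N" and X: "\<forall>v. v \<notin> X \<longrightarrow> e v = 0" and inp: "\<forall>q\<ge>b. inp q = 0"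
    and fr: "frame b e I" and rep: "rep b inp M R"
  let ?Q = "framed b e (\<lambda>R'. agree b d R R' \<and> R' (slot b 0 d 0) = rval inp M e (IfIdx s t x y))"
  show "runs (rexp_code d (IfIdx s t x y)) (I, R) ((1 + ix_time s) + ((1 + ix_time t) + ((p N + p' N) + 1))) ?Q"
    unfolding rexp_code.simps
  proof (rule runs_Seq_sets[OF sets_set_ix[OF fr]], simp, simp)
    fix I1 assume 1: "I1 ptr1 = ix_val e s" "\<forall>r. r \<notin> {const_reg} \<and> r \<noteq> ptr1 \<longrightarrow> I1 r = I r"
    have fr1: "frame b e I1" by (rule sets_frame[OF fr 1(2)]) auto
    show "runs (Seq (set_ix ptr2 t) (Cond (ILess ptr1 ptr2) (rexp_code d x) (rexp_code d y))) (I1, R)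
      ((1 + ix_time t) + ((p N + p' N) + 1)) ?Q"
    proof (rule runs_Seq_sets[OF sets_set_ix[OF fr1]], simp, simp)
      fix I2 assume 2: "I2 ptr2 = ix_val e t" "\<forall>r. r \<notin> {const_reg} \<and> r \<noteq> ptr2 \<longrightarrow> I2 r = I1 r"
      have fr2: "frame b e I2" by (rule sets_frame[OF fr1 2(2)]) auto
      have ptr: "I2 ptr1 = ix_val e s" using 1 2 by auto
      show "runs (Cond (ILess ptr1 ptr2) (rexp_code d x) (rexp_code d y)) (I2, R) ((p N + p' N) + 1) ?Q"
      proof (rule runs_Cond)
        assume "holds (ILess ptr1 ptr2) (I2, R)"
        then show "runs (rexp_code d x) (I2, R) (p N + p' N) ?Q"
          by (intro runs_weaken[OF computesD[OF x N X inp fr2 rep]]) (auto simp: ptr 2(1) framed_def)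
      next
        assume "\<not> holds (ILess ptr1 ptr2) (I2, R)"
        then show "runs (rexp_code d y) (I2, R) (p N + p' N) ?Q"
          by (intro runs_weaken[OF computesD[OF y N X inp fr2 rep]]) (auto simp: ptr 2(1) framed_def)
      qed
    qed
  qed
qed

lemma computes_IfLess:
  assumes u: "computes X u p1" and w: "computes X w p2" and x: "computes X x p3" and y: "computes X y p4"
  shows "computes X (IfLess u w x y) (\<lambda>N. p1 N + (p2 N + (2 + (2 + ((p3 N + p4 N) + 1)))))"
  unfolding computes_def
proof (intro allI impI)
  fix d e N b inp M I R
  assume N: "\<forall>v. e v \<le> N" and X: "\<forall>v. v \<notin> X \<longrightarrow> e v = 0" and inp: "\<forall>q\<ge>b. inp q = 0"
    and fr: "frame b e I" and rep: "rep b inp M R"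
  let ?Q = "framed b e (\<lambda>R'. agree b d R R' \<and> R' (slot b 0 d 0) = rval inp M e (IfLess u w x y))"
  let ?C = "Cond (RLess ptr1 ptr2) (rexp_code d x) (rexp_code d y)"
  show "runs (rexp_code d (IfLess u w x y)) (I, R) (p1 N + (p2 N + (2 + (2 + ((p3 N + p4 N) + 1))))) ?Q"
    unfolding rexp_code.simps
  proof (rule runs_Seq[OF computesD[OF u N X inp fr rep]])
    fix s1 assume s1: "framed b e (\<lambda>R'. agree b d R R' \<and> R' (slot b 0 d 0) = rval inp M e u) s1"
    obtain I1 R1 where s1': "s1 = (I1, R1)" by (cases s1)
    have 1: "frame b e I1" "agree b d R R1" "R1 (slot b 0 d 0) = rval inp M e u"
      using s1 s1' by (auto simp: framed_def)
    show "runs (Seq (rexp_code (d + 1) w) (Seq (temp_addr ptr1 d) (Seq (temp_addr ptr2 (d + 1)) ?C))) s1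
       (p2 N + (2 + (2 + ((p3 N + p4 N) + 1)))) ?Q"
      unfolding s1'
    proof (rule runs_Seq[OF computesD[OF w N X inp 1(1) agree_rep[OF 1(2) rep]]])
      fix s2 assume s2: "framed b e (\<lambda>R'. agree b (d + 1) R1 R' \<and> R' (slot b 0 (d + 1) 0) = rval inp M e w) s2"
      obtain I2 R2 where s2': "s2 = (I2, R2)" by (cases s2)
      have 2: "frame b e I2" "agree b (d + 1) R1 R2" "R2 (slot b 0 (d + 1) 0) = rval inp M e w"
        using s2 s2' by (auto simp: framed_def)
      have a2: "agree b d R R2" by (rule agree_trans[OF 1(2) _ 2(2)]) simp
      have r2: "R2 (slot b 0 d 0) = rval inp M e u" using agree_temp[OF 2(2), of d] 1(3) by simp
      show "runs (Seq (temp_addr ptr1 d) (Seq (temp_addr ptr2 (d + 1)) ?C)) s2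
        (2 + (2 + ((p3 N + p4 N) + 1))) ?Q"
        unfolding s2'
      proof (rule runs_Seq_temp[OF 2(1)], simp, rule runs_Seq_temp, assumption, simp)
        fix I3 I4
        assume *: "I3 ptr1 = slot b 0 d 0" "\<forall>r. r \<noteq> ptr1 \<longrightarrow> I3 r = I2 r"
          "I4 ptr2 = slot b 0 (d + 1) 0" "\<forall>r. r \<noteq> ptr2 \<longrightarrow> I4 r = I3 r" "frame b e I4"
        have ptr: "I4 ptr1 = slot b 0 d 0" "I4 ptr2 = slot b 0 (d + 1) 0" using * by auto
        have res: "runs (rexp_code d z) (I4, R2) (p3 N + p4 N) ?Q"
          if z: "computes X z q" "q N \<le> p3 N + p4 N" "rval inp M e z = rval inp M e (IfLess u w x y)" for z q
          by (rule runs_weaken[OF computesD[OF z(1) N X inp *(5) agree_rep[OF a2 rep]] z(2)])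
            (use agree_trans[OF a2 order_refl] z(3) in \<open>auto simp: framed_def\<close>)
        show "runs ?C (I4, R2) ((p3 N + p4 N) + 1) ?Q"
        proof (rule runs_Cond)
          assume "holds (RLess ptr1 ptr2) (I4, R2)"
          then show "runs (rexp_code d x) (I4, R2) (p3 N + p4 N) ?Q"
            by (intro res[OF x]) (auto simp: ptr r2 2(3)[simplified])
        next
          assume "\<not> holds (RLess ptr1 ptr2) (I4, R2)"
          then show "runs (rexp_code d y) (I4, R2) (p3 N + p4 N) ?Q"
            by (intro res[OF y]) (auto simp: ptr r2 2(3)[simplified])
        qed
      qed
    qed
  qed
qed

lemma rexp_code_correct: "rexp_ok X x \<Longrightarrow> \<exists>p. poly_bdd p \<and> computes X x p"
proof (induction x arbitrary: X)
  case (Num z)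
  show ?case using computes_Num poly_bdd_const by blast
next
  case (Inp i j)
  show ?case by (rule computes_Inp)
next
  case (Cell a i j)
  show ?case by (rule computes_Cell)
next
  case (Bin f x y)
  obtain p p' where h: "poly_bdd p" "computes X x p" "poly_bdd p'" "computes X y p'"
    using Bin.IH[of X] Bin.prems by auto
  have "poly_bdd (\<lambda>N. p N + (p' N + 11))" using h by (intro poly_bdd_intros)
  then show ?case using computes_Bin[OF h(2,4)] by blast
next
  case (Sum v t x)
  obtain p where "poly_bdd p" "computes (insert v X) x p"
    using Sum.IH[of "insert v X"] Sum.prems by auto
  moreover from this have "poly_bdd (\<lambda>N. 3 + (ix_size t * (N + 1) *
    (p ((ix_size t + 1) * (N + 1)) + 5 + ix_time t + 3) + ix_time t + 3))"
    by (intro poly_bdd_intros)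
  ultimately show ?case using computes_Sum[of v X x p t] Sum.prems by auto
next
  case (IfIdx s t x y)
  obtain p p' where h: "poly_bdd p" "computes X x p" "poly_bdd p'" "computes X y p'"
    using IfIdx.IH[of X] IfIdx.prems by auto
  have "poly_bdd (\<lambda>N. (1 + ix_time s) + ((1 + ix_time t) + ((p N + p' N) + 1)))" using h by (intro poly_bdd_intros)
  then show ?case using computes_IfIdx[OF h(2,4)] by blast
next
  case (IfLess u w x y)
  obtain p1 p2 p3 p4 where h: "poly_bdd p1" "computes X u p1" "poly_bdd p2" "computes X w p2"
    "poly_bdd p3" "computes X x p3" "poly_bdd p4" "computes X y p4"
    using IfLess.IH[of X] IfLess.prems by auto
  have "poly_bdd (\<lambda>N. p1 N + (p2 N + (2 + (2 + ((p3 N + p4 N) + 1)))))" using h by (intro poly_bdd_intros)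
  then show ?case using computes_IfLess[OF h(2,4,6,8)] by blast
qed

section \<open>Compilation of commands and programs\<close>

text \<open>An assignment to a matrix first writes all new entries to the staging area and then copies them,
  which makes it simultaneous.\<close>

fun cmd_code :: "cmd \<Rightarrow> com" where
  "cmd_code (Fill a v t w t' x) = Seq
     (loop v t (loop w t' (Seq (rexp_code 0 x) (Seq (slot_addr ptr1 1 (IVar v) (IVar w))
       (Seq (temp_addr ptr2 0) (RCopy ptr1 ptr2))))))
     (loop v t (loop w t' (Seq (slot_addr ptr1 (a + 2) (IVar v) (IVar w))
       (Seq (slot_addr ptr2 1 (IVar v) (IVar w)) (RCopy ptr1 ptr2)))))"
| "cmd_code (Then c c') = Seq (cmd_code c) (cmd_code c')"
| "cmd_code (For v t c) = loop v t (cmd_code c)"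

lemma runs_loop2:
  assumes e: "e v = 0" "e w = 0" "v \<noteq> w" "v \<notin> ix_vars t \<union> ix_vars t'" "w \<notin> ix_vars t \<union> ix_vars t'"
    and fr: "frame b e I" and J0: "J 0 0 R"
    and J_Suc: "\<And>i R. J i (ix_val e t') R \<Longrightarrow> J (Suc i) 0 R"
    and step: "\<And>i j I R. i < ix_val e t \<Longrightarrow> j < ix_val e t' \<Longrightarrow>
      frame b (e(v := i, w := j)) I \<Longrightarrow> J i j R \<Longrightarrow>
      runs body (I, R) T (framed b (e(v := i, w := j)) (J i (Suc j)))"
  shows "runs (loop v t (loop w t' body)) (I, R) (ix_val e t *
      ((ix_val e t' * (T + ix_time t' + 3) + ix_time t' + 3) + ix_time t + 3) + ix_time t + 3)
    (framed b e (J (ix_val e t) 0))"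
proof (rule runs_loop[where J="\<lambda>i. J i 0", OF e(1) _ fr J0])
  show "v \<notin> ix_vars t" using e by simp
  fix i I R assume i: "i < ix_val e t" and fr: "frame b (e(v := i)) I" and J: "J i 0 R"
  have n: "ix_val (e(v := i)) t' = ix_val e t'" using e by (simp add: ix_val_upd)
  have "runs (loop w t' body) (I, R) (ix_val (e(v := i)) t' * (T + ix_time t' + 3) + ix_time t' + 3)
      (framed b (e(v := i)) (J i (ix_val (e(v := i)) t')))"
  proof (rule runs_loop)
    show "(e(v := i)) w = 0" "w \<notin> ix_vars t'" using e by simp_all
    show "frame b (e(v := i)) I" "J i 0 R" by fact+
    fix j I R assume "j < ix_val (e(v := i)) t'" "frame b (e(v := i, w := j)) I" "J i j R"
    then show "runs body (I, R) T (framed b (e(v := i, w := j)) (J i (Suc j)))"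
      using step[OF i] n by simp
  qed
  then show "runs (loop w t' body) (I, R) (ix_val e t' * (T + ix_time t' + 3) + ix_time t' + 3)
      (framed b (e(v := i)) (J (Suc i) 0))"
    unfolding n by (rule runs_weaken) (auto simp: framed_def J_Suc)
qed

definition performs :: "nat set \<Rightarrow> cmd \<Rightarrow> (nat \<Rightarrow> nat) \<Rightarrow> bool" where
  "performs X c p \<longleftrightarrow> (\<forall>e N b inp M I R. (\<forall>v. e v \<le> N) \<longrightarrow> (\<forall>v. v \<notin> X \<longrightarrow> e v = 0) \<longrightarrow>
     (\<forall>q\<ge>b. inp q = 0) \<longrightarrow> frame b e I \<longrightarrow> rep b inp M R \<longrightarrow>
     runs (cmd_code c) (I, R) (p N) (framed b e (rep b inp (sem inp e c M))))"

lemma performsD: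
  assumes "performs X c p" "\<forall>v. e v \<le> N" "\<forall>v. v \<notin> X \<longrightarrow> e v = 0" "\<forall>q\<ge>b. inp q = 0"
    "frame b e I" "rep b inp M R"
  shows "runs (cmd_code c) (I, R) (p N) (framed b e (rep b inp (sem inp e c M)))"
  using assms unfolding performs_def by blast

lemma rep_upd_stage: "rep b inp M R \<Longrightarrow> rep b inp M (R(slot b 1 i j := z))"
  using slot_ge[of b 1 i j] by (auto simp: rep_def)

lemma rep_upd_cell: "rep b inp M R \<Longrightarrow>
    rep b inp (M(a := (M a)(i := (M a i)(j := z)))) (R(slot b (a + 2) i j := z))"
  using slot_ge[of b "a + 2" i j] by (auto simp: rep_def)

lemma performs_Fill:
  assumes ok: "cmd_ok X (Fill a v t w t' x)"
  shows "\<exists>p. poly_bdd p \<and> performs X (Fill a v t w t' x) p"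
proof -
  have vw: "v \<notin> X" "w \<notin> X" "v \<noteq> w" "v \<notin> ix_vars t \<union> ix_vars t'" "w \<notin> ix_vars t \<union> ix_vars t'"
    and xok: "rexp_ok (insert v (insert w X)) x"
    using ok by auto
  obtain px where px: "poly_bdd px" "computes (insert v (insert w X)) x px"
    using rexp_code_correct[OF xok] by blast
  obtain pa where pa: "poly_bdd pa" "\<And>q c b e N I. \<forall>u. e u \<le> N \<Longrightarrow> frame b e I \<Longrightarrow> q \<in> {12..<20} \<Longrightarrow>
     sets {7..<12} (slot_addr q c (IVar v) (IVar w)) q (slot b c (e v) (e w)) (pa N + 3 * c) I"
    using sets_slot_addr[of "IVar v" "IVar w"] by auto
  define s where "s = ix_size t + ix_size t' + 1"
  define T1 where "T1 = (\<lambda>N. px (s * (N + 1)) + ((pa (s * (N + 1)) + 3) + (2 + 1)))"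
  define T2 where "T2 = (\<lambda>N. (pa (s * (N + 1)) + 3 * (a + 2)) + ((pa (s * (N + 1)) + 3) + 1))"
  define L where "L = (\<lambda>B T. B * ((B * (T + ix_time t' + 3) + ix_time t' + 3) + ix_time t + 3) + ix_time t + 3)"
  define p where "p = (\<lambda>N. L (s * (N + 1)) (T1 N) + L (s * (N + 1)) (T2 N))"
  have "poly_bdd p" unfolding p_def L_def T1_def T2_def
    by (intro poly_bdd_intros px(1) pa(1))
  moreover have "performs X (Fill a v t w t' x) p" unfolding performs_def
  proof (intro allI impI)
    fix e N b inp M I R
    assume N: "\<forall>v. e v \<le> N" and X: "\<forall>v. v \<notin> X \<longrightarrow> e v = 0" and inp: "\<forall>q\<ge>b. inp q = 0"
      and fr: "frame b e I" and rep: "rep b inp M R"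
    let ?n = "ix_val e t" and ?n' = "ix_val e t'"
    have e0: "e v = 0" "e w = 0" using X vw by auto
    have nt: "?n \<le> ix_size t * (N + 1)" "?n' \<le> ix_size t' * (N + 1)" using ix_val_le[OF N] by auto
    then have n: "?n \<le> s * (N + 1)" "?n' \<le> s * (N + 1)" "N \<le> s * (N + 1)"
      by (auto simp: s_def distrib_right)
    have L_mono: "?n * ((?n' * (T + ix_time t' + 3) + ix_time t' + 3) + ix_time t + 3) + ix_time t + 3
        \<le> L (s * (N + 1)) T" for T
      unfolding L_def by (intro add_mono mult_le_mono n order_refl)
    define V where "V = (\<lambda>i j. rval inp M (e(v := i, w := j)) x)"
    have Nij: "\<forall>u. (e(v := i, w := j)) u \<le> s * (N + 1)" if "i < ?n" "j < ?n'" for i j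
      using that n N by (auto intro: le_trans)
    have Xij: "\<forall>u. u \<notin> insert v (insert w X) \<longrightarrow> (e(v := i, w := j)) u = 0" for i j
      using X by auto
    define done1 where "done1 = (\<lambda>(i::nat) j i' j'. i' < i \<and> j' < ?n' \<or> i' = i \<and> j' < j)"
    \<comment> \<open>In the first phase the staging cells receive the new entries, in the second they are copied.\<close>
    define J1 where "J1 = (\<lambda>i j R. rep b inp M R \<and> (\<forall>i' j'. done1 i j i' j' \<longrightarrow> R (slot b 1 i' j') = V i' j'))"
    define M2 where "M2 = (\<lambda>i j. M(a := \<lambda>i' j'. if done1 i j i' j' then V i' j' else M a i' j'))"
    define J2 where "J2 = (\<lambda>i j R. rep b inp (M2 i j) R \<and> (\<forall>i'<?n. \<forall>j'<?n'. R (slot b 1 i' j') = V i' j'))"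
    have phase1: "runs (loop v t (loop w t' (Seq (rexp_code 0 x) (Seq (slot_addr ptr1 1 (IVar v) (IVar w))
       (Seq (temp_addr ptr2 0) (RCopy ptr1 ptr2)))))) (I, R) (L (s * (N + 1)) (T1 N)) (framed b e (J1 ?n 0))"
    proof (rule runs_weaken[OF runs_loop2[where J=J1 and T="T1 N", OF e0 vw(3-5) fr]])
      show "J1 0 0 R" using rep by (simp add: J1_def done1_def)
      show "J1 (Suc i) 0 R" if "J1 i ?n' R" for i R
        using that by (auto simp: J1_def done1_def less_Suc_eq)
      fix i j I R
      assume ij: "i < ?n" "j < ?n'" and fr: "frame b (e(v := i, w := j)) I" and J: "J1 i j R"
      have rep': "rep b inp M R" using J by (simp add: J1_def)
      let ?e = "e(v := i, w := j)"
      show "runs (Seq (rexp_code 0 x) (Seq (slot_addr ptr1 1 (IVar v) (IVar w))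
       (Seq (temp_addr ptr2 0) (RCopy ptr1 ptr2)))) (I, R) (T1 N) (framed b ?e (J1 i (Suc j)))"
        unfolding T1_def
      proof (rule runs_Seq[OF computesD[OF px(2) Nij[OF ij] Xij inp fr rep']])
        fix s1 assume s1: "framed b ?e (\<lambda>R'. agree b 0 R R' \<and> R' (slot b 0 0 0) = rval inp M ?e x) s1"
        obtain I1 R1 where s1': "s1 = (I1, R1)" by (cases s1)
        have 1: "frame b ?e I1" "agree b 0 R R1" "R1 (slot b 0 0 0) = V i j"
          using s1 s1' by (auto simp: framed_def V_def)
        have p1: "ptr1 \<in> {12..<20}" by simp
        show "runs (Seq (slot_addr ptr1 1 (IVar v) (IVar w)) (Seq (temp_addr ptr2 0) (RCopy ptr1 ptr2)))
          s1 ((pa (s * (N + 1)) + 3) + (2 + 1)) (framed b ?e (J1 i (Suc j)))"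
          unfolding s1'
        proof (rule runs_Seq_sets[OF pa(2)[OF Nij[OF ij] 1(1) p1, of 1, simplified mult_1_right]])
          fix I2 assume 2: "I2 ptr1 = slot b 1 (?e v) (?e w)" "\<forall>r. r \<notin> {7..<12} \<and> r \<noteq> ptr1 \<longrightarrow> I2 r = I1 r"
          have fr2: "frame b ?e I2" by (rule sets_frame[OF 1(1) 2(2)]) auto
          show "runs (Seq (temp_addr ptr2 0) (RCopy ptr1 ptr2)) (I2, R1) (2 + 1) (framed b ?e (J1 i (Suc j)))"
          proof (rule runs_Seq_temp[OF fr2])
            fix I3 assume 3: "I3 ptr2 = slot b 0 0 0" "\<forall>r. r \<noteq> ptr2 \<longrightarrow> I3 r = I2 r" "frame b ?e I3"
            have ptr: "I3 ptr1 = slot b 1 i j" using 2(1) 3(2) vw(3) by simp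
            have "J1 i (Suc j) (R1(slot b 1 i j := V i j))"
              unfolding J1_def
            proof (intro conjI allI impI)
              show "rep b inp M (R1(slot b 1 i j := V i j))"
                by (rule rep_upd_stage[OF agree_rep[OF 1(2) rep']])
              fix i' j' assume "done1 i (Suc j) i' j'"
              then show "(R1(slot b 1 i j := V i j)) (slot b 1 i' j') = V i' j'"
                using J agree_slot[OF 1(2), of 1 i' j'] by (auto simp: J1_def done1_def less_Suc_eq)
            qed
            then show "runs (RCopy ptr1 ptr2) (I3, R1) 1 (framed b ?e (J1 i (Suc j)))"
              using 3 1(3) by (intro runs_RCopy) (auto simp: ptr framed_def)
          qed simp
        qed
      qed
    qed (use L_mono in auto)
    have phase2: "runs (loop v t (loop w t' (Seq (slot_addr ptr1 (a + 2) (IVar v) (IVar w))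
       (Seq (slot_addr ptr2 1 (IVar v) (IVar w)) (RCopy ptr1 ptr2))))) (I, R) (L (s * (N + 1)) (T2 N))
       (framed b e (J2 ?n 0))" if fr: "frame b e I" and J2: "J2 0 0 R" for I R
    proof (rule runs_weaken[OF runs_loop2[where J=J2 and T="T2 N", OF e0 vw(3-5) fr J2]])
      have "done1 (Suc i) 0 = done1 i ?n'" for i
        by (auto simp: done1_def less_Suc_eq intro!: ext)
      then show "J2 (Suc i) 0 R" if "J2 i ?n' R" for i R
        using that by (simp add: J2_def M2_def)
      fix i j I R
      assume ij: "i < ?n" "j < ?n'" and fr: "frame b (e(v := i, w := j)) I" and J: "J2 i j R"
      let ?e = "e(v := i, w := j)"
      have p1: "ptr1 \<in> {12..<20}" and p2: "ptr2 \<in> {12..<20}" by simp_all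
      show "runs (Seq (slot_addr ptr1 (a + 2) (IVar v) (IVar w))
        (Seq (slot_addr ptr2 1 (IVar v) (IVar w)) (RCopy ptr1 ptr2))) (I, R) (T2 N)
        (framed b ?e (J2 i (Suc j)))"
        unfolding T2_def
      proof (rule runs_Seq_sets[OF pa(2)[OF Nij[OF ij] fr p1]])
        fix I2 assume 2: "I2 ptr1 = slot b (a + 2) (?e v) (?e w)" "\<forall>r. r \<notin> {7..<12} \<and> r \<noteq> ptr1 \<longrightarrow> I2 r = I r"
        have fr2: "frame b ?e I2" by (rule sets_frame[OF fr 2(2)]) auto
        show "runs (Seq (slot_addr ptr2 1 (IVar v) (IVar w)) (RCopy ptr1 ptr2)) (I2, R)
          ((pa (s * (N + 1)) + 3) + 1) (framed b ?e (J2 i (Suc j)))"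
        proof (rule runs_Seq_sets[OF pa(2)[OF Nij[OF ij] fr2 p2, of 1, simplified mult_1_right]])
          fix I3 assume 3: "I3 ptr2 = slot b 1 (?e v) (?e w)" "\<forall>r. r \<notin> {7..<12} \<and> r \<noteq> ptr2 \<longrightarrow> I3 r = I2 r"
          have fr3: "frame b ?e I3" by (rule sets_frame[OF fr2 3(2)]) auto
          have ptr: "I3 ptr1 = slot b (a + 2) i j" "I3 ptr2 = slot b 1 i j"
            using 2(1) 3 vw(3) by simp_all
          have st: "R (slot b 1 i j) = V i j" using J ij by (simp add: J2_def)
          have M2: "(M2 i j)(a := (M2 i j a)(i := (M2 i j a i)(j := V i j))) = M2 i (Suc j)"
            by (auto simp: M2_def done1_def less_Suc_eq intro!: ext)
          have "rep b inp (M2 i j) R" using J by (simp add: J2_def)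
          from rep_upd_cell[OF this, of a i j "V i j"] M2
          have "J2 i (Suc j) (R(slot b (a + 2) i j := V i j))"
            using J by (simp add: J2_def)
          then show "runs (RCopy ptr1 ptr2) (I3, R) 1 (framed b ?e (J2 i (Suc j)))"
            using fr3 st by (intro runs_RCopy) (auto simp: ptr framed_def)
        qed
      qed
    qed (use L_mono in auto)
    have done_n: "done1 ?n 0 i' j' \<longleftrightarrow> i' < ?n \<and> j' < ?n'" for i' j'
      by (auto simp: done1_def)
    have fin: "M2 ?n 0 = sem inp e (Fill a v t w t' x) M"
      unfolding M2_def V_def sem.simps by (simp only: done_n)
    show "runs (cmd_code (Fill a v t w t' x)) (I, R) (p N)
        (framed b e (rep b inp (sem inp e (Fill a v t w t' x) M)))"
      unfolding cmd_code.simps p_def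
    proof (rule runs_Seq[OF phase1])
      fix s1 assume s1: "framed b e (J1 ?n 0) s1"
      obtain I1 R1 where s1': "s1 = (I1, R1)" by (cases s1)
      have "frame b e I1" using s1 s1' by (auto simp: framed_def)
      moreover have "J2 0 0 R1"
        using s1 s1' by (simp add: framed_def J1_def J2_def M2_def done_n) (simp add: done1_def)
      ultimately show "runs (loop v t (loop w t' (Seq (slot_addr ptr1 (a + 2) (IVar v) (IVar w))
        (Seq (slot_addr ptr2 1 (IVar v) (IVar w)) (RCopy ptr1 ptr2))))) s1 (L (s * (N + 1)) (T2 N))
        (framed b e (rep b inp (sem inp e (Fill a v t w t' x) M)))"
        unfolding s1' by (rule runs_weaken[OF phase2]) (auto simp: framed_def J2_def fin simp del: sem.simps)
    qed
  qed
  ultimately show ?thesis by blast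
qed

text \<open>Each construct of the language combines the bounds of its parts by sums, products and a scaling of the
  argument, so that every program has polynomial running time.\<close>

lemma cmd_code_correct: "cmd_ok X c \<Longrightarrow> \<exists>p. poly_bdd p \<and> performs X c p"
proof (induction c arbitrary: X)
  case (Fill a v t w t' x)
  then show ?case by (rule performs_Fill)
next
  case (Then c c')
  obtain p p' where p: "poly_bdd p" "performs X c p" "poly_bdd p'" "performs X c' p'"
    using Then.IH[of X] Then.prems by auto
  have "performs X (Then c c') (\<lambda>N. p N + p' N)" unfolding performs_def
  proof (intro allI impI)
    fix e N b inp M I R
    assume *: "\<forall>v. e v \<le> N" "\<forall>v. v \<notin> X \<longrightarrow> e v = 0" "\<forall>q\<ge>b. inp q = 0" "frame b e I" "rep b inp M R"
    show "runs (cmd_code (Then c c')) (I, R) (p N + p' N) (framed b e (rep b inp (sem inp e (Then c c') M)))"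
      unfolding cmd_code.simps
    proof (rule runs_Seq[OF performsD[OF p(2) *]])
      fix s assume "framed b e (rep b inp (sem inp e c M)) s"
      then show "runs (cmd_code c') s (p' N) (framed b e (rep b inp (sem inp e (Then c c') M)))"
        using performsD[OF p(4) *(1-3)] by (cases s) (auto simp: framed_def)
    qed
  qed
  moreover have "poly_bdd (\<lambda>N. p N + p' N)" using p by (intro poly_bdd_intros)
  ultimately show ?case by blast
next
  case (For v t c)
  have v: "v \<notin> X" "v \<notin> ix_vars t" using For.prems by auto
  obtain p where p: "poly_bdd p" "performs (insert v X) c p"
    using For.IH[of "insert v X"] For.prems by auto
  define s where "s = ix_size t + 1"
  define p' where "p' = (\<lambda>N. s * (N + 1) * (p (s * (N + 1)) + ix_time t + 3) + ix_time t + 3)"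
  have "performs X (For v t c) p'" unfolding performs_def
  proof (intro allI impI)
    fix e N b inp M I R
    assume N: "\<forall>v. e v \<le> N" and X: "\<forall>v. v \<notin> X \<longrightarrow> e v = 0" and inp: "\<forall>q\<ge>b. inp q = 0"
      and fr: "frame b e I" and rep: "rep b inp M R"
    define J where "J = (\<lambda>i. rep b inp (fold (\<lambda>i. sem inp (e(v := i)) c) [0..<i] M))"
    have n: "ix_val e t \<le> s * (N + 1)" "N \<le> s * (N + 1)"
      using ix_val_le[OF N, of t] by (auto simp: s_def)
    have "runs (loop v t (cmd_code c)) (I, R)
        (ix_val e t * (p (s * (N + 1)) + ix_time t + 3) + ix_time t + 3) (framed b e (J (ix_val e t)))"
    proof (rule runs_loop)
      show "e v = 0" "v \<notin> ix_vars t" "frame b e I" using X v fr by auto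
      show "J 0 R" using rep by (simp add: J_def)
      fix i I R assume i: "i < ix_val e t" and fr: "frame b (e(v := i)) I" and J: "J i R"
      have N': "\<forall>u. (e(v := i)) u \<le> s * (N + 1)" using i n N by (auto intro: le_trans)
      have X': "\<forall>u. u \<notin> insert v X \<longrightarrow> (e(v := i)) u = 0" using X by simp
      show "runs (cmd_code c) (I, R) (p (s * (N + 1))) (framed b (e(v := i)) (J (Suc i)))"
        by (rule runs_weaken[OF performsD[OF p(2) N' X' inp fr J[unfolded J_def]]])
          (auto simp: J_def framed_def)
    qed
    then show "runs (cmd_code (For v t c)) (I, R) (p' N) (framed b e (rep b inp (sem inp e (For v t c) M)))"
      unfolding cmd_code.simps
    proof (rule runs_weaken)
      show "ix_val e t * (p (s * (N + 1)) + ix_time t + 3) + ix_time t + 3 \<le> p' N"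
        unfolding p'_def by (intro add_mono mult_le_mono n order_refl)
    qed (simp add: J_def)
  qed
  moreover have "poly_bdd p'" unfolding p'_def by (intro poly_bdd_intros p)
  ultimately show ?case by blast
qed

text \<open>Sets up the constant \<open>1\<close> and the address \<open>(m + l) n\<close> behind the input, runs the program and moves the
  upper left entry of matrix \<open>a\<close> to the output cell.\<close>

definition program_code :: "nat \<Rightarrow> cmd \<Rightarrow> com" where
  "program_code a c = Seq (IConst one_reg 1) (Seq (IAdd row_reg 1 0)
     (Seq (mul_code base_reg row_reg 2) (Seq (cmd_code c)
     (Seq (slot_addr ptr1 (a + 2) (INum 0) (INum 0)) (RCopy zero_reg ptr1)))))"

lemma program_code_correct:
  assumes ok: "cmd_ok {0, 1, 2, 3} c"
  shows "\<exists>d. \<forall>l m n k. \<forall>A\<in>carrier_mat m n. \<forall>B\<in>carrier_mat l n.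
    \<exists>t s. exec (program_code a c) (input_state k A B) t s \<and> t \<le> d * (l + m + n + k + 1) ^ d \<and>
      output_value s = sem (snd (input_state k A B)) (fst (input_state k A B)) c (\<lambda>_ _ _. 0) a 0 0"
proof -
  obtain p where p: "poly_bdd p" "performs {0, 1, 2, 3} c p"
    using cmd_code_correct[OF ok] by blast
  obtain pa where pa: "poly_bdd pa" "\<And>q c b e N I. \<forall>v. e v \<le> N \<Longrightarrow> frame b e I \<Longrightarrow> q \<in> {12..<20} \<Longrightarrow>
     sets {7..<12} (slot_addr q c (INum 0) (INum 0)) q (slot b c 0 0) (pa N + 3 * c) I"
    using sets_slot_addr[of "INum 0" "INum 0"] by auto
  define T where "T = (\<lambda>N. 1 + (1 + ((3 * N + 1) + (p N + ((pa N + 3 * (a + 2)) + 1)))))"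
  have "poly_bdd T" unfolding T_def by (intro poly_bdd_intros p pa)
  then obtain d where d: "T N \<le> d * (N + 1) ^ d" for N
    unfolding poly_bdd_def by blast
  show ?thesis
  proof (rule exI[of _ d], intro allI ballI)
    fix l m n k and A B :: "real mat"
    assume A: "A \<in> carrier_mat m n" and B: "B \<in> carrier_mat l n"
    let ?s0 = "input_state k A B"
    define e where "e = fst ?s0"
    define inp where "inp = snd ?s0"
    have s0: "?s0 = (e, inp)" by (simp add: e_def inp_def)
    define N where "N = l + m + n + k"
    define b where "b = (m + l) * n"
    have e_eq: "e = (\<lambda>_. 0)(0 := l, 1 := m, 2 := n, 3 := k)"
      using A B by (simp add: e_def input_state_def Let_def)
    have inp: "\<forall>q\<ge>b. inp q = 0"
      using A B by (auto simp: inp_def input_state_def Let_def b_def distrib_right)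
    have eN: "\<forall>v. e v \<le> N" by (auto simp: e_eq N_def)
    have e0: "\<forall>v. v \<notin> {0, 1, 2, 3} \<longrightarrow> e v = 0" by (auto simp: e_eq)
    \<comment> \<open>Everything beyond the input is zero at the start, hence so are all matrices.\<close>
    have rep: "rep b inp (\<lambda>_ _ _. 0) inp" using inp slot_ge[of b] by (auto simp: rep_def)
    let ?M = "sem inp e c (\<lambda>_ _ _. 0)"
    have "runs (program_code a c) (e, inp) (T N) (\<lambda>s. output_value s = ?M a 0 0)"
      unfolding program_code_def T_def
    proof (rule runs_Seq_sets[OF sets_IConst])
      fix I1 assume 1: "I1 one_reg = 1" "\<forall>r. r \<notin> {} \<and> r \<noteq> one_reg \<longrightarrow> I1 r = e r"
      show "runs (Seq (IAdd row_reg 1 0) (Seq (mul_code base_reg row_reg 2) (Seq (cmd_code c)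
          (Seq (slot_addr ptr1 (a + 2) (INum 0) (INum 0)) (RCopy zero_reg ptr1))))) (I1, inp)
          (1 + ((3 * N + 1) + (p N + ((pa N + 3 * (a + 2)) + 1)))) (\<lambda>s. output_value s = ?M a 0 0)"
      proof (rule runs_Seq_sets[OF sets_IAdd])
        fix I2 assume 2: "I2 row_reg = I1 1 + I1 0" "\<forall>r. r \<notin> {} \<and> r \<noteq> row_reg \<longrightarrow> I2 r = I1 r"
        have row: "I2 row_reg = m + l" using 1 2 by (simp add: e_eq)
        have I2: "I2 base_reg = 0" "I2 zero_reg = 0" "I2 one_reg = 1" "I2 2 = n"
          using 1 2 by (simp_all add: e_eq)
        have "sets {row_reg} (mul_code base_reg row_reg 2) base_reg
          (I2 base_reg + I2 row_reg * I2 2) (3 * I2 row_reg + 1) I2"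
          by (rule sets_mul_code) (use I2 in auto)
        then have mc: "sets {row_reg} (mul_code base_reg row_reg 2) base_reg b (3 * (m + l) + 1) I2"
          using I2 row by (simp add: b_def)
        show "runs (Seq (mul_code base_reg row_reg 2) (Seq (cmd_code c)
          (Seq (slot_addr ptr1 (a + 2) (INum 0) (INum 0)) (RCopy zero_reg ptr1)))) (I2, inp)
          ((3 * N + 1) + (p N + ((pa N + 3 * (a + 2)) + 1))) (\<lambda>s. output_value s = ?M a 0 0)"
        proof (rule runs_Seq_sets[OF sets_weaken[OF mc _ order_refl]])
          show "3 * (m + l) + 1 \<le> 3 * N + 1" by (simp add: N_def)
          fix I3 assume 3: "I3 base_reg = b" "\<forall>r. r \<notin> {row_reg} \<and> r \<noteq> base_reg \<longrightarrow> I3 r = I2 r"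
          have "I3 (reg v) = e v" for v
            using 1 2 3 by (simp add: reg_def e_eq)
          then have fr3: "frame b e I3" using I2 3 by (simp add: frame_def)
          show "runs (Seq (cmd_code c) (Seq (slot_addr ptr1 (a + 2) (INum 0) (INum 0))
              (RCopy zero_reg ptr1))) (I3, inp) (p N + ((pa N + 3 * (a + 2)) + 1))
              (\<lambda>s. output_value s = ?M a 0 0)"
          proof (rule runs_Seq[OF performsD[OF p(2) eN e0 inp fr3 rep]])
            fix s4 assume s4: "framed b e (rep b inp ?M) s4"
            obtain I4 R4 where s4': "s4 = (I4, R4)" by (cases s4)
            have 4: "frame b e I4" "rep b inp ?M R4" using s4 s4' by (auto simp: framed_def)
            have p1: "ptr1 \<in> {12..<20}" by simp
            show "runs (Seq (slot_addr ptr1 (a + 2) (INum 0) (INum 0)) (RCopy zero_reg ptr1)) s4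
              ((pa N + 3 * (a + 2)) + 1) (\<lambda>s. output_value s = ?M a 0 0)"
              unfolding s4'
            proof (rule runs_Seq_sets[OF pa(2)[OF eN 4(1) p1]])
              fix I5 assume 5: "I5 ptr1 = slot b (a + 2) 0 0" "\<forall>r. r \<notin> {7..<12} \<and> r \<noteq> ptr1 \<longrightarrow> I5 r = I4 r"
              have "I5 zero_reg = 0" using 4(1) 5(2) by (simp add: frame_def)
              then show "runs (RCopy zero_reg ptr1) (I5, R4) 1 (\<lambda>s. output_value s = ?M a 0 0)"
                using 4(2) 5(1) by (intro runs_RCopy) (simp_all add: output_value_def rep_def)
            qed
          qed
        qed
      qed
    qed
    then show "\<exists>t s. exec (program_code a c) ?s0 t s \<and> t \<le> d * (l + m + n + k + 1) ^ d \<and>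
      output_value s = sem (snd ?s0) (fst ?s0) c (\<lambda>_ _ _. 0) a 0 0"
      using d[of N] unfolding runs_def s0 N_def by (auto intro: le_trans)
  qed
qed

section \<open>A program for the norm\<close>

lemma sem_For_invariant:
  assumes "P 0 M" and "\<And>i M. i < ix_val e t \<Longrightarrow> P i M \<Longrightarrow> P (Suc i) (sem inp (e(v := i)) c M)"
  shows "P (ix_val e t) (sem inp e (For v t c) M)"
proof -
  have "i \<le> ix_val e t \<Longrightarrow> P i (fold (\<lambda>i. sem inp (e(v := i)) c) [0..<i] M)" for i
    by (induction i) (use assms in auto)
  then show ?thesis by simp
qed

text \<open>In the programs below the variables \<open>0\<close>, \<open>1\<close>, \<open>2\<close>, \<open>3\<close> are \<open>l\<close>, \<open>m\<close>, \<open>n\<close>, \<open>k\<close>. Matrix \<open>0\<close> is \<open>A\<close> on top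
  of \<open>B\<close>, matrix \<open>1\<close> is the column vector of the diagonal \<open>diag\<close>, and matrix \<open>5\<close> is the test matrix.
  The others are scalars: \<open>2\<close> and \<open>3\<close> are the upper and lower end of the bisection interval, \<open>4\<close> is
  its midpoint and \<open>6\<close> is the verdict on definiteness.\<close>

definition gram_exp :: "nat \<Rightarrow> nat \<Rightarrow> rexp" where
  "gram_exp c c' = Sum 7 (IVar 0) (Bin Times (Cell 0 (ISum (IVar 1) (IVar 7)) (IVar c))
     (Cell 0 (ISum (IVar 1) (IVar 7)) (IVar c')))"

definition abs_exp :: "rexp \<Rightarrow> rexp" where
  "abs_exp x = IfLess x (Num 0) (Bin Minus (Num 0) x) x"

text \<open>A scalar is the upper left entry of a matrix.\<close>

definition set_scalar :: "nat \<Rightarrow> rexp \<Rightarrow> cmd" where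
  "set_scalar a x = Fill a 10 (INum 1) 11 (INum 1) x"

abbreviation (input) scalar :: "nat \<Rightarrow> rexp" where
  "scalar a \<equiv> Cell a (INum 0) (INum 0)"

definition read_cmd :: cmd where
  "read_cmd = Fill 0 5 (ISum (IVar 1) (IVar 0)) 6 (IVar 2) (Inp (IVar 5) (IVar 6))"

definition gs_cmd :: cmd where
  "gs_cmd = For 4 (IVar 2) (Fill 0 5 (ISum (IVar 1) (IVar 0)) 6 (IVar 2)
     (IfIdx (IVar 4) (IVar 6)
       (Bin Minus (Cell 0 (IVar 5) (IVar 6))
         (Bin Times (Bin Divide (gram_exp 4 6) (gram_exp 4 4)) (Cell 0 (IVar 5) (IVar 4))))
       (Cell 0 (IVar 5) (IVar 6))))"

definition diag_cmd :: cmd where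
  "diag_cmd = Fill 1 5 (IVar 2) 6 (INum 1) (IfLess (Num 0) (gram_exp 5 5) (gram_exp 5 5) (Num 1))"

definition hi_cmd :: cmd where
  "hi_cmd = set_scalar 2 (Sum 7 (IVar 2) (Sum 8 (IVar 1) (Sum 9 (IVar 0) (abs_exp
     (Bin Divide (Bin Times (Cell 0 (IVar 8) (IVar 7)) (Cell 0 (ISum (IVar 1) (IVar 9)) (IVar 7)))
       (Cell 1 (IVar 7) (INum 0)))))))"

definition test_mat_cmd :: cmd where
  "test_mat_cmd = Fill 5 5 (IVar 2) 6 (IVar 2) (Bin Minus
     (IfIdx (IVar 5) (IVar 6) (Num 0) (IfIdx (IVar 6) (IVar 5) (Num 0)
       (Bin Times (Bin Times (scalar 4) (scalar 4)) (Cell 1 (IVar 5) (INum 0)))))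
     (Sum 7 (IVar 1) (Bin Times (Cell 0 (IVar 7) (IVar 5)) (Cell 0 (IVar 7) (IVar 6)))))"

text \<open>The verdict starts at \<open>1\<close> and becomes \<open>0\<close> at the first pivot that is not positive; the elimination
  then continues with irrelevant values.\<close>

definition pd_cmd :: cmd where
  "pd_cmd = Then (set_scalar 6 (Num 1)) (For 8 (IVar 2) (Then
     (set_scalar 6 (IfLess (Num 0) (Cell 5 (IVar 8) (IVar 8)) (scalar 6) (Num 0)))
     (Fill 5 5 (IVar 2) 6 (IVar 2) (Bin Minus (Cell 5 (IVar 5) (IVar 6))
       (Bin Divide (Bin Times (Cell 5 (IVar 5) (IVar 8)) (Cell 5 (IVar 8) (IVar 6)))
         (Cell 5 (IVar 8) (IVar 8)))))))"

definition bisect_step_cmd :: cmd where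
  "bisect_step_cmd = Then (set_scalar 4 (Bin Divide (Bin Plus (scalar 3) (scalar 2)) (Num 2)))
     (Then test_mat_cmd (Then pd_cmd
     (Then (set_scalar 2 (IfLess (Num 0) (scalar 6) (scalar 4) (scalar 2)))
       (set_scalar 3 (IfLess (Num 0) (scalar 6) (scalar 3) (scalar 4))))))"

text \<open>Besides the \<open>k\<close> rounds for the accuracy there are \<open>n + m + l\<close> rounds for the factor \<open>n m l\<close> by which
  the initial upper end may exceed the norm.\<close>

definition bisect_cmd :: cmd where
  "bisect_cmd = For 4 (ISum (IVar 3) (ISum (IVar 2) (ISum (IVar 1) (IVar 0)))) bisect_step_cmd"

definition norm_cmd :: cmd where
  "norm_cmd = Then read_cmd (Then gs_cmd (Then diag_cmd (Then hi_cmd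
     (Then (set_scalar 3 (Num 0)) bisect_cmd))))"

lemma norm_cmd_ok: "cmd_ok {0, 1, 2, 3} norm_cmd"
  by (simp add: norm_cmd_def read_cmd_def gs_cmd_def diag_cmd_def hi_cmd_def set_scalar_def
      bisect_cmd_def bisect_step_cmd_def test_mat_cmd_def pd_cmd_def gram_exp_def abs_exp_def)

definition dims :: "(nat \<Rightarrow> nat) \<Rightarrow> nat \<Rightarrow> nat \<Rightarrow> nat \<Rightarrow> bool" where
  "dims e l m n \<longleftrightarrow> e 0 = l \<and> e 1 = m \<and> e 2 = n"

lemma rval_gram_exp:
  assumes "dims e l m n" "c \<noteq> 7" "c' \<noteq> 7"
  shows "rval inp M e (gram_exp c c') = ip m l (M 0) (e c) (e c')"
  using assms by (simp add: gram_exp_def ip_def dims_def)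

lemma rval_abs_exp: "rval inp M e (abs_exp x) = \<bar>rval inp M e x\<bar>"
  by (simp add: abs_exp_def)

lemma sem_set_scalar:
  "sem inp e (set_scalar a x) M b = (if b = a then
     (\<lambda>i j. if i < 1 \<and> j < 1 then rval inp M (e(10 := i, 11 := j)) x else M a i j) else M b)"
  by (simp add: set_scalar_def)

lemma gs_cmd_correct:
  assumes e: "dims e l m n"
  shows "same_range (m + l) n (M 0) (sem inp e gs_cmd M 0)"
    "orth_upto m l n n (sem inp e gs_cmd M 0)"
proof -
  define P where "P = (\<lambda>i M'. same_range (m + l) n (M 0) (M' 0) \<and> orth_upto m l n i (M' (0::nat)))"
  have "P (ix_val e (IVar 2)) (sem inp e gs_cmd M)"
    unfolding gs_cmd_def
  proof (rule sem_For_invariant)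
    show "P 0 M" by (simp add: P_def same_range_refl orth_upto_def)
    fix i M' assume i: "i < ix_val e (IVar 2)" and P: "P i M'"
    let ?c = "Fill 0 5 (ISum (IVar 1) (IVar 0)) 6 (IVar 2)
     (IfIdx (IVar 4) (IVar 6)
       (Bin Minus (Cell 0 (IVar 5) (IVar 6))
         (Bin Times (Bin Divide (gram_exp 4 6) (gram_exp 4 4)) (Cell 0 (IVar 5) (IVar 4))))
       (Cell 0 (IVar 5) (IVar 6)))"
    have d: "dims (e(4 := i, 5 := r, 6 := c)) l m n" for r c
      using e by (simp add: dims_def)
    have i': "i < n" using i e by (simp add: dims_def)
    have step: "sem inp (e(4 := i)) ?c M' 0 r c = gs_step m l i (M' 0) r c"
      if "r < m + l" "c < n" for r c
      using that e by (simp add: rval_gram_exp[OF d] gs_step_def dims_def)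
    have inv: "same_range (m + l) n (M 0) (M' 0)" "orth_upto m l n i (M' 0)"
      using P by (simp_all add: P_def)
    show "P (Suc i) (sem inp (e(4 := i)) ?c M')"
      unfolding P_def
      using gs_step_correct[OF i' inv(2) step] same_range_trans[OF inv(1)] by blast
  qed
  then show "same_range (m + l) n (M 0) (sem inp e gs_cmd M 0)"
    "orth_upto m l n n (sem inp e gs_cmd M 0)"
    using e by (simp_all add: P_def dims_def)
qed

lemma pd_cmd_frame: "b \<noteq> 5 \<Longrightarrow> b \<noteq> 6 \<Longrightarrow> sem inp e pd_cmd M b = M b"
proof -
  assume b: "b \<noteq> 5" "b \<noteq> 6"
  define P where "P = (\<lambda>(i::nat) M'. M' b = M b)"
  let ?M = "sem inp e (set_scalar 6 (Num 1)) M"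
  let ?c = "Then
     (set_scalar 6 (IfLess (Num 0) (Cell 5 (IVar 8) (IVar 8)) (scalar 6) (Num 0)))
     (Fill 5 5 (IVar 2) 6 (IVar 2) (Bin Minus (Cell 5 (IVar 5) (IVar 6))
       (Bin Divide (Bin Times (Cell 5 (IVar 5) (IVar 8)) (Cell 5 (IVar 8) (IVar 6)))
         (Cell 5 (IVar 8) (IVar 8)))))"
  have "P (ix_val e (IVar 2)) (sem inp e (For 8 (IVar 2) ?c) ?M)"
    by (rule sem_For_invariant) (use b in \<open>auto simp: P_def sem_set_scalar\<close>)
  then show "sem inp e pd_cmd M b = M b" by (simp add: pd_cmd_def P_def)
qed

text \<open>As long as the verdict is \<open>1\<close>, the definiteness of the original matrix is equivalent to that of the
  remaining block. A nonpositive pivot refutes it for good.\<close>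

lemma pd_cmd_correct:
  assumes e: "dims e l m n" and sym: "\<And>j k. j < n \<Longrightarrow> k < n \<Longrightarrow> M 5 j k = M 5 k j"
  shows "0 < sem inp e pd_cmd M 6 0 0 \<longleftrightarrow> pd_from n 0 (M 5)"
proof -
  define P where "P = (\<lambda>i (M' :: mem).
    M' 6 0 0 = 1 \<and> reduced n i (M' 5) \<and> (pd_from n 0 (M 5) \<longleftrightarrow> pd_from n i (M' 5)) \<or>
    M' 6 0 0 = (0::real) \<and> \<not> pd_from n 0 (M 5))"
  let ?M = "sem inp e (set_scalar 6 (Num 1)) M"
  let ?F = "Fill 5 5 (IVar 2) 6 (IVar 2) (Bin Minus (Cell 5 (IVar 5) (IVar 6))
       (Bin Divide (Bin Times (Cell 5 (IVar 5) (IVar 8)) (Cell 5 (IVar 8) (IVar 6)))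
         (Cell 5 (IVar 8) (IVar 8))))"
  let ?T = "set_scalar 6 (IfLess (Num 0) (Cell 5 (IVar 8) (IVar 8)) (scalar 6) (Num 0))"
  have "P (ix_val e (IVar 2)) (sem inp e (For 8 (IVar 2) (Then ?T ?F)) ?M)"
  proof (rule sem_For_invariant)
    show "P 0 ?M" using sym by (simp add: P_def sem_set_scalar reduced_def)
    fix i M' assume i: "i < ix_val e (IVar 2)" and P: "P i M'"
    have i': "i < n" using i e by (simp add: dims_def)
    let ?M1 = "sem inp (e(8 := i)) ?T M'"
    let ?M2 = "sem inp (e(8 := i)) (Then ?T ?F) M'"
    have ok: "?M2 6 0 0 = (if 0 < M' 5 i i then M' 6 0 0 else 0)"
      by (simp add: sem_set_scalar)
    have S: "?M2 5 j k = eliminate i (M' 5) j k" if "j < n" "k < n" for j k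
      using that e by (simp add: sem_set_scalar eliminate_def dims_def)
    show "P (Suc i) ?M2"
    proof (cases "M' 6 0 0 = 1 \<and> reduced n i (M' 5) \<and> (pd_from n 0 (M 5) \<longleftrightarrow> pd_from n i (M' 5))")
      case True
      show ?thesis
      proof (cases "0 < M' 5 i i")
        case piv: True
        have "reduced n (Suc i) (?M2 5)"
        proof (rule reduced_cong[THEN iffD2])
          show "reduced n (Suc i) (eliminate i (M' 5))"
            by (rule reduced_eliminate) (use i' True piv in auto)
          show "?M2 5 j k = eliminate i (M' 5) j k" if "j < n" "k < n" for j k by (rule S[OF that])
          show "Suc i \<le> n" using i' by simp
        qed
        moreover have "pd_from n 0 (M 5) \<longleftrightarrow> pd_from n (Suc i) (?M2 5)"
        proof -
          have "pd_from n (Suc i) (?M2 5) \<longleftrightarrow> pd_from n (Suc i) (eliminate i (M' 5))"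
            by (rule pd_from_cong) (rule S)
          then show ?thesis using pd_from_eliminate[OF i', of "M' 5"] piv True by blast
        qed
        moreover have "?M2 6 0 0 = 1" unfolding ok using piv True by simp
        ultimately show ?thesis unfolding P_def by blast
      next
        case False
        then have "\<not> pd_from n 0 (M 5)" using pd_from_pivot[OF i'] True by blast
        moreover have "?M2 6 0 0 = 0" unfolding ok using False by simp
        ultimately show ?thesis unfolding P_def by blast
      qed
    next
      case False
      then have "M' 6 0 0 = 0" "\<not> pd_from n 0 (M 5)" using P unfolding P_def by blast+
      moreover from this have "?M2 6 0 0 = 0" unfolding ok by simp
      ultimately show ?thesis unfolding P_def by blast
    qed
  qed
  moreover have "pd_from n n S" for S by (auto simp: pd_from_def)
  ultimately show ?thesis using e by (auto simp: P_def pd_cmd_def dims_def)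
qed

text \<open>A positive verdict at the midpoint makes it an upper bound for the norm, a negative one a lower
  bound.\<close>

lemma bisect_step_correct:
  fixes inp :: "nat \<Rightarrow> real"
  assumes e: "dims e l m n" and orth: "orth_upto m l n n (M 0)" and F: "least_bound m l n (M 0) F"
    and D: "\<And>c. c < n \<Longrightarrow> M 1 c 0 = diag m l (M 0) c"
    and lo: "0 \<le> M 3 0 0" "M 3 0 0 \<le> F" and hi: "F \<le> M 2 0 0"
  defines "M' \<equiv> sem inp e bisect_step_cmd M"
  shows "M' 0 = M 0" "M' 1 = M 1" "0 \<le> M' 3 0 0" "M' 3 0 0 \<le> F" "F \<le> M' 2 0 0"
    "M' 2 0 0 - M' 3 0 0 = (M 2 0 0 - M 3 0 0) / 2"
proof -
  define M1 where "M1 = sem inp e (set_scalar 4 (Bin Divide (Bin Plus (scalar 3) (scalar 2)) (Num 2))) M"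
  define t where "t = (M 3 0 0 + M 2 0 0) / 2"
  define M2 where "M2 = sem inp e test_mat_cmd M1"
  define M3 where "M3 = sem inp e pd_cmd M2"
  have M1: "M1 4 0 0 = t" "b \<noteq> 4 \<Longrightarrow> M1 b = M b" for b
    by (simp_all add: M1_def sem_set_scalar t_def)
  have M2: "b \<noteq> 5 \<Longrightarrow> M2 b = M1 b" for b
    by (simp add: M2_def test_mat_cmd_def)
  have S: "M2 5 j k = test_mat m l (M 0) t j k" if "j < n" "k < n" for j k
    using that e D by (simp add: M2_def test_mat_cmd_def test_mat_def M1 dims_def)
  have M3: "b \<noteq> 5 \<Longrightarrow> b \<noteq> 6 \<Longrightarrow> M3 b = M2 b" for b
    by (simp add: M3_def pd_cmd_frame)
  have "M2 5 j k = M2 5 k j" if "j < n" "k < n" for j k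
    unfolding S[OF that] S[OF that(2,1)] by (simp add: test_mat_def mult.commute)
  then have "0 < M3 6 0 0 \<longleftrightarrow> pd_from n 0 (M2 5)"
    unfolding M3_def by (rule pd_cmd_correct[OF e])
  moreover have "pd_from n 0 (M2 5) \<longleftrightarrow> pd_from n 0 (test_mat m l (M 0) t)"
    by (rule pd_from_cong) (rule S)
  ultimately have ok: "0 < M3 6 0 0 \<longleftrightarrow> pd_from n 0 (test_mat m l (M 0) t)" by blast
  have M': "M' 0 = M 0" "M' 1 = M 1"
    "M' 2 0 0 = (if 0 < M3 6 0 0 then t else M 2 0 0)"
    "M' 3 0 0 = (if 0 < M3 6 0 0 then M 3 0 0 else t)"
    unfolding M'_def bisect_step_cmd_def
    by (simp_all add: M1_def[symmetric] M2_def[symmetric] M3_def[symmetric] sem_set_scalar M3 M2 M1)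
  have t0: "0 \<le> t" using lo hi by (simp add: t_def)
  have FB: "ratio_bound m l n (M 0) F" using F by (simp add: least_bound_def)
  have "F \<le> t" if "0 < M3 6 0 0"
    using ratio_bound_if_pd[OF orth FB t0] that ok F by (simp add: least_bound_def)
  moreover have "t \<le> F" if "\<not> 0 < M3 6 0 0"
    using le_bound_if_not_pd[OF orth FB] that ok by simp
  ultimately show "M' 0 = M 0" "M' 1 = M 1" "0 \<le> M' 3 0 0" "M' 3 0 0 \<le> F" "F \<le> M' 2 0 0"
    "M' 2 0 0 - M' 3 0 0 = (M 2 0 0 - M 3 0 0) / 2"
    using M' lo hi t0 by (auto simp: t_def field_simps)
qed

text \<open>The norm stays in the interval, whose length is halved in each round, and the initial length is at
  most \<open>n m l F\<close>.\<close>

lemma bisect_correct: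
  assumes e: "dims e l m n" and orth: "orth_upto m l n n (M 0)" and F: "least_bound m l n (M 0) F"
    and D: "\<And>c. c < n \<Longrightarrow> M 1 c 0 = diag m l (M 0) c"
    and lo: "M 3 0 0 = 0" and hi: "M 2 0 0 = entry_sum m l n (M 0)"
  shows "\<bar>sem inp e bisect_cmd M 2 0 0 - F\<bar> \<le> F / 2 ^ e 3"
proof -
  define h where "h = entry_sum m l n (M 0)"
  define P where "P = (\<lambda>i M'. M' 0 = M 0 \<and> M' (1::nat) = M 1 \<and> 0 \<le> M' 3 0 0 \<and> M' 3 0 0 \<le> F \<and>
    F \<le> M' 2 0 0 \<and> M' 2 0 0 - M' 3 0 0 = h / 2 ^ i)"
  let ?t = "ISum (IVar 3) (ISum (IVar 2) (ISum (IVar 1) (IVar 0)))"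
  have FB: "ratio_bound m l n (M 0) F" using F by (simp add: least_bound_def)
  have F0: "0 \<le> F" using FB by (simp add: ratio_bound_def)
  have "P (ix_val e ?t) (sem inp e bisect_cmd M)"
    unfolding bisect_cmd_def
  proof (rule sem_For_invariant)
    have "F \<le> h" using F ratio_bound_entry_sum[OF orth FB] by (simp add: least_bound_def h_def)
    then show "P 0 M" using lo hi F0 by (simp add: P_def h_def)
    fix i M' assume "P i M'"
    then have P: "M' 0 = M 0" "M' 1 = M 1" "0 \<le> M' 3 0 0" "M' 3 0 0 \<le> F" "F \<le> M' 2 0 0"
      "M' 2 0 0 - M' 3 0 0 = h / 2 ^ i" by (simp_all add: P_def)
    have d: "dims (e(4 := i)) l m n" using e by (simp add: dims_def)
    have orth': "orth_upto m l n n (M' 0)" and F': "least_bound m l n (M' 0) F"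
      and D': "\<And>c. c < n \<Longrightarrow> M' 1 c 0 = diag m l (M' 0) c"
      using orth F D P(1,2) by simp_all
    show "P (Suc i) (sem inp (e(4 := i)) bisect_step_cmd M')"
      using bisect_step_correct[OF d orth' F' D' P(3-5)] P by (simp add: P_def)
  qed
  then have "\<bar>sem inp e bisect_cmd M 2 0 0 - F\<bar> \<le> h / 2 ^ ix_val e ?t"
    by (simp add: P_def)
  also have "\<dots> \<le> real (n * m * l) * F / 2 ^ ix_val e ?t"
    using entry_sum_le[OF orth FB] by (simp add: h_def divide_right_mono)
  also have "\<dots> = real (n * m * l) / (2 ^ n * 2 ^ m * 2 ^ l) * (F / 2 ^ e 3)"
    using e by (simp add: dims_def power_add)
  also have "\<dots> \<le> 1 * (F / 2 ^ e 3)"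
  proof (rule mult_right_mono)
    have "real j \<le> 2 ^ j" for j by (rule less_imp_le[OF of_nat_less_two_power])
    then have "real n * real m * real l \<le> 2 ^ n * 2 ^ m * 2 ^ l" by (intro mult_mono) auto
    then show "real (n * m * l) / (2 ^ n * 2 ^ m * 2 ^ l) \<le> 1" by simp
  qed (use F0 in simp)
  finally show ?thesis by simp
qed

lemma norm_cmd_correct:
  assumes e: "dims e l m n"
    and K: "\<And>r c. r < m + l \<Longrightarrow> c < n \<Longrightarrow> K r c = inp (c + r * n)"
    and F: "least_bound m l n K F"
  shows "\<bar>sem inp e norm_cmd M 2 0 0 - F\<bar> \<le> F / 2 ^ e 3"
proof -
  define M1 where "M1 = sem inp e read_cmd M"
  define M2 where "M2 = sem inp e gs_cmd M1"
  define M3 where "M3 = sem inp e diag_cmd M2"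
  define M4 where "M4 = sem inp e hi_cmd M3"
  define M5 where "M5 = sem inp e (set_scalar 3 (Num 0)) M4"
  have M1: "M1 0 r c = K r c" if "r < m + l" "c < n" for r c
    using that e by (simp add: M1_def read_cmd_def K dims_def)
  have "lin n (M1 0) x r = lin n K x r" if "r < m + l" for x r
    unfolding lin_def using M1[OF that] by (intro sum.cong) auto
  then have "same_range (m + l) n K (M1 0)"
    by (rule same_range_eq)
  then have F1: "least_bound m l n (M1 0) F" using F least_bound_same_range by blast
  note gs = gs_cmd_correct[OF e, where M = M1 and inp = inp, folded M2_def]
  have F2: "least_bound m l n (M2 0) F" using F1 least_bound_same_range[OF gs(1)] by blast
  have M3: "M3 0 = M2 0" by (simp add: M3_def diag_cmd_def)
  have d: "dims (e(5 := c, 6 := d)) l m n" for c d using e by (simp add: dims_def)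
  have D: "M3 1 c 0 = diag m l (M2 0) c" if "c < n" for c
    using that e by (simp add: M3_def diag_cmd_def rval_gram_exp[OF d] diag_def dims_def)
  have M4: "M4 0 = M2 0" "M4 1 = M3 1" by (simp_all add: M4_def hi_cmd_def sem_set_scalar M3)
  have "M4 2 0 0 = entry_sum m l n (M2 0)"
    unfolding entry_sum_def
    using e by (simp add: M4_def hi_cmd_def sem_set_scalar rval_abs_exp M3 dims_def D[unfolded One_nat_def])
  moreover have M5: "M5 0 = M2 0" "M5 1 = M3 1" "M5 2 = M4 2" "M5 3 0 0 = 0"
    by (simp_all add: M5_def sem_set_scalar M4 M4[unfolded One_nat_def])
  moreover have "sem inp e norm_cmd M = sem inp e bisect_cmd M5"
    unfolding norm_cmd_def sem.simps(2) M1_def M2_def M3_def M4_def M5_def by (rule refl)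
  ultimately show ?thesis using bisect_correct[OF e, where M = M5 and F = F and inp = inp] gs(2) F2 D by simp
qed

section \<open>The maximum and its evaluation in polynomial time\<close>

lemma spectral_norm_poly_time:
  "poly_time_evaluable (\<lambda>A B. injective_mat B \<or> mat_kernel B \<subseteq> mat_kernel A)
     (\<lambda>A B. spectral_norm (A * pinv B))"
proof -
  obtain d where d: "\<And>l m n k A B. A \<in> carrier_mat m n \<Longrightarrow> B \<in> carrier_mat l n \<Longrightarrow>
    \<exists>t s. exec (program_code 2 norm_cmd) (input_state k A B) t s \<and> t \<le> d * (l + m + n + k + 1) ^ d \<and>
      output_value s = sem (snd (input_state k A B)) (fst (input_state k A B)) norm_cmd (\<lambda>_ _ _. 0) 2 0 0"
    using program_code_correct[OF norm_cmd_ok, of 2] by blast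
  show ?thesis unfolding poly_time_evaluable_def
  proof (rule exI[of _ "program_code 2 norm_cmd"], rule exI[of _ d], intro allI ballI impI)
    fix l m n k and A B :: "real mat"
    assume A: "A \<in> carrier_mat m n" and B: "B \<in> carrier_mat l n"
      and P: "injective_mat B \<or> mat_kernel B \<subseteq> mat_kernel A"
    have ker: "mat_kernel B \<subseteq> mat_kernel A" using P injective_kernel[OF A B] by blast
    define e where "e = fst (input_state k A B)"
    define inp where "inp = snd (input_state k A B)"
    define F where "F = spectral_norm (A * pinv B)"
    have e: "dims e l m n" "e 3 = k"
      using A B by (simp_all add: e_def input_state_def Let_def dims_def)
    define K where "K = (\<lambda>r c. inp (c + r * n))"
    have KA: "K r c = A $$ (r, c)" if "r < m" "c < n" for r c
    proof -
      have "c + r * n < m * n"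
      proof -
        have "c + r * n < Suc r * n" using that by simp
        also have "\<dots> \<le> m * n" using that by (intro mult_le_mono1) simp
        finally show ?thesis .
      qed
      then show ?thesis using A that by (simp add: K_def inp_def input_state_def Let_def)
    qed
    have KB: "K (m + s) c = B $$ (s, c)" if "s < l" "c < n" for s c
    proof -
      have "c + (m + s) * n < (m + l) * n"
      proof -
        have "c + (m + s) * n < Suc (m + s) * n" using that by simp
        also have "\<dots> \<le> (m + l) * n" using that by (intro mult_le_mono1) simp
        finally show ?thesis .
      qed
      moreover have "c + (m + s) * n = m * n + (c + s * n)" by (simp add: distrib_right)
      ultimately show ?thesis using A B that
        by (simp add: K_def inp_def input_state_def Let_def)
    qed
    have F: "least_bound m l n K F"
      unfolding F_def by (rule least_bound_spectral_norm[OF A B ker KA KB])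
    have "\<bar>sem inp e norm_cmd (\<lambda>_ _ _. 0) 2 0 0 - F\<bar> \<le> F / 2 ^ e 3"
      by (rule norm_cmd_correct[OF e(1) _ F]) (simp add: K_def)
    moreover have "0 \<le> F" unfolding F_def by (rule spectral_norm_nonneg)
    ultimately show "\<exists>t s. exec (program_code 2 norm_cmd) (input_state k A B) t s \<and>
      t \<le> d * (l + m + n + k + 1) ^ d \<and>
      \<bar>output_value s - spectral_norm (A * pinv B)\<bar> \<le> \<bar>spectral_norm (A * pinv B)\<bar> / 2 ^ k"
      using d[OF A B, of k] unfolding F_def e(2) e_def[symmetric] inp_def[symmetric]
      by (metis abs_of_nonneg)
  qed
qed

theorem theorem4p3:
  fixes A B :: "real mat" and l m n :: nat
  assumes "A \<in> carrier_mat m n" and "B \<in> carrier_mat l n"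
  shows "(injective_mat B \<or> mat_kernel B \<subseteq> mat_kernel A \<longrightarrow>
            is_max_value (objective_values A B) (ereal (spectral_norm (A * pinv B)))) \<and>
         poly_time_evaluable (\<lambda>A B. injective_mat B \<or> mat_kernel B \<subseteq> mat_kernel A)
           (\<lambda>A B. spectral_norm (A * pinv B)) \<and>
         (\<not> mat_kernel B \<subseteq> mat_kernel A \<longrightarrow>
            is_max_value (objective_values A B) \<infinity>)"
proof (intro conjI impI spectral_norm_poly_time)
  assume "injective_mat B \<or> mat_kernel B \<subseteq> mat_kernel A"
  then have "mat_kernel B \<subseteq> mat_kernel A" using injective_kernel[OF assms] by blast
  from objective_values_eq_ball_values[OF assms this]
  show "is_max_value (objective_values A B) (ereal (spectral_norm (A * pinv B)))"
    unfolding is_max_value_def using spectral_norm_max by auto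
next
  assume "\<not> mat_kernel B \<subseteq> mat_kernel A"
  then show "is_max_value (objective_values A B) \<infinity>"
    using unbounded_objective[OF assms] by (simp add: is_max_value_def)
qed

end
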